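(* Let $d\ge1$, let $f\in\mathcal{S}_d$ be a standard Schur function, $r:\mathbb{Z}_+\to\mathbb{D}$ its sequence of Schur parameters, and $\mu_f$ its probability measure on $\mathbb{T}^d$. Write $d\mu_f=w\,d\tau+d\sigma$, where $\sigma$ is singular with respect to normalized Lebesgue measure $\tau$ on $\mathbb{T}^d$. Then $$\int_{\mathbb{T}^d}\log w\,d\tau=\sum_{j=1}^\infty\log(1-|r_j|^2).$$
   Context: Both sides of the identity are understood as elements of $[-\infty,\infty)$. Notation. $\mathbb{D}$ is the open unit disk, $\overline{\mathbb{D}}$ its closure, $\mathbb{T}$ the unit circle, $\mathbb{Z}_+$ the nonnegative integers. $\mathcal{H}_d$ is the set of all holomorphic functions $h:\mathbb{D}^d\to\overline{\mathbb{D}}$, with the topology of uniform convergence on compact sets. $\mathbf{c}_r$ denotes the constant function with value $r$. For $1\le j\le d$ and $r\in\overline{\mathbb{D}}$ define operators on $\mathcal{H}_d$ by $(\mathfrak{m}_jh)(z)=z_jh(z)$; $(\mathfrak{g}_rh)(z)=\frac{h(z)+r}{1+\overline{r}h(z)}$ if $r\in\mathbb{D}$, and $\mathfrak{g}_rh=\mathbf{c}_r$ if $r\in\mathbb{T}$. Schur functions. $\mathcal{S}_d$ is the closure in $\mathcal{H}_d$ of the set of all functions $\mathfrak{g}_{r_0}\mathfrak{m}_{\nu_1}\cdots\mathfrak{g}_{r_{k-1}}\mathfrak{m}_{\nu_k}\mathbf{c}_0$ with $k\ge1$, $r_i\in\mathbb{D}$, $\nu_i\in\{1,\dots,d\}$;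 its elements are called Schur functions. Every $f\in\mathcal{S}_d$ can be written $f=\mathfrak{g}_r\mathfrak{m}_jh$ with $r=f(0)$, some $1\le j\le d$, some $h\in\mathcal{S}_d$. Starting with $h_0=f$, iterate: set $r_n=h_n(0)$ and choose $\nu_{n+1}\in\{1,\dots,d\}$, $h_{n+1}\in\mathcal{S}_d$ with $h_n=\mathfrak{g}_{r_n}\mathfrak{m}_{\nu_{n+1}}h_{n+1}$ (if $h_n$ is constant, take $\nu_{n+1}=1$, $h_{n+1}=\mathbf{c}_0$). The numbers $r_n$ $(n\ge0)$, which do not depend on the choices made, are the Schur parameters of $f$. $f$ is standard if $f(0)=0$ and $|r_n|<1$ for all $n\ge0$. Measure. For $z=(s_1e^{i\phi_1},\dots,s_de^{i\phi_d})\in\mathbb{D}^d$ the Poisson kernel is $K_z(e^{i\theta_1},\dots,e^{i\theta_d})=\prod_{j=1}^d\frac{1-s_j^2}{1-2s_j\cos(\phi_j-\theta_j)+s_j^2}$. For $f\in\mathcal{H}_d$ with $f(0)=0$, $\mu_f$ is the unique positive Borel measure on $\mathbb{T}^d$ (a probability measure) with $\Re\frac{1+f(z)}{1-f(z)}=\int_{\mathbb{T}^d}K_z\,d\mu_f$ for all $z\in\mathbb{D}^d$. *)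

theory Defs
  imports "HOL-Analysis.Analysis"
begin

section \<open>The class of holomorphic self-maps\<close>

text \<open>
  The coordinates are indexed by a finite type, whose cardinality is the dimension.
  Functions on the polydisk are represented by total functions; only their values on the
  polydisk are ever used.
\<close>

definition polydisk :: "(complex ^ 'd) set" where
  "polydisk = {z. \<forall>j. norm (z $ j) < 1}"

definition torus :: "(complex ^ 'd) set" where
  "torus = {\<zeta>. \<forall>j. norm (\<zeta> $ j) = 1}"

definition holomorphic_on_polydisk :: "(complex ^ 'd \<Rightarrow> complex) \<Rightarrow> bool" where
  "holomorphic_on_polydisk h \<longleftrightarrow>
     (\<forall>z\<in>polydisk. \<exists>D. (h has_derivative D) (at z) \<and> (\<forall>c v. D (c *s v) = c * D v))"

definition hol_maps :: "(complex ^ 'd \<Rightarrow> complex) set" where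
  "hol_maps = {h. holomorphic_on_polydisk h \<and> (\<forall>z\<in>polydisk. norm (h z) \<le> 1)}"

definition open_hol_maps :: "(complex ^ 'd \<Rightarrow> complex) set \<Rightarrow> bool" where
  "open_hol_maps U \<longleftrightarrow> U \<subseteq> hol_maps \<and>
     (\<forall>h\<in>U. \<exists>K \<epsilon>. compact K \<and> K \<subseteq> polydisk \<and> 0 < \<epsilon> \<and>
        (\<forall>g\<in>hol_maps. (\<forall>z\<in>K. dist (g z) (h z) < \<epsilon>) \<longrightarrow> g \<in> U))"

definition hol_maps_topology :: "(complex ^ 'd \<Rightarrow> complex) topology" where
  "hol_maps_topology = topology open_hol_maps"

lemma open_hol_maps_subset: "open_hol_maps U \<Longrightarrow> U \<subseteq> hol_maps"
  unfolding open_hol_maps_def by (rule conjunct1)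

lemma open_hol_mapsE:
  assumes "open_hol_maps U" "h \<in> U"
  obtains K \<epsilon> where "compact K" "K \<subseteq> polydisk" "0 < \<epsilon>"
    "\<forall>g\<in>hol_maps. (\<forall>z\<in>K. dist (g z) (h z) < \<epsilon>) \<longrightarrow> g \<in> U"
proof -
  have "\<forall>h\<in>U. \<exists>K \<epsilon>. compact K \<and> K \<subseteq> polydisk \<and> 0 < \<epsilon> \<and>
      (\<forall>g\<in>hol_maps. (\<forall>z\<in>K. dist (g z) (h z) < \<epsilon>) \<longrightarrow> g \<in> U)"
    using assms(1) unfolding open_hol_maps_def by (rule conjunct2)
  from bspec[OF this assms(2)] show thesis
    by (elim exE conjE) (rule that)
qed

lemma open_hol_mapsI:
  assumes "U \<subseteq> hol_maps"
    and "\<And>h. h \<in> U \<Longrightarrow> \<exists>K \<epsilon>. compact K \<and> K \<subseteq> polydisk \<and> 0 < \<epsilon> \<and>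
      (\<forall>g\<in>hol_maps. (\<forall>z\<in>K. dist (g z) (h z) < \<epsilon>) \<longrightarrow> g \<in> U)"
  shows "open_hol_maps U"
  unfolding open_hol_maps_def by (intro conjI ballI assms)

lemma istopology_open_hol_maps: "istopology open_hol_maps"
  unfolding istopology_def
proof (intro conjI allI impI)
  fix U V :: "(complex ^ 'd \<Rightarrow> complex) set"
  assume U: "open_hol_maps U" and V: "open_hol_maps V"
  show "open_hol_maps (U \<inter> V)"
  proof (rule open_hol_mapsI)
    show "U \<inter> V \<subseteq> hol_maps"
      using open_hol_maps_subset[OF U] by (rule le_infI1)
    fix h assume h: "h \<in> U \<inter> V"
    obtain K1 e1 where 1: "compact K1" "K1 \<subseteq> polydisk" "0 < e1"
        "\<forall>g\<in>hol_maps. (\<forall>z\<in>K1. dist (g z) (h z) < e1) \<longrightarrow> g \<in> U"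
      by (rule open_hol_mapsE[OF U IntD1[OF h]])
    obtain K2 e2 where 2: "compact K2" "K2 \<subseteq> polydisk" "0 < e2"
        "\<forall>g\<in>hol_maps. (\<forall>z\<in>K2. dist (g z) (h z) < e2) \<longrightarrow> g \<in> V"
      by (rule open_hol_mapsE[OF V IntD2[OF h]])
    show "\<exists>K \<epsilon>. compact K \<and> K \<subseteq> polydisk \<and> 0 < \<epsilon> \<and>
        (\<forall>g\<in>hol_maps. (\<forall>z\<in>K. dist (g z) (h z) < \<epsilon>) \<longrightarrow> g \<in> U \<inter> V)"
    proof (rule exI[of _ "K1 \<union> K2"], rule exI[of _ "min e1 e2"], intro conjI ballI impI)
      fix g assume g: "g \<in> hol_maps" "\<forall>z\<in>K1 \<union> K2. dist (g z) (h z) < min e1 e2"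
      show "g \<in> U \<inter> V"
        using bspec[OF 1(4) g(1)] bspec[OF 2(4) g(1)] g(2) by simp
    qed (use 1(1-3) 2(1-3) in \<open>simp_all add: compact_Un\<close>)
  qed
next
  fix \<U> :: "(complex ^ 'd \<Rightarrow> complex) set set"
  assume \<U>: "\<forall>U\<in>\<U>. open_hol_maps U"
  show "open_hol_maps (\<Union>\<U>)"
  proof (rule open_hol_mapsI)
    show "\<Union>\<U> \<subseteq> hol_maps"
      by (rule Union_least) (rule open_hol_maps_subset[OF bspec[OF \<U>]])
    fix h assume "h \<in> \<Union>\<U>"
    then obtain U where U: "U \<in> \<U>" "h \<in> U" by (rule UnionE)
    obtain K \<epsilon> where K: "compact K" "K \<subseteq> polydisk" "0 < \<epsilon>"
        "\<forall>g\<in>hol_maps. (\<forall>z\<in>K. dist (g z) (h z) < \<epsilon>) \<longrightarrow> g \<in> U"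
      by (rule open_hol_mapsE[OF bspec[OF \<U> U(1)] U(2)])
    show "\<exists>K \<epsilon>. compact K \<and> K \<subseteq> polydisk \<and> 0 < \<epsilon> \<and>
        (\<forall>g\<in>hol_maps. (\<forall>z\<in>K. dist (g z) (h z) < \<epsilon>) \<longrightarrow> g \<in> \<Union>\<U>)"
      by (intro exI[of _ K] exI[of _ \<epsilon>] conjI ballI impI K(1-3) UnionI[OF U(1)] bspec[OF K(4), THEN mp])
        (assumption, erule (1) bspec)
  qed
qed

lemma openin_hol_maps_topology: "openin hol_maps_topology U \<longleftrightarrow> open_hol_maps U"
  unfolding hol_maps_topology_def topology_inverse'[OF istopology_open_hol_maps] ..

lemma topspace_hol_maps_topology: "topspace hol_maps_topology = hol_maps"
proof (rule antisym)
  show "topspace hol_maps_topology \<subseteq> hol_maps"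
    unfolding topspace_def openin_hol_maps_topology
    by (rule Union_least) (simp add: open_hol_maps_subset)
  have "open_hol_maps hol_maps"
    by (rule open_hol_mapsI[OF subset_refl], rule exI[of _ "{}"], rule exI[of _ 1]) simp
  then show "hol_maps \<subseteq> topspace hol_maps_topology"
    by (intro openin_subset) (simp add: openin_hol_maps_topology)
qed

section \<open>Schur functions and Schur parameters\<close>

definition mult_op :: "'d \<Rightarrow> (complex ^ 'd \<Rightarrow> complex) \<Rightarrow> complex ^ 'd \<Rightarrow> complex" where
  "mult_op j h = (\<lambda>z. z $ j * h z)"

definition mobius_op :: "complex \<Rightarrow> (complex ^ 'd \<Rightarrow> complex) \<Rightarrow> complex ^ 'd \<Rightarrow> complex" where
  "mobius_op r h = (if norm r < 1 then (\<lambda>z. (h z + r) / (1 + cnj r * h z)) else (\<lambda>_. r))"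

definition schur_generators :: "(complex ^ 'd \<Rightarrow> complex) set" where
  "schur_generators =
     {foldr (\<lambda>(r, j) h. mobius_op r (mult_op j h)) ps (\<lambda>_. 0) | ps.
        ps \<noteq> [] \<and> (\<forall>(r, j)\<in>set ps. norm r < 1)}"

definition schur_class :: "(complex ^ 'd \<Rightarrow> complex) set" where
  "schur_class = hol_maps_topology closure_of schur_generators"

text \<open>
  The parameters are treated as a relation between a function and a sequence, so that no choice
  has to be made in the recursion. For constant \<open>h n\<close> the index \<open>\<nu> (Suc n)\<close> is irrelevant,
  because \<open>h (Suc n)\<close> vanishes, and is left arbitrary.
\<close>

definition schur_parameters :: "(complex ^ 'd \<Rightarrow> complex) \<Rightarrow> (nat \<Rightarrow> complex) \<Rightarrow> bool" where
  "schur_parameters f r \<longleftrightarrow>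
     (\<exists>h \<nu>. h 0 = f \<and>
        (\<forall>n. h n \<in> schur_class \<and> r n = h n 0 \<and>
             (\<forall>z\<in>polydisk. h n z = mobius_op (r n) (mult_op (\<nu> (Suc n)) (h (Suc n))) z) \<and>
             (h n constant_on polydisk \<longrightarrow> h (Suc n) = (\<lambda>_. 0))))"

definition standard_schur :: "(complex ^ 'd \<Rightarrow> complex) \<Rightarrow> (nat \<Rightarrow> complex) \<Rightarrow> bool" where
  "standard_schur f r \<longleftrightarrow>
     f \<in> schur_class \<and> schur_parameters f r \<and> f 0 = 0 \<and> (\<forall>n. norm (r n) < 1)"

section \<open>Measures on the torus\<close>

abbreviation torus_borel :: "(complex ^ 'd) measure" where
  "torus_borel \<equiv> restrict_space borel torus"

definition torus_lebesgue :: "(complex ^ 'd) measure" where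
  "torus_lebesgue =
     distr (uniform_measure lborel {\<theta> :: real ^ 'd. \<forall>j. 0 \<le> \<theta> $ j \<and> \<theta> $ j < 2 * pi})
       torus_borel (\<lambda>\<theta>. \<chi> j. cis (\<theta> $ j))"

definition poisson_kernel :: "complex ^ 'd \<Rightarrow> complex ^ 'd \<Rightarrow> real" where
  "poisson_kernel z \<zeta> =
     (\<Prod>j\<in>UNIV. (1 - (norm (z $ j))\<^sup>2) /
        (1 - 2 * norm (z $ j) * cos (Arg (z $ j) - Arg (\<zeta> $ j)) + (norm (z $ j))\<^sup>2))"

text \<open>
  Such a measure is a probability measure: at \<open>z = 0\<close> the kernel is \<open>1\<close>, so for \<open>f 0 = 0\<close> the
  integral of \<open>1\<close> is \<open>1\<close>, which for the Bochner integral excludes infinite total mass.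
\<close>

definition poisson_measure :: "(complex ^ 'd \<Rightarrow> complex) \<Rightarrow> (complex ^ 'd) measure \<Rightarrow> bool" where
  "poisson_measure f \<mu> \<longleftrightarrow>
     sets \<mu> = sets torus_borel \<and>
     (\<forall>z\<in>polydisk. Re ((1 + f z) / (1 - f z)) = (\<integral>\<zeta>. poisson_kernel z \<zeta> \<partial>\<mu>))"

definition mutually_singular :: "'a measure \<Rightarrow> 'a measure \<Rightarrow> bool" where
  "mutually_singular M N \<longleftrightarrow>
     sets M = sets N \<and> (\<exists>A\<in>sets M. emeasure M A = 0 \<and> emeasure N (space N - A) = 0)"

definition lebesgue_decomposition ::
    "'a measure \<Rightarrow> 'a measure \<Rightarrow> ('a \<Rightarrow> real) \<Rightarrow> 'a measure \<Rightarrow> bool" where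
  "lebesgue_decomposition \<mu> \<tau> w \<sigma> \<longleftrightarrow>
     w \<in> borel_measurable \<tau> \<and> (AE x in \<tau>. 0 \<le> w x) \<and>
     sets \<mu> = sets \<tau> \<and> mutually_singular \<sigma> \<tau> \<and>
     (\<forall>A\<in>sets \<mu>. emeasure \<mu> A = emeasure (density \<tau> (\<lambda>x. ennreal (w x))) A + emeasure \<sigma> A)"

section \<open>Extended-real logarithmic integrals\<close>

definition log_ereal :: "real \<Rightarrow> ereal" where
  "log_ereal x = (if 0 < x then ereal (ln x) else - \<infinity>)"

text \<open>
  Since \<open>\<infinity> - \<infinity> = \<infinity>\<close> in \<^typ>\<open>ereal\<close>, the
  value is meaningful only if one of the parts is finite; for \<open>log w\<close> with \<open>w\<close> integrable the
  positive part is.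
\<close>

definition ereal_integral :: "'a measure \<Rightarrow> ('a \<Rightarrow> ereal) \<Rightarrow> ereal" where
  "ereal_integral M g =
     enn2ereal (\<integral>\<^sup>+x. e2ennreal (g x) \<partial>M) - enn2ereal (\<integral>\<^sup>+x. e2ennreal (- g x) \<partial>M)"

end

theory Submission
  imports Defs "HOL-Complex_Analysis.Cauchy_Integral_Formula" "HOL-Probability.Probability_Measure"
begin

text \<open>
  Let \<open>h 0 = f, h 1, \<dots>\<close> be the iterates of the Schur algorithm, and for \<open>\<rho> < 1\<close> let \<open>W \<zeta>\<close> be the value of
  \<open>Re ((1 + f) / (1 - f)) = (1 - |f|\<^sup>2) / |1 - f|\<^sup>2\<close> at \<open>\<rho> \<zeta>\<close>, which is the Poisson integral of \<open>\<mu>\<close>. The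
  argument takes place on the tori of radius \<open>\<rho> < 1\<close> and replaces boundary values by two limits.

  The first one is \<open>\<integral> log w = lim \<integral> log W\<close> as \<open>\<rho>\<close> tends to \<open>1\<close>. Here \<open>\<le>\<close> holds for every \<open>\<rho>\<close>, because the
  Poisson kernel has integral \<open>1\<close> in each variable and the logarithm is concave
  (\<open>log_integral_le_log_poisson_integral\<close>). The other inequality is the semicontinuity of relative entropy
  under the weak convergence of \<open>W \<tau>\<close> to \<open>\<mu>\<close>: for positive continuous \<open>v\<close> the bound
  \<open>log W \<le> - log v + v W - 1\<close> passes to the limit, it extends to Borel functions \<open>v\<close>, and \<open>v\<close> may be taken
  as a truncation of \<open>1 / w\<close> that is small on a set carrying the singular part
  (\<open>truncated_log_lower_bound\<close>).

  The second one is the evaluation of \<open>\<integral> log W\<close>. Since \<open>log |1 - f|\<close> is the real part of a holomorphic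
  function vanishing at \<open>0\<close>, this integral is \<open>- D (f)\<close>, where \<open>D (h)\<close> is the integral of
  \<open>- log (1 - |h|\<^sup>2)\<close> over the torus of radius \<open>\<rho>\<close> (\<open>log_defect\<close>). For the same reason a step of the algorithm
  gives \<open>D (h n) = - log (1 - |r n|\<^sup>2) + D (z h (Suc n))\<close>, with \<open>z\<close> the chosen coordinate
  (\<open>log_defect_step\<close>). Dropping the factor \<open>z\<close> can only increase \<open>D\<close>. Conversely the expansion
  \<open>- log (1 - |h|\<^sup>2) = \<Sum> |h ^ k|\<^sup>2 / k\<close>, together with the growth of square means of holomorphic functions
  with the radius, shows that \<open>D (h)\<close> at radius \<open>\<rho>\<close> is at most \<open>D (z h) + \<epsilon>\<close> at a larger radius
  (\<open>log_defect_le_mult_larger_radius\<close>). So for every partial sum of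
  \<open>- log (1 - |r j|\<^sup>2)\<close> and every \<open>\<epsilon> > 0\<close> there is a radius at which \<open>D (f)\<close> exceeds the partial sum
  minus \<open>\<epsilon>\<close>. In the other direction \<open>D (f)\<close> is at most such a partial sum plus the remainder
  \<open>D (h n)\<close>. If the sum is finite, then \<open>r n\<close> tends to \<open>0\<close>, and \<open>|h n| \<le> |r n| + \<rho> |h (Suc n)|\<close> forces
  \<open>h n\<close> to tend to \<open>0\<close> uniformly on the torus of radius \<open>\<rho>\<close>, so the remainder vanishes in the limit
  (\<open>log_defect_le_bounded_sum\<close>).
\<close>

section \<open>Means of holomorphic functions over circles\<close>

definition angle_measure :: "real measure" where
  "angle_measure = density lborel (\<lambda>t. ennreal (indicator {0..2 * pi} t / (2 * pi)))"

lemma space_angle_measure [simp]: "space angle_measure = UNIV"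
  and sets_angle_measure [simp, measurable_cong]: "sets angle_measure = sets borel"
  by (simp_all add: angle_measure_def)

lemma prob_space_angle_measure: "prob_space angle_measure"
proof
  have "emeasure angle_measure UNIV = (\<integral>\<^sup>+t. ennreal (1 / (2 * pi)) * indicator {0..2 * pi} t \<partial>lborel)"
    unfolding angle_measure_def
    by (subst emeasure_density) (auto intro!: nn_integral_cong split: split_indicator)
  also have "\<dots> = ennreal (1 / (2 * pi)) * ennreal (2 * pi)"
    by (subst nn_integral_cmult_indicator) auto
  also have "\<dots> = 1"
    by (simp flip: ennreal_mult)
  finally show "emeasure angle_measure (space angle_measure) = 1" by simp
qed

lemma angle_integral_FTC:
  fixes F f :: "real \<Rightarrow> 'a::euclidean_space"
  assumes "\<And>t. (F has_vector_derivative f t) (at t)" and "continuous_on UNIV f"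
  shows "(\<integral>t. f t \<partial>angle_measure) = (F (2 * pi) - F 0) /\<^sub>R (2 * pi)"
proof -
  have [measurable]: "f \<in> borel_measurable borel"
    using assms(2) by (rule borel_measurable_continuous_onI)
  have "(\<integral>t. f t \<partial>angle_measure) = (\<integral>t. (indicator {0..2 * pi} t / (2 * pi)) *\<^sub>R f t \<partial>lborel)"
    unfolding angle_measure_def
  proof (rule integral_density)
    show "(\<lambda>t. indicator {0..2 * pi} t / (2 * pi)) \<in> borel_measurable lborel"
      by (intro borel_measurable_divide borel_measurable_indicator borel_measurable_const) simp
  qed (simp_all add: indicator_def)
  also have "\<dots> = (\<integral>t. inverse (2 * pi) *\<^sub>R (indicator {0..2 * pi} t *\<^sub>R f t) \<partial>lborel)"
    by (simp only: scaleR_scaleR divide_inverse mult.commute)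
  also have "\<dots> = inverse (2 * pi) *\<^sub>R (\<integral>t. indicator {0..2 * pi} t *\<^sub>R f t \<partial>lborel)"
    by (rule integral_scaleR_right) 
  also have "(\<integral>t. indicator {0..2 * pi} t *\<^sub>R f t \<partial>lborel) = F (2 * pi) - F 0"
    using assms by (intro integral_FTC_Icc)
      (auto intro: has_vector_derivative_at_within continuous_on_subset)
  finally show ?thesis .
qed

text \<open>
  Orthogonality of the characters of the circle; it turns termwise integration of power series into
  the mean value property and Parseval's identity.
\<close>

lemma angle_integral_cis:
  "(\<integral>t. cis (of_int n * t) \<partial>angle_measure) = (if n = 0 then 1 else 0)"
proof (cases "n = 0")
  case True
  then show ?thesis
    using prob_space.prob_space[OF prob_space_angle_measure] by simp
next
  case False
  have d: "((\<lambda>t. cis (of_int n * t) / (\<i> * of_int n)) has_vector_derivative cis (of_int n * t)) (at t)" for t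
  proof -
    have "((\<lambda>z. exp (\<i> * of_int n * z) / (\<i> * of_int n)) has_field_derivative exp (\<i> * of_int n * z)) (at z)" for z
      using False by (auto intro!: derivative_eq_intros)
    then have "((\<lambda>z. exp (\<i> * of_int n * z) / (\<i> * of_int n)) has_field_derivative exp (\<i> * of_int n * of_real t)) (at (of_real t))" .
    from has_vector_derivative_real_field[OF this]
    show ?thesis by (simp add: cis_conv_exp mult.assoc)
  qed
  have "(\<integral>t. cis (of_int n * t) \<partial>angle_measure) =
      (cis (of_int n * (2 * pi)) / (\<i> * of_int n) - cis (of_int n * 0) / (\<i> * of_int n)) /\<^sub>R (2 * pi)"
    by (rule angle_integral_FTC[OF d]) (auto intro!: continuous_intros)
  moreover have "cis (of_int n * (2 * pi)) = 1"
    by (metis cis_multiple_2pi mult.commute Ints_of_int)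
  ultimately show ?thesis using False by simp
qed

lemma integrable_angle_continuous:
  fixes f :: "real \<Rightarrow> 'a::{banach, second_countable_topology}"
  assumes "continuous_on UNIV f" "\<And>t. norm (f t) \<le> B"
  shows "integrable angle_measure f"
proof -
  interpret prob_space angle_measure by (rule prob_space_angle_measure)
  have [measurable]: "f \<in> borel_measurable borel"
    using assms(1) by (rule borel_measurable_continuous_onI)
  show ?thesis
    by (rule integrable_const_bound[of _ B]) (use assms(2) in auto)
qed

text \<open>
  Absolute convergence is recorded as well, because it is what makes termwise integration over the
  circles of radius less than \<open>1\<close> legitimate.
\<close>

lemma power_series_of_disc_function:
  assumes "\<phi> holomorphic_on ball 0 1"
  shows "\<exists>a. (\<forall>z. norm z < 1 \<longrightarrow> (\<lambda>n. a n * z ^ n) sums \<phi> z \<and> summable (\<lambda>n. norm (a n * z ^ n))) \<and> a 0 = \<phi> 0"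
proof -
  define a where "a n = (deriv ^^ n) \<phi> 0 / fact n" for n
  have s: "(\<lambda>n. a n * z ^ n) sums \<phi> z" if "norm z < 1" for z
    using holomorphic_power_series[OF assms, of z] that by (simp add: a_def)
  moreover have "summable (\<lambda>n. norm (a n * z ^ n))" if z: "norm z < 1" for z
  proof -
    obtain r where r: "norm z < r" "r < 1" using dense[OF z] by blast
    then have "0 < r" using norm_ge_zero[of z] by linarith
    then have "summable (\<lambda>n. a n * (of_real r) ^ n)"
      using r by (intro sums_summable[OF s]) simp
    then show ?thesis
      by (rule powser_insidea[where f = a and x = "of_real r"]) (use r \<open>0 < r\<close> in auto)
  qed
  ultimately show ?thesis
    by (intro exI[of _ a]) (simp add: a_def)
qed

lemma circle_fourier_coefficient:
  assumes "summable (\<lambda>n. norm (b n))" and "\<And>t. (\<lambda>n. b n * cis (real n * t)) sums g t"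
  shows "(\<integral>t. g t * cis (- real m * t) \<partial>angle_measure) = b m"
    and "continuous_on UNIV g" and "norm (g t) \<le> (\<Sum>n. norm (b n))"
proof -
  have gt: "g t = (\<Sum>n. b n * cis (real n * t))" for t
    using assms(2) by (simp add: sums_iff)
  show "norm (g t) \<le> (\<Sum>n. norm (b n))" for t
    unfolding gt by (rule order_trans[OF summable_norm]) (use assms(1) in \<open>auto simp: norm_mult\<close>)
  have "uniform_limit UNIV (\<lambda>N t. \<Sum>n<N. b n * cis (real n * t)) (\<lambda>t. \<Sum>n. b n * cis (real n * t)) sequentially"
    by (rule Weierstrass_m_test[OF _ assms(1)]) (simp add: norm_mult)
  then have "continuous_on UNIV (\<lambda>t. \<Sum>n. b n * cis (real n * t))"
    by (rule uniform_limit_theorem[rotated])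
      (simp, intro always_eventually allI continuous_intros)
  then show "continuous_on UNIV g" by (simp add: gt[abs_def])
  have *: "b n * cis (real n * t) * cis (- real m * t) = b n * cis (of_int (int n - int m) * t)" for n t
    by (simp add: cis_mult mult.assoc) (simp add: algebra_simps)
  interpret prob_space angle_measure by (rule prob_space_angle_measure)
  have "(\<lambda>n. \<integral>t. b n * cis (real n * t) * cis (- real m * t) \<partial>angle_measure) sums
      (\<integral>t. (\<Sum>n. b n * cis (real n * t) * cis (- real m * t)) \<partial>angle_measure)"
  proof (rule sums_integral)
    show "integrable angle_measure (\<lambda>t. b n * cis (real n * t) * cis (- real m * t))" for n
      by (rule integrable_angle_continuous[of _ "norm (b n)"])
        (auto intro!: continuous_intros simp: norm_mult)
    show "AE t in angle_measure. summable (\<lambda>n. norm (b n * cis (real n * t) * cis (- real m * t)))"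
      using assms(1) by (simp add: norm_mult)
    show "summable (\<lambda>n. \<integral>t. norm (b n * cis (real n * t) * cis (- real m * t)) \<partial>angle_measure)"
      using assms(1) prob_space by (simp add: norm_mult)
  qed
  also have "(\<lambda>t. \<Sum>n. b n * cis (real n * t) * cis (- real m * t)) = (\<lambda>t. g t * cis (- real m * t))"
    by (rule ext, rule sums_unique[OF sums_mult2[OF assms(2)], symmetric])
  also have "(\<lambda>n. \<integral>t. b n * cis (real n * t) * cis (- real m * t) \<partial>angle_measure) =
      (\<lambda>n. if n = m then b n else 0)"
    unfolding * by (intro ext) (simp add: angle_integral_cis[of "int n - int m" for n, simplified])
  finally have "(\<lambda>n. if n = m then b n else 0) sums (\<integral>t. g t * cis (- real m * t) \<partial>angle_measure)" .
  moreover have "(\<lambda>n. if n = m then b n else 0) sums b m"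
    using sums_single[of m b] by simp
  ultimately show "(\<integral>t. g t * cis (- real m * t) \<partial>angle_measure) = b m"
    by (rule sums_unique2)
qed

text \<open>
  Termwise integration of \<open>g\<close> times the series of \<open>cnj g\<close>: each term is a Fourier coefficient of \<open>g\<close>,
  so no double series appears.
\<close>

lemma circle_parseval:
  assumes "summable (\<lambda>n. norm (b n))" and "\<And>t. (\<lambda>n. b n * cis (real n * t)) sums g t"
  shows "(\<lambda>n. (norm (b n))\<^sup>2) sums (\<integral>t. (norm (g t))\<^sup>2 \<partial>angle_measure)"
proof -
  note g = circle_fourier_coefficient[OF assms]
  let ?B = "\<Sum>n. norm (b n)"
  interpret prob_space angle_measure by (rule prob_space_angle_measure)
  have "(\<lambda>n. \<integral>t. cnj (b n) * (g t * cis (- real n * t)) \<partial>angle_measure) sums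
      (\<integral>t. (\<Sum>n. cnj (b n) * (g t * cis (- real n * t))) \<partial>angle_measure)"
  proof (rule sums_integral)
    show 1: "integrable angle_measure (\<lambda>t. cnj (b n) * (g t * cis (- real n * t)))" for n
      by (rule integrable_angle_continuous[of _ "norm (b n) * ?B"])
        (auto intro!: continuous_intros g(2) mult_left_mono g(3) simp: norm_mult)
    show "AE t in angle_measure. summable (\<lambda>n. norm (cnj (b n) * (g t * cis (- real n * t))))"
      using assms(1) by (auto simp: norm_mult intro!: summable_mult2)
    show "summable (\<lambda>n. \<integral>t. norm (cnj (b n) * (g t * cis (- real n * t))) \<partial>angle_measure)"
    proof (rule summable_comparison_test'[of "\<lambda>n. norm (b n) * ?B" 0])
      show "summable (\<lambda>n. norm (b n) * ?B)" using assms(1) by (rule summable_mult2)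
      fix n
      have "(\<integral>t. norm (cnj (b n) * (g t * cis (- real n * t))) \<partial>angle_measure) \<le> (\<integral>t. norm (b n) * ?B \<partial>angle_measure)"
        by (rule integral_mono[OF integrable_norm[OF 1]]) (auto simp: norm_mult intro!: mult_left_mono g(3))
      then show "norm (\<integral>t. norm (cnj (b n) * (g t * cis (- real n * t))) \<partial>angle_measure) \<le> norm (b n) * ?B"
        using prob_space by (simp add: integral_nonneg_AE)
    qed
  qed
  also have "(\<lambda>n. \<integral>t. cnj (b n) * (g t * cis (- real n * t)) \<partial>angle_measure) = (\<lambda>n. of_real ((norm (b n))\<^sup>2))"
    by (simp only: integral_mult_right_zero g(1)) (simp only: complex_norm_square mult.commute)
  also have "(\<lambda>t. \<Sum>n. cnj (b n) * (g t * cis (- real n * t))) = (\<lambda>t. of_real ((norm (g t))\<^sup>2))"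
  proof
    fix t
    have "(\<lambda>n. g t * cnj (b n * cis (real n * t))) sums (g t * cnj (g t))"
      using assms(2)[of t] by (intro sums_mult) (simp only: sums_cnj)
    then have "(\<lambda>n. cnj (b n) * (g t * cis (- real n * t))) sums (g t * cnj (g t))"
      by (simp add: cis_cnj mult.left_commute)
    then show "(\<Sum>n. cnj (b n) * (g t * cis (- real n * t))) = of_real ((norm (g t))\<^sup>2)"
      unfolding complex_norm_square by (rule sums_unique[symmetric])
  qed
  also have "(\<integral>t. complex_of_real ((norm (g t))\<^sup>2) \<partial>angle_measure) =
      complex_of_real (\<integral>t. (norm (g t))\<^sup>2 \<partial>angle_measure)"
    by (rule integral_complex_of_real)
  finally have "(\<lambda>n. complex_of_real ((norm (b n))\<^sup>2)) sums complex_of_real (\<integral>t. (norm (g t))\<^sup>2 \<partial>angle_measure)" .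
  then show ?thesis by (simp only: sums_of_real_iff)
qed

lemma disc_circle_series:
  assumes "\<And>z. norm z < 1 \<Longrightarrow> (\<lambda>n. a n * z ^ n) sums \<phi> z"
    "\<And>z. norm z < 1 \<Longrightarrow> summable (\<lambda>n. norm (a n * z ^ n))" "0 \<le> \<rho>" "\<rho> < 1"
  shows "summable (\<lambda>n. norm (a n * of_real \<rho> ^ n))"
    "(\<lambda>n. a n * of_real \<rho> ^ n * cis (real n * t)) sums \<phi> (of_real \<rho> * cis t)"
proof -
  have "norm (of_real \<rho> :: complex) < 1" "norm (of_real \<rho> * cis t) < 1"
    using assms(3,4) by (simp_all add: norm_mult)
  from assms(2)[OF this(1)] assms(1)[OF this(2)]
  show "summable (\<lambda>n. norm (a n * of_real \<rho> ^ n))"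
    "(\<lambda>n. a n * of_real \<rho> ^ n * cis (real n * t)) sums \<phi> (of_real \<rho> * cis t)"
    by (simp_all only: power_mult_distrib Complex.DeMoivre mult.assoc)
qed

lemma circle_mean_value:
  assumes "\<phi> holomorphic_on ball 0 1" "0 \<le> \<rho>" "\<rho> < 1"
  shows "(\<integral>t. \<phi> (of_real \<rho> * cis t) \<partial>angle_measure) = \<phi> 0"
    and "integrable angle_measure (\<lambda>t. \<phi> (of_real \<rho> * cis t))"
proof -
  obtain a where *: "\<forall>z. norm z < 1 \<longrightarrow> (\<lambda>n. a n * z ^ n) sums \<phi> z \<and> summable (\<lambda>n. norm (a n * z ^ n))"
    and a0: "a 0 = \<phi> 0"
    using power_series_of_disc_function[OF assms(1)] by blast
  have a: "norm z < 1 \<Longrightarrow> (\<lambda>n. a n * z ^ n) sums \<phi> z"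
    "norm z < 1 \<Longrightarrow> summable (\<lambda>n. norm (a n * z ^ n))" for z
    using * by blast+
  note s = disc_circle_series[where a = a and \<phi> = \<phi>, OF a(1,2) assms(2,3)]
  note c = circle_fourier_coefficient[where b = "\<lambda>n. a n * of_real \<rho> ^ n" and g = "\<lambda>t. \<phi> (of_real \<rho> * cis t)", OF s]
  show "(\<integral>t. \<phi> (of_real \<rho> * cis t) \<partial>angle_measure) = \<phi> 0"
    using c(1)[of 0] a0 by simp
  show "integrable angle_measure (\<lambda>t. \<phi> (of_real \<rho> * cis t))"
    by (rule integrable_angle_continuous[OF c(2,3)])
qed

text \<open>
  By Parseval's identity the mean is \<open>\<Sum>n. |a n|\<^sup>2 \<rho> ^ (2 * n)\<close>, and every term increases with \<open>\<rho>\<close>.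
\<close>

lemma circle_square_mean_mono:
  assumes "\<phi> holomorphic_on ball 0 1" "0 \<le> \<rho>" "\<rho> \<le> \<rho>'" "\<rho>' < 1"
  shows "(\<integral>t. (norm (\<phi> (of_real \<rho> * cis t)))\<^sup>2 \<partial>angle_measure)
       \<le> (\<integral>t. (norm (\<phi> (of_real \<rho>' * cis t)))\<^sup>2 \<partial>angle_measure)"
proof -
  obtain a where *: "\<forall>z. norm z < 1 \<longrightarrow> (\<lambda>n. a n * z ^ n) sums \<phi> z \<and> summable (\<lambda>n. norm (a n * z ^ n))"
    and a0: "a 0 = \<phi> 0"
    using power_series_of_disc_function[OF assms(1)] by blast
  have a: "norm z < 1 \<Longrightarrow> (\<lambda>n. a n * z ^ n) sums \<phi> z"
    "norm z < 1 \<Longrightarrow> summable (\<lambda>n. norm (a n * z ^ n))" for z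
    using * by blast+
  have 1: "\<rho> < 1" "0 \<le> \<rho>'" using assms by auto
  show ?thesis
  proof (rule sums_le)
    show "(\<lambda>n. (norm (a n * of_real \<rho> ^ n))\<^sup>2) sums (\<integral>t. (norm (\<phi> (of_real \<rho> * cis t)))\<^sup>2 \<partial>angle_measure)"
      by (rule circle_parseval[where b = "\<lambda>n. a n * of_real \<rho> ^ n" and g = "\<lambda>t. \<phi> (of_real \<rho> * cis t)",
          OF disc_circle_series[where a = a and \<phi> = \<phi>, OF a(1,2) assms(2) 1(1)]])
    show "(\<lambda>n. (norm (a n * of_real \<rho>' ^ n))\<^sup>2) sums (\<integral>t. (norm (\<phi> (of_real \<rho>' * cis t)))\<^sup>2 \<partial>angle_measure)"
      by (rule circle_parseval[where b = "\<lambda>n. a n * of_real \<rho>' ^ n" and g = "\<lambda>t. \<phi> (of_real \<rho>' * cis t)",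
          OF disc_circle_series[where a = a and \<phi> = \<phi>, OF a(1,2) 1(2) assms(4)]])
    show "(norm (a n * of_real \<rho> ^ n))\<^sup>2 \<le> (norm (a n * of_real \<rho>' ^ n))\<^sup>2" for n
      using assms(2,3) by (intro power_mono) (auto simp: norm_mult norm_power intro!: mult_left_mono power_mono)
  qed
qed

lemma ln_series_sums:
  fixes x :: real assumes "0 \<le> x" "x < 1"
  shows "(\<lambda>k. x ^ Suc k / real (Suc k)) sums (- ln (1 - x))"
proof -
  have "(\<lambda>n. - (x ^ n / real n)) sums ln (1 - x)"
    using ln_series'[of "- x"] assms by simp
  then have "(\<lambda>n. x ^ n / real n) sums (- ln (1 - x))"
    using sums_minus by fastforce
  then show ?thesis
    using sums_Suc_iff[of "\<lambda>n. x ^ n / real n"] by simp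
qed

text \<open>
  The expansion \<open>- ln (1 - x) = \<Sum>k. x ^ Suc k / Suc k\<close> reduces the mean of \<open>- ln (1 - |\<phi>|\<^sup>2)\<close> to the square
  means of the holomorphic functions \<open>\<phi> ^ Suc k\<close>.
\<close>

lemma circle_log_mean_sums:
  assumes "\<phi> holomorphic_on ball 0 1" "\<And>z. norm z < 1 \<Longrightarrow> norm (\<phi> z) \<le> c" "c < 1" "0 \<le> \<rho>" "\<rho> < 1"
  shows "(\<lambda>k. (\<integral>t. (norm (\<phi> (of_real \<rho> * cis t) ^ Suc k))\<^sup>2 \<partial>angle_measure) / real (Suc k)) sums
    (\<integral>t. - ln (1 - (norm (\<phi> (of_real \<rho> * cis t)))\<^sup>2) \<partial>angle_measure)"
proof -
  interpret prob_space angle_measure by (rule prob_space_angle_measure)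
  have cont: "continuous_on UNIV (\<lambda>t. \<phi> (of_real \<rho> * cis t))"
    by (rule continuous_on_compose2[OF holomorphic_on_imp_continuous_on[OF assms(1)]])
      (use assms(4,5) in \<open>auto intro!: continuous_intros simp: norm_mult\<close>)
  have c0: "0 \<le> c" using order_trans[OF norm_ge_zero assms(2)[of 0]] by simp
  have b: "norm (\<phi> (of_real \<rho> * cis t)) \<le> c" for t
    using assms(2)[of "of_real \<rho> * cis t"] assms(4,5) by (simp add: norm_mult)
  let ?u = "\<lambda>k t. (norm (\<phi> (of_real \<rho> * cis t) ^ Suc k))\<^sup>2 / real (Suc k)"
  have c2: "c\<^sup>2 < 1" using c0 assms(3) by (simp add: abs_square_less_1)
  have bd: "norm (?u k t) \<le> (c\<^sup>2) ^ Suc k" for k t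
  proof -
    have "norm (\<phi> (of_real \<rho> * cis t)) ^ Suc k \<le> c ^ Suc k"
      by (rule power_mono[OF b norm_ge_zero])
    then have "(norm (\<phi> (of_real \<rho> * cis t) ^ Suc k))\<^sup>2 \<le> (c ^ Suc k)\<^sup>2"
      by (simp add: norm_power power_mono del: power_Suc)
    also have "\<dots> = (c\<^sup>2) ^ Suc k" by (simp only: power_mult[symmetric] mult.commute)
    finally have "(norm (\<phi> (of_real \<rho> * cis t) ^ Suc k))\<^sup>2 \<le> (c\<^sup>2) ^ Suc k" .
    moreover have "(norm (\<phi> (of_real \<rho> * cis t) ^ Suc k))\<^sup>2 / real (Suc k) \<le> (norm (\<phi> (of_real \<rho> * cis t) ^ Suc k))\<^sup>2 / 1"
      by (rule divide_left_mono) auto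
    ultimately show ?thesis by simp
  qed
  have sm: "summable (\<lambda>k. (c\<^sup>2) ^ Suc k)"
    using summable_mult[OF summable_geometric[of "c\<^sup>2"], of "c\<^sup>2"] c2 by simp
  have int: "integrable angle_measure (?u k)" for k
    by (rule integrable_angle_continuous[OF _ bd]) (intro continuous_intros cont, auto)
  have "(\<lambda>k. \<integral>t. ?u k t \<partial>angle_measure) sums (\<integral>t. (\<Sum>k. ?u k t) \<partial>angle_measure)"
  proof (rule sums_integral[OF int])
    show "AE t in angle_measure. summable (\<lambda>k. norm (?u k t))"
      by (rule AE_I2, rule summable_comparison_test'[OF sm, of 0]) (simp only: real_norm_def abs_abs, rule bd[unfolded real_norm_def])
    show "summable (\<lambda>k. \<integral>t. norm (?u k t) \<partial>angle_measure)"
    proof (rule summable_comparison_test'[OF sm, of 0])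
      fix k
      have "(\<integral>t. norm (?u k t) \<partial>angle_measure) \<le> (\<integral>t. (c\<^sup>2) ^ Suc k \<partial>angle_measure)"
        by (rule integral_mono[OF integrable_norm[OF int]]) (rule integrable_const, rule bd)
      then show "norm (\<integral>t. norm (?u k t) \<partial>angle_measure) \<le> (c\<^sup>2) ^ Suc k"
        using prob_space by (simp add: integral_nonneg_AE)
    qed
  qed
  also have "(\<lambda>t. \<Sum>k. ?u k t) = (\<lambda>t. - ln (1 - (norm (\<phi> (of_real \<rho> * cis t)))\<^sup>2))"
  proof
    fix t
    have "(norm (\<phi> (of_real \<rho> * cis t)))\<^sup>2 < 1"
      using b[of t] assms(3) by (simp add: abs_square_less_1)
    from ln_series_sums[OF _ this]
    show "(\<Sum>k. ?u k t) = - ln (1 - (norm (\<phi> (of_real \<rho> * cis t)))\<^sup>2)"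
      by (simp add: sums_iff norm_power power_mult[symmetric] mult.commute del: power_Suc)
  qed
  finally show ?thesis by simp
qed

lemma circle_log_mean_mono:
  assumes "\<phi> holomorphic_on ball 0 1" "\<And>z. norm z < 1 \<Longrightarrow> norm (\<phi> z) \<le> c" "c < 1"
    "0 \<le> \<rho>" "\<rho> \<le> \<rho>'" "\<rho>' < 1"
  shows "(\<integral>t. - ln (1 - (norm (\<phi> (of_real \<rho> * cis t)))\<^sup>2) \<partial>angle_measure)
       \<le> (\<integral>t. - ln (1 - (norm (\<phi> (of_real \<rho>' * cis t)))\<^sup>2) \<partial>angle_measure)"
proof (rule sums_le)
  have 1: "\<rho> < 1" "0 \<le> \<rho>'" using assms by auto
  show "(\<lambda>k. (\<integral>t. (norm (\<phi> (of_real \<rho> * cis t) ^ Suc k))\<^sup>2 \<partial>angle_measure) / real (Suc k)) sums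
    (\<integral>t. - ln (1 - (norm (\<phi> (of_real \<rho> * cis t)))\<^sup>2) \<partial>angle_measure)"
    "(\<lambda>k. (\<integral>t. (norm (\<phi> (of_real \<rho>' * cis t) ^ Suc k))\<^sup>2 \<partial>angle_measure) / real (Suc k)) sums
    (\<integral>t. - ln (1 - (norm (\<phi> (of_real \<rho>' * cis t)))\<^sup>2) \<partial>angle_measure)"
    by (intro circle_log_mean_sums[where c = c] assms 1; assumption)+
  show "(\<integral>t. (norm (\<phi> (of_real \<rho> * cis t) ^ Suc k))\<^sup>2 \<partial>angle_measure) / real (Suc k)
    \<le> (\<integral>t. (norm (\<phi> (of_real \<rho>' * cis t) ^ Suc k))\<^sup>2 \<partial>angle_measure) / real (Suc k)" for k
    using assms by (intro divide_right_mono circle_square_mean_mono[where \<phi> = "\<lambda>z. \<phi> z ^ Suc k"] holomorphic_intros) auto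
qed

section \<open>Lebesgue measure on the torus\<close>

notation (input) torus_lebesgue ("\<tau>")

definition fundamental_box :: "(real ^ 'd) set" where
  "fundamental_box = {\<theta>. \<forall>j. 0 \<le> \<theta> $ j \<and> \<theta> $ j < 2 * pi}"

definition cis_vec :: "real ^ 'd \<Rightarrow> complex ^ 'd" where
  "cis_vec \<theta> = (\<chi> j. cis (\<theta> $ j))"

lemma cis_vec_in_torus [simp]: "cis_vec \<theta> \<in> torus"
  by (simp add: cis_vec_def torus_def)

lemma torus_eq_cis_vec:
  assumes "\<zeta> \<in> torus" obtains a where "\<zeta> = cis_vec a"
proof
  show "\<zeta> = cis_vec (\<chi> j. Arg (\<zeta> $ j))"
    using assms rcis_cmod_Arg[of "\<zeta> $ j" for j]
    by (simp add: cis_vec_def torus_def vec_eq_iff rcis_def)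
qed

lemma continuous_cis_vec [continuous_intros]: "continuous_on S cis_vec"
  unfolding cis_vec_def by (intro continuous_intros)

lemma closed_torus: "closed (torus :: (complex ^ 'd) set)"
proof -
  have "torus = (\<Inter>j. {z :: complex ^ 'd. norm (z $ j) = 1})"
    by (auto simp: torus_def)
  also have "closed \<dots>"
    by (intro closed_INT ballI closed_Collect_eq continuous_intros)
  finally show ?thesis .
qed

lemma compact_torus: "compact (torus :: (complex ^ 'd) set)"
proof (rule compact_eq_bounded_closed[THEN iffD2, OF conjI[OF _ closed_torus]])
  have "norm z \<le> real CARD('d)" if "z \<in> torus" for z :: "complex ^ 'd"
  proof -
    have "norm z \<le> (\<Sum>j\<in>UNIV. norm (z $ j))" 
      unfolding norm_vec_def by (rule L2_set_le_sum) simp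
    then show ?thesis using that by (simp add: torus_def)
  qed
  then show "bounded (torus :: (complex ^ 'd) set)" by (auto simp: bounded_iff)
qed

lemma space_torus_borel [simp]: "space torus_borel = torus"
  by (simp add: space_restrict_space)

lemma measurable_cis_vec [measurable]: "cis_vec \<in> borel \<rightarrow>\<^sub>M torus_borel"
  by (rule measurable_restrict_space2) (auto intro!: borel_measurable_continuous_onI continuous_intros)

lemma fundamental_box_borel [measurable]: "fundamental_box \<in> sets borel"
proof -
  have "fundamental_box = (\<Inter>j. {\<theta> :: real ^ 'd. 0 \<le> \<theta> $ j} \<inter> {\<theta>. \<theta> $ j < 2 * pi})"
    by (auto simp: fundamental_box_def)
  also have "\<dots> \<in> sets borel"
    by (intro sets.countable_INT'' sets.Int borel_closed borel_open closed_Collect_le open_Collect_less continuous_intros) auto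
  finally show ?thesis .
qed

lemma axis_inner: "x \<bullet> axis j 1 = x $ j" for x :: "real ^ 'd"
  by (simp add: inner_axis)

lemma Basis_real_vec: "(Basis :: (real ^ 'd) set) = (\<lambda>j. axis j 1) ` UNIV"
  by (auto simp: Basis_vec_def)

lemma inj_axis_one: "inj (\<lambda>j :: 'd::finite. axis j (1 :: real))"
  by (rule injI) (simp add: axis_eq_axis)

text \<open>
  The product formula for Lebesgue measure on a Euclidean space, rewritten from the abstract basis to
  the coordinates of a vector.
\<close>

lemma nn_integral_lborel_coordinate_prod:
  fixes F :: "'d::finite \<Rightarrow> real \<Rightarrow> real"
  assumes [measurable]: "\<And>j. F j \<in> borel_measurable borel" and "\<And>j t. 0 \<le> F j t"
  shows "(\<integral>\<^sup>+\<theta>. ennreal (\<Prod>j\<in>UNIV. F j (\<theta> $ j)) \<partial>(lborel :: (real ^ 'd) measure)) =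
    (\<Prod>j\<in>UNIV. \<integral>\<^sup>+t. ennreal (F j t) \<partial>lborel)"
proof -
  define G where "G b t = ennreal (F (inv (\<lambda>j. axis j (1::real)) b) t)" for b :: "real ^ 'd" and t
  have G: "G (axis j 1) = (\<lambda>t. ennreal (F j t))" for j
    unfolding G_def by (simp add: inv_f_f[OF inj_axis_one])
  have "(\<integral>\<^sup>+\<theta>. (\<Prod>b\<in>Basis. G b (\<theta> \<bullet> b)) \<partial>(lborel :: (real ^ 'd) measure)) =
      (\<Prod>b\<in>Basis. \<integral>\<^sup>+t. G b t \<partial>lborel)"
    by (rule nn_integral_lborel_prod) (auto simp: G_def)
  then show ?thesis
    unfolding Basis_real_vec
    by (simp add: prod.reindex[OF inj_axis_one] G axis_inner assms(2) prod_ennreal)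
qed

lemma emeasure_fundamental_box:
  "emeasure lborel (fundamental_box :: (real ^ 'd) set) = ennreal ((2 * pi) ^ CARD('d))"
proof -
  have eq: "indicator fundamental_box \<theta> = ennreal (\<Prod>j\<in>UNIV. indicator {0..<2 * pi} (\<theta> $ j))"
    for \<theta> :: "real ^ 'd"
  proof (cases "\<theta> \<in> fundamental_box")
    case True
    then show ?thesis by (simp add: fundamental_box_def)
  next
    case False
    then obtain j where "\<theta> $ j \<notin> {0..<2 * pi}" by (auto simp: fundamental_box_def)
    then have "\<exists>j\<in>UNIV. indicator {0..<2 * pi} (\<theta> $ j) = (0 :: real)"
      by (intro bexI[of _ j]) (simp_all add: indicator_def)
    then have "(\<Prod>j\<in>UNIV. indicator {0..<2 * pi} (\<theta> $ j)) = (0 :: real)"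
      by (intro prod_zero) simp_all
    then show ?thesis by (simp only: indicator_simps(2)[OF False] ennreal_0)
  qed
  have "emeasure lborel (fundamental_box :: (real ^ 'd) set) =
     (\<integral>\<^sup>+\<theta>. indicator fundamental_box \<theta> \<partial>(lborel :: (real ^ 'd) measure))"
    by simp
  also have "\<dots> = (\<integral>\<^sup>+\<theta>. ennreal (\<Prod>j\<in>UNIV. indicator {0..<2 * pi} (\<theta> $ j)) \<partial>(lborel :: (real ^ 'd) measure))"
    by (simp only: eq)
  also have "\<dots> = (\<Prod>j\<in>(UNIV :: 'd set). \<integral>\<^sup>+t. ennreal (indicator {0..<2 * pi} t) \<partial>lborel)"
    by (rule nn_integral_lborel_coordinate_prod) auto
  also have "(\<integral>\<^sup>+t. ennreal (indicator {0..<2 * pi} t) \<partial>lborel) = ennreal (2 * pi)"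
    by (simp add: ennreal_indicator)
  finally show ?thesis by (simp add: ennreal_power)
qed

lemma torus_lebesgue_alt:
  "\<tau> = distr (uniform_measure lborel fundamental_box) torus_borel cis_vec"
  unfolding torus_lebesgue_def fundamental_box_def cis_vec_def ..

lemma sets_torus_lebesgue [simp, measurable_cong]: "sets \<tau> = sets torus_borel"
  and space_torus_lebesgue [simp]: "space \<tau> = torus"
  by (simp_all add: torus_lebesgue_def)

lemma prob_space_torus_lebesgue: "prob_space \<tau>"
  unfolding torus_lebesgue_alt
proof (intro prob_space.prob_space_distr prob_space_uniform_measure)
  show "emeasure lborel (fundamental_box :: (real ^ 'd) set) \<noteq> 0"
    "emeasure lborel (fundamental_box :: (real ^ 'd) set) \<noteq> \<infinity>"
    unfolding emeasure_fundamental_box by simp_all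
qed measurable

lemma nn_integral_torus_lebesgue:
  fixes F :: "complex ^ 'd \<Rightarrow> ennreal"
  assumes [measurable]: "F \<in> borel_measurable torus_borel"
  shows "(\<integral>\<^sup>+\<zeta>. F \<zeta> \<partial>\<tau>) =
    (\<integral>\<^sup>+\<theta>. F (cis_vec \<theta>) * indicator fundamental_box \<theta> \<partial>lborel) / ennreal ((2 * pi) ^ CARD('d))"
proof -
  have "(\<integral>\<^sup>+\<zeta>. F \<zeta> \<partial>\<tau>) = (\<integral>\<^sup>+\<theta>. F (cis_vec \<theta>) \<partial>uniform_measure lborel fundamental_box)"
    unfolding torus_lebesgue_alt by (subst nn_integral_distr) auto
  also have "\<dots> = (\<integral>\<^sup>+\<theta>. F (cis_vec \<theta>) * indicator fundamental_box \<theta> \<partial>lborel) / emeasure lborel (fundamental_box :: (real ^ 'd) set)"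
    by (rule nn_integral_uniform_measure) auto
  finally show ?thesis by (simp only: emeasure_fundamental_box)
qed

text \<open>
  The period lattice of \<open>cis_vec\<close>.
\<close>

definition lattice_vec :: "int ^ 'd \<Rightarrow> real ^ 'd" where
  "lattice_vec k = (\<chi> j. 2 * pi * of_int (k $ j))"

lemma cis_vec_lattice [simp]: "cis_vec (lattice_vec k + \<theta>) = cis_vec \<theta>"
  by (simp add: cis_vec_def lattice_vec_def vec_eq_iff flip: cis_mult)

text \<open>
  The translates of the half-open box by the period lattice partition the space, so their indicators
  sum to \<open>1\<close>. Counting measure on the lattice makes this a partition of unity under an integral.
\<close>

lemma fundamental_box_tiles:
  fixes \<theta> :: "real ^ 'd"
  shows "(\<integral>\<^sup>+k. indicator fundamental_box (\<theta> - lattice_vec k) \<partial>count_space UNIV) = 1"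
proof -
  define m :: "int ^ 'd" where "m = (\<chi> j. \<lfloor>\<theta> $ j / (2 * pi)\<rfloor>)"
  have eq: "\<theta> - lattice_vec k \<in> fundamental_box \<longleftrightarrow> k = m" for k
  proof -
    have "0 \<le> \<theta> $ j - 2 * pi * of_int (k $ j) \<and> \<theta> $ j - 2 * pi * of_int (k $ j) < 2 * pi
        \<longleftrightarrow> k $ j = \<lfloor>\<theta> $ j / (2 * pi)\<rfloor>" for j
    proof -
      have "k $ j = \<lfloor>\<theta> $ j / (2 * pi)\<rfloor> \<longleftrightarrow> of_int (k $ j) \<le> \<theta> $ j / (2 * pi) \<and> \<theta> $ j / (2 * pi) < of_int (k $ j) + 1"
        using floor_eq_iff[of "\<theta> $ j / (2 * pi)" "k $ j"] by auto
      then show ?thesis by (simp add: field_simps)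
    qed
    then show ?thesis
      by (simp add: fundamental_box_def lattice_vec_def m_def vec_eq_iff)
  qed
  have "(\<integral>\<^sup>+k. indicator fundamental_box (\<theta> - lattice_vec k) \<partial>count_space UNIV) =
      (\<integral>\<^sup>+k. indicator {m} k \<partial>count_space UNIV)"
    by (intro nn_integral_cong) (simp add: eq indicator_def)
  then show ?thesis by simp
qed

lemma nn_integral_lborel_shift:
  fixes F :: "real ^ 'd \<Rightarrow> ennreal"
  assumes [measurable]: "F \<in> borel_measurable borel"
  shows "(\<integral>\<^sup>+\<theta>. F (c + \<theta>) \<partial>lborel) = (\<integral>\<^sup>+\<theta>. F \<theta> \<partial>lborel)"
proof -
  have "(\<integral>\<^sup>+\<theta>. F \<theta> \<partial>lborel) = (\<integral>\<^sup>+\<theta>. F \<theta> \<partial>distr lborel borel ((+) c))"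
    by (simp only: lborel_distr_plus)
  also have "\<dots> = (\<integral>\<^sup>+\<theta>. F (c + \<theta>) \<partial>lborel)"
    by (rule nn_integral_distr) auto
  finally show ?thesis ..
qed

text \<open>
  The integral of a periodic function is the same over any two fundamental domains. Inserting the
  partition of unity given by the translates of one box, and moving the lattice translation to the
  other box, exchanges the roles of the shifted and the unshifted box.
\<close>

lemma nn_integral_periodic_shift:
  fixes F :: "real ^ 'd \<Rightarrow> ennreal"
  assumes [measurable]: "F \<in> borel_measurable borel" and per: "\<And>k \<theta>. F (lattice_vec k + \<theta>) = F \<theta>"
  shows "(\<integral>\<^sup>+\<theta>. F (a + \<theta>) * indicator fundamental_box \<theta> \<partial>lborel) =
    (\<integral>\<^sup>+\<theta>. F \<theta> * indicator fundamental_box \<theta> \<partial>lborel)"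
proof -
  let ?B = "fundamental_box :: (real ^ 'd) set"
  have cnt: "countable (UNIV :: (int ^ 'd) set)" by simp
  have "(\<integral>\<^sup>+\<theta>. F (a + \<theta>) * indicator ?B \<theta> \<partial>lborel) = (\<integral>\<^sup>+\<theta>. F \<theta> * indicator ?B (\<theta> - a) \<partial>lborel)"
    using nn_integral_lborel_shift[of "\<lambda>\<theta>. F \<theta> * indicator ?B (\<theta> - a)" a] by simp
  also have "\<dots> = (\<integral>\<^sup>+\<theta>. F \<theta> * indicator ?B (\<theta> - a) * (\<integral>\<^sup>+k. indicator ?B (\<theta> - lattice_vec k) \<partial>count_space UNIV) \<partial>lborel)"
    by (simp add: fundamental_box_tiles)
  also have "\<dots> = (\<integral>\<^sup>+\<theta>. (\<integral>\<^sup>+k. F \<theta> * indicator ?B (\<theta> - a) * indicator ?B (\<theta> - lattice_vec k) \<partial>count_space UNIV) \<partial>lborel)"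
    by (simp add: nn_integral_cmult)
  also have "\<dots> = (\<integral>\<^sup>+k. (\<integral>\<^sup>+\<theta>. F \<theta> * indicator ?B (\<theta> - a) * indicator ?B (\<theta> - lattice_vec k) \<partial>lborel) \<partial>count_space UNIV)"
    by (rule nn_integral_count_space_nn_integral[OF cnt]) measurable
  also have "\<dots> = (\<integral>\<^sup>+k. (\<integral>\<^sup>+\<theta>. F \<theta> * indicator ?B (lattice_vec k + \<theta> - a) * indicator ?B \<theta> \<partial>lborel) \<partial>count_space UNIV)"
  proof (rule nn_integral_cong)
    fix k :: "int ^ 'd"
    show "(\<integral>\<^sup>+\<theta>. F \<theta> * indicator ?B (\<theta> - a) * indicator ?B (\<theta> - lattice_vec k) \<partial>lborel) =
      (\<integral>\<^sup>+\<theta>. F \<theta> * indicator ?B (lattice_vec k + \<theta> - a) * indicator ?B \<theta> \<partial>lborel)"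
      using nn_integral_lborel_shift[of "\<lambda>\<theta>. F \<theta> * indicator ?B (\<theta> - a) * indicator ?B (\<theta> - lattice_vec k)" "lattice_vec k"]
      by (simp add: per)
  qed
  also have "\<dots> = (\<integral>\<^sup>+\<theta>. (\<integral>\<^sup>+k. F \<theta> * indicator ?B (lattice_vec k + \<theta> - a) * indicator ?B \<theta> \<partial>count_space UNIV) \<partial>lborel)"
    by (rule nn_integral_count_space_nn_integral[OF cnt, symmetric]) measurable
  also have "\<dots> = (\<integral>\<^sup>+\<theta>. F \<theta> * indicator ?B \<theta> * (\<integral>\<^sup>+k. indicator ?B (lattice_vec k + \<theta> - a) \<partial>count_space UNIV) \<partial>lborel)"
    by (simp add: nn_integral_cmult[symmetric] mult_ac)
  also have "\<dots> = (\<integral>\<^sup>+\<theta>. F \<theta> * indicator ?B \<theta> \<partial>lborel)"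
  proof -
    have "(\<integral>\<^sup>+k. indicator ?B (lattice_vec k + \<theta> - a) \<partial>count_space UNIV) = (1 :: ennreal)" for \<theta> :: "real ^ 'd"
    proof -
      have bij: "bij_betw (uminus :: int ^ 'd \<Rightarrow> int ^ 'd) UNIV UNIV"
        by (rule bij_betw_byWitness[of _ uminus]) auto
      have "(\<integral>\<^sup>+k. indicator ?B (lattice_vec k + \<theta> - a) \<partial>count_space UNIV) =
          (\<integral>\<^sup>+k. indicator ?B (lattice_vec (- k) + \<theta> - a) \<partial>count_space UNIV)"
        by (rule nn_integral_bij_count_space[OF bij, symmetric])
      also have "\<dots> = (\<integral>\<^sup>+k. indicator ?B ((\<theta> - a) - lattice_vec k) \<partial>count_space UNIV)"
        by (intro nn_integral_cong arg_cong[where f = "indicator ?B"]) (simp add: lattice_vec_def vec_eq_iff)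
      finally show ?thesis by (simp only: fundamental_box_tiles)
    qed
    then show ?thesis by simp
  qed
  finally show ?thesis .
qed

definition torus_rotation :: "complex ^ 'd \<Rightarrow> complex ^ 'd \<Rightarrow> complex ^ 'd" where
  "torus_rotation \<xi> \<zeta> = (\<chi> j. \<xi> $ j * \<zeta> $ j)"

lemma torus_rotation_in_torus [simp]:
  "\<xi> \<in> torus \<Longrightarrow> \<zeta> \<in> torus \<Longrightarrow> torus_rotation \<xi> \<zeta> \<in> torus"
  by (simp add: torus_rotation_def torus_def norm_mult)

lemma measurable_torus_rotation:
  "\<xi> \<in> torus \<Longrightarrow> torus_rotation \<xi> \<in> torus_borel \<rightarrow>\<^sub>M torus_borel"
  unfolding torus_rotation_def
  by (intro measurable_restrict_space2 measurable_restrict_space1 borel_measurable_continuous_onI continuous_intros)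
    (auto simp: space_restrict_space torus_def norm_mult)

text \<open>
  In angular coordinates a rotation is a translation, so this is the invariance under shifts of
  integrals of periodic functions.
\<close>

lemma torus_lebesgue_rotation_invariant:
  assumes "\<xi> \<in> torus"
  shows "distr \<tau> \<tau> (torus_rotation \<xi>) = \<tau>"
proof (rule measure_eqI)
  note [measurable] = measurable_torus_rotation[OF assms]
  obtain a where a: "\<xi> = cis_vec a" using assms by (rule torus_eq_cis_vec)
  fix A assume "A \<in> sets (distr \<tau> \<tau> (torus_rotation \<xi>))"
  then have A[measurable]: "A \<in> sets torus_borel" by simp
  let ?F = "\<lambda>\<theta>. indicator A (cis_vec \<theta>) :: ennreal"
  have rot: "torus_rotation \<xi> (cis_vec \<theta>) = cis_vec (a + \<theta>)" for \<theta>
    by (simp add: a torus_rotation_def cis_vec_def cis_mult vec_eq_iff)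
  have "emeasure (distr \<tau> \<tau> (torus_rotation \<xi>)) A =
      (\<integral>\<^sup>+\<zeta>. indicator A \<zeta> \<partial>distr \<tau> \<tau> (torus_rotation \<xi>))"
    by simp
  also have "\<dots> = (\<integral>\<^sup>+\<zeta>. indicator A (torus_rotation \<xi> \<zeta>) \<partial>\<tau>)"
    by (rule nn_integral_distr) measurable
  also have "\<dots> = (\<integral>\<^sup>+\<theta>. ?F (a + \<theta>) * indicator fundamental_box \<theta> \<partial>lborel) / ennreal ((2 * pi) ^ CARD('a))"
    by (subst nn_integral_torus_lebesgue) (measurable, simp add: rot)
  also have "(\<integral>\<^sup>+\<theta>. ?F (a + \<theta>) * indicator fundamental_box \<theta> \<partial>lborel) =
      (\<integral>\<^sup>+\<theta>. ?F \<theta> * indicator fundamental_box \<theta> \<partial>lborel)"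
    by (rule nn_integral_periodic_shift)
      (rule measurable_compose[OF measurable_cis_vec borel_measurable_indicator[OF A]], simp)
  also have "\<dots> / ennreal ((2 * pi) ^ CARD('a)) = (\<integral>\<^sup>+\<zeta>. indicator A \<zeta> \<partial>\<tau>)"
    by (rule nn_integral_torus_lebesgue[symmetric]) measurable
  finally show "emeasure (distr \<tau> \<tau> (torus_rotation \<xi>)) A = emeasure \<tau> A"
    by simp
qed simp

lemma torus_integral_rotation:
  fixes F :: "complex ^ 'd \<Rightarrow> 'a::{banach, second_countable_topology}"
  assumes "F \<in> borel_measurable torus_borel" "\<xi> \<in> torus"
  shows "(\<integral>\<zeta>. F (torus_rotation \<xi> \<zeta>) \<partial>\<tau>) = (\<integral>\<zeta>. F \<zeta> \<partial>\<tau>)"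
proof -
  have m: "torus_rotation \<xi> \<in> \<tau> \<rightarrow>\<^sub>M \<tau>" "F \<in> borel_measurable \<tau>"
    using measurable_torus_rotation[OF assms(2)] assms(1)
    by (simp_all cong: measurable_cong_sets)
  show ?thesis
    using integral_distr[OF m] torus_lebesgue_rotation_invariant[OF assms(2)] by simp
qed

section \<open>Logarithmic means over tori\<close>

lemma continuous_on_smult_vec [continuous_intros]:
  fixes f :: "'a::topological_space \<Rightarrow> complex" and g :: "'a \<Rightarrow> complex ^ 'd"
  shows "continuous_on S f \<Longrightarrow> continuous_on S g \<Longrightarrow> continuous_on S (\<lambda>x. f x *s g x)"
  unfolding vector_scalar_mult_def by (intro continuous_intros)

lemma smult_in_torus: "norm c = 1 \<Longrightarrow> \<zeta> \<in> torus \<Longrightarrow> c *s \<zeta> \<in> torus"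
  by (simp add: torus_def norm_mult)

lemma smult_in_polydisk: "norm c < 1 \<Longrightarrow> \<zeta> \<in> torus \<Longrightarrow> c *s \<zeta> \<in> polydisk"
  by (simp add: torus_def polydisk_def norm_mult)

lemma torus_borel_measurable_continuous:
  "continuous_on torus F \<Longrightarrow> F \<in> borel_measurable torus_borel"
  by (rule borel_measurable_continuous_on_restrict)

lemma integrable_torus_continuous:
  fixes F :: "complex ^ 'd \<Rightarrow> 'a::{banach, second_countable_topology}"
  assumes "continuous_on torus F" "finite_measure M" "sets M = sets torus_borel"
  shows "integrable M F"
proof -
  interpret finite_measure M by fact
  have "bounded (F ` torus)"
    by (rule compact_imp_bounded[OF compact_continuous_image[OF assms(1) compact_torus]])
  then obtain B where "\<And>x. x \<in> torus \<Longrightarrow> norm (F x) \<le> B" by (auto simp: bounded_iff)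
  moreover have "space M = torus"
    using sets_eq_imp_space_eq[OF assms(3)] by simp
  ultimately show ?thesis
    using torus_borel_measurable_continuous[OF assms(1)] assms(3)
    by (intro integrable_const_bound[of _ B]) (auto cong: measurable_cong_sets)
qed

lemma integrable_torus_lebesgue_continuous:
  fixes F :: "complex ^ 'd \<Rightarrow> 'a::{banach, second_countable_topology}"
  assumes "continuous_on torus F"
  shows "integrable \<tau> F"
  using assms
  by (rule integrable_torus_continuous)
    (simp_all add: prob_space.finite_measure[OF prob_space_torus_lebesgue])

lemma measurable_circle_rotation:
  "(\<lambda>(t, \<zeta>). cis t *s \<zeta>) \<in> angle_measure \<Otimes>\<^sub>M \<tau> \<rightarrow>\<^sub>M torus_borel"
proof (rule measurable_restrict_space2)
  have "(\<lambda>p. (fst p, snd p)) \<in> angle_measure \<Otimes>\<^sub>M \<tau> \<rightarrow>\<^sub>M borel \<Otimes>\<^sub>M (borel :: (complex ^ 'a) measure)"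
  proof (rule measurable_Pair)
    show "fst \<in> angle_measure \<Otimes>\<^sub>M \<tau> \<rightarrow>\<^sub>M borel"
      using measurable_fst by (simp cong: measurable_cong_sets)
    have "snd \<in> angle_measure \<Otimes>\<^sub>M \<tau> \<rightarrow>\<^sub>M (torus_borel :: (complex ^ 'a) measure)"
      using measurable_snd[of angle_measure \<tau>] by (simp cong: measurable_cong_sets)
    then show "snd \<in> angle_measure \<Otimes>\<^sub>M \<tau> \<rightarrow>\<^sub>M (borel :: (complex ^ 'a) measure)"
      by (rule measurable_restrict_space2_iff[THEN iffD1, THEN conjunct1])
  qed
  moreover have "(\<lambda>p. cis (fst p) *s snd p) \<in> borel_measurable (borel :: (real \<times> (complex ^ 'a)) measure)"
    by (intro borel_measurable_continuous_onI continuous_intros)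
  ultimately show "(\<lambda>(t, \<zeta>). cis t *s \<zeta>) \<in> angle_measure \<Otimes>\<^sub>M \<tau> \<rightarrow>\<^sub>M (borel :: (complex ^ 'a) measure)"
    using measurable_compose[of "\<lambda>p. (fst p, snd p)" _ "borel :: (real \<times> (complex ^ 'a)) measure" "\<lambda>p. cis (fst p) *s snd p"]
    by (simp add: borel_prod case_prod_unfold)
qed (auto simp: space_pair_measure smult_in_torus)

text \<open>
  Rotating all coordinates by the same angle and averaging over the angle: this reduces integrals
  over the torus to means over circles in the one-variable slices \<open>l \<mapsto> l *s \<zeta>\<close>, where one-variable
  function theory applies.
\<close>

lemma torus_integral_circle_average:
  fixes F :: "complex ^ 'd \<Rightarrow> real"
  assumes "continuous_on torus F"
  shows "(\<integral>\<zeta>. (\<integral>t. F (cis t *s \<zeta>) \<partial>angle_measure) \<partial>\<tau>) = (\<integral>\<zeta>. F \<zeta> \<partial>\<tau>)"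
    and "integrable \<tau> (\<lambda>\<zeta>. \<integral>t. F (cis t *s \<zeta>) \<partial>angle_measure)"
proof -
  interpret P: pair_prob_space angle_measure "\<tau> :: (complex ^ 'd) measure"
    by (simp add: pair_prob_space_def pair_sigma_finite_def prob_space_angle_measure
        prob_space_torus_lebesgue prob_space_imp_sigma_finite)
  note F = torus_borel_measurable_continuous[OF assms]
  have "bounded (F ` torus)"
    by (rule compact_imp_bounded[OF compact_continuous_image[OF assms compact_torus]])
  then obtain B where B: "\<And>x. x \<in> torus \<Longrightarrow> norm (F x) \<le> B" by (auto simp: bounded_iff)
  have int: "integrable (angle_measure \<Otimes>\<^sub>M \<tau>) (\<lambda>(t, \<zeta>). F (cis t *s \<zeta>))"
  proof (rule P.P.integrable_const_bound[of _ B])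
    show "AE x in angle_measure \<Otimes>\<^sub>M \<tau>. norm (case x of (t, \<zeta>) \<Rightarrow> F (cis t *s \<zeta>)) \<le> B"
      by (rule AE_I2) (use B in \<open>auto simp: space_pair_measure smult_in_torus simp del: real_norm_def\<close>)
    show "(\<lambda>(t, \<zeta>). F (cis t *s \<zeta>)) \<in> borel_measurable (angle_measure \<Otimes>\<^sub>M \<tau>)"
      using measurable_compose[OF measurable_circle_rotation F] by (simp add: case_prod_unfold)
  qed
  have rot: "cis t *s \<zeta> = torus_rotation (cis_vec (\<chi> j. t)) \<zeta>" for t and \<zeta> :: "complex ^ 'd"
    by (simp add: vec_eq_iff torus_rotation_def cis_vec_def)
  show "integrable \<tau> (\<lambda>\<zeta>. \<integral>t. F (cis t *s \<zeta>) \<partial>angle_measure)"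
    by (rule P.integrable_snd[OF int])
  have "(\<integral>\<zeta>. (\<integral>t. F (cis t *s \<zeta>) \<partial>angle_measure) \<partial>\<tau>) =
      (\<integral>t. (\<integral>\<zeta>. F (cis t *s \<zeta>) \<partial>\<tau>) \<partial>angle_measure)"
    by (rule P.Fubini_integral[OF int])
  also have "\<dots> = (\<integral>t. (\<integral>\<zeta>. F \<zeta> \<partial>\<tau>) \<partial>angle_measure)"
    unfolding rot by (simp only: torus_integral_rotation[OF F cis_vec_in_torus])
  also have "\<dots> = (\<integral>\<zeta>. F \<zeta> \<partial>\<tau>)"
    using prob_space.prob_space[OF prob_space_angle_measure] by simp
  finally show "(\<integral>\<zeta>. (\<integral>t. F (cis t *s \<zeta>) \<partial>angle_measure) \<partial>\<tau>) = (\<integral>\<zeta>. F \<zeta> \<partial>\<tau>)" .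
qed

lemma holomorphic_on_polydisk_slice:
  assumes "holomorphic_on_polydisk h" "\<zeta> \<in> torus"
  shows "(\<lambda>l. h (l *s \<zeta>)) holomorphic_on ball 0 1"
proof (rule holomorphic_onI)
  fix l :: complex assume "l \<in> ball 0 1"
  then have "l *s \<zeta> \<in> polydisk" using assms(2) by (simp add: smult_in_polydisk)
  then obtain D where D: "(h has_derivative D) (at (l *s \<zeta>))" "\<And>c v. D (c *s v) = c * D v"
    using assms(1) unfolding holomorphic_on_polydisk_def by blast
  have lin: "bounded_linear (\<lambda>l. l *s \<zeta>)"
  proof (rule linear_conv_bounded_linear[THEN iffD1], rule linearI)
    show "(b1 + b2) *s \<zeta> = b1 *s \<zeta> + b2 *s \<zeta>" for b1 b2 by (rule vector_sadd_rdistrib)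
    show "(r *\<^sub>R b) *s \<zeta> = r *\<^sub>R (b *s \<zeta>)" for r b
      by (simp add: vec_eq_iff)
  qed
  have "((\<lambda>l. h (l *s \<zeta>)) has_derivative (\<lambda>c. D (c *s \<zeta>))) (at l)"
    by (rule has_derivative_compose[OF bounded_linear_imp_has_derivative[OF lin] D(1)])
  then have "((\<lambda>l. h (l *s \<zeta>)) has_field_derivative D \<zeta>) (at l)"
    by (simp add: has_field_derivative_def D(2) mult.commute[of _ "D \<zeta>"])
  then show "(\<lambda>l. h (l *s \<zeta>)) field_differentiable at l within ball 0 1"
    by (meson field_differentiable_at_within field_differentiable_def)
qed

lemma holomorphic_on_polydisk_continuous:
  "holomorphic_on_polydisk h \<Longrightarrow> continuous_on polydisk h"
  unfolding holomorphic_on_polydisk_def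
  by (metis continuous_at_imp_continuous_on has_derivative_continuous)

lemma continuous_on_torus_dilation:
  assumes "holomorphic_on_polydisk h" "0 \<le> \<rho>" "\<rho> < 1"
  shows "continuous_on torus (\<lambda>\<zeta>. h (of_real \<rho> *s \<zeta>))"
  by (rule continuous_on_compose2[OF holomorphic_on_polydisk_continuous[OF assms(1)]])
    (use assms(2,3) in \<open>auto intro!: continuous_intros smult_in_polydisk\<close>)

text \<open>
  On each slice \<open>ln |1 + g|\<close> is the real part of the holomorphic function \<open>Ln (1 + g)\<close>, defined because
  \<open>1 + g\<close> lies in the right half plane, and the mean value is its value \<open>0\<close> at the origin.
\<close>

lemma torus_log_mean_zero:
  assumes hol: "holomorphic_on_polydisk g" and small: "\<And>z. z \<in> polydisk \<Longrightarrow> norm (g z) < 1"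
    and g0: "g 0 = 0" and \<rho>: "0 \<le> \<rho>" "\<rho> < 1"
  shows "(\<integral>\<zeta>. ln (norm (1 + g (of_real \<rho> *s \<zeta>))) \<partial>\<tau>) = 0"
    and "continuous_on torus (\<lambda>\<zeta>. ln (norm (1 + g (of_real \<rho> *s \<zeta>))))"
proof -
  let ?F = "\<lambda>\<zeta>. ln (norm (1 + g (of_real \<rho> *s \<zeta>)))"
  have pos: "0 < Re (1 + g z)" if "z \<in> polydisk" for z
    using small[OF that] abs_Re_le_cmod[of "g z"] by simp
  have ne: "1 + g z \<noteq> 0" if "z \<in> polydisk" for z
    using pos[OF that] by (metis less_irrefl zero_complex.sel(1))
  show cont: "continuous_on torus ?F"
    by (intro continuous_intros continuous_on_torus_dilation[OF hol \<rho>]) (use \<rho> in \<open>auto dest!: ne[OF smult_in_polydisk[of "of_real \<rho>"], rotated]\<close>)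
  have "(\<integral>t. ?F (cis t *s \<zeta>) \<partial>angle_measure) = 0" if \<zeta>: "\<zeta> \<in> torus" for \<zeta>
  proof -
    define \<phi> where "\<phi> l = Ln (1 + g (l *s \<zeta>))" for l
    have "\<phi> holomorphic_on ball 0 1"
      unfolding \<phi>_def
    proof (intro holomorphic_intros holomorphic_on_polydisk_slice[OF hol \<zeta>])
      fix l :: complex assume "l \<in> ball 0 1"
      then have "0 < Re (1 + g (l *s \<zeta>))"
        using \<zeta> by (intro pos smult_in_polydisk) simp_all
      then show "1 + g (l *s \<zeta>) \<notin> \<real>\<^sub>\<le>\<^sub>0"
        by (auto simp: complex_nonpos_Reals_iff)
    qed
    note mv = circle_mean_value[OF this \<rho>]
    have "?F (cis t *s \<zeta>) = Re (\<phi> (of_real \<rho> * cis t))" for t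
    proof -
      have "1 + g ((of_real \<rho> * cis t) *s \<zeta>) \<noteq> 0"
        using \<rho> \<zeta> by (intro ne smult_in_polydisk) (simp_all add: norm_mult)
      then show ?thesis by (simp add: \<phi>_def Re_Ln vector_smult_assoc)
    qed
    then have "(\<integral>t. ?F (cis t *s \<zeta>) \<partial>angle_measure) = Re (\<phi> 0)"
      using integral_Re[OF mv(2)] mv(1) by simp
    then show ?thesis by (simp add: \<phi>_def g0)
  qed
  then have "(\<integral>\<zeta>. (\<integral>t. ?F (cis t *s \<zeta>) \<partial>angle_measure) \<partial>\<tau>) = 0"
    by (subst Bochner_Integration.integral_cong[of _ _ _ "\<lambda>_. 0"]) auto
  then show "(\<integral>\<zeta>. ?F \<zeta> \<partial>\<tau>) = 0"
    using torus_integral_circle_average(1)[OF cont] by simp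
qed

text \<open>
  The factor \<open>s < 1\<close> keeps the argument of the logarithm away from \<open>0\<close>, uniformly in the radius, which
  the power series of the logarithm on the slices requires.
\<close>

lemma torus_log_mean_mono:
  assumes hol: "h \<in> hol_maps" and s: "0 \<le> s" "s < 1" and \<rho>: "0 \<le> \<rho>" "\<rho> \<le> \<rho>'" "\<rho>' < 1"
  shows "(\<integral>\<zeta>. - ln (1 - (s * norm (h (of_real \<rho> *s \<zeta>)))\<^sup>2) \<partial>\<tau>)
       \<le> (\<integral>\<zeta>. - ln (1 - (s * norm (h (of_real \<rho>' *s \<zeta>)))\<^sup>2) \<partial>\<tau>)"
proof -
  let ?F = "\<lambda>\<rho> \<zeta>. - ln (1 - (s * norm (h (of_real \<rho> *s \<zeta>)))\<^sup>2)"
  have h: "holomorphic_on_polydisk h" "\<And>z. z \<in> polydisk \<Longrightarrow> norm (h z) \<le> 1"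
    using hol by (auto simp: hol_maps_def)
  have b: "s * norm (h z) \<le> s" if "z \<in> polydisk" for z
    using mult_left_mono[OF h(2)[OF that] s(1)] by simp
  have cont: "continuous_on torus (?F \<rho>)" if "0 \<le> \<rho>" "\<rho> < 1" for \<rho>
  proof (intro continuous_intros continuous_on_torus_dilation[OF h(1) that] ballI)
    fix \<zeta> :: "complex ^ 'a" assume "\<zeta> \<in> torus"
    then have "s * norm (h (of_real \<rho> *s \<zeta>)) \<le> s"
      using that by (intro b smult_in_polydisk) auto
    then have "(s * norm (h (of_real \<rho> *s \<zeta>)))\<^sup>2 < 1"
      using s by (simp add: abs_square_less_1)
    then show "1 - (s * norm (h (of_real \<rho> *s \<zeta>)))\<^sup>2 \<noteq> 0" by simp
  qed
  have r: "\<rho> < 1" "0 \<le> \<rho>'" using \<rho> by auto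
  have "(\<integral>t. ?F \<rho> (cis t *s \<zeta>) \<partial>angle_measure) \<le> (\<integral>t. ?F \<rho>' (cis t *s \<zeta>) \<partial>angle_measure)"
    if \<zeta>: "\<zeta> \<in> torus" for \<zeta>
  proof -
    have "(\<integral>t. - ln (1 - (norm (of_real s * h ((of_real \<rho> * cis t) *s \<zeta>)))\<^sup>2) \<partial>angle_measure)
       \<le> (\<integral>t. - ln (1 - (norm (of_real s * h ((of_real \<rho>' * cis t) *s \<zeta>)))\<^sup>2) \<partial>angle_measure)"
    proof (rule circle_log_mean_mono[where \<phi> = "\<lambda>l. of_real s * h (l *s \<zeta>)" and c = s])
      show "(\<lambda>l. of_real s * h (l *s \<zeta>)) holomorphic_on ball 0 1"
        by (intro holomorphic_intros holomorphic_on_polydisk_slice[OF h(1) \<zeta>])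
      show "norm (of_real s * h (l *s \<zeta>)) \<le> s" if "norm l < 1" for l
        using b[OF smult_in_polydisk[OF that \<zeta>]] s by (simp add: norm_mult)
    qed fact+
    then show ?thesis using s by (simp add: norm_mult vector_smult_assoc)
  qed
  then have "(\<integral>\<zeta>. (\<integral>t. ?F \<rho> (cis t *s \<zeta>) \<partial>angle_measure) \<partial>\<tau>)
      \<le> (\<integral>\<zeta>. (\<integral>t. ?F \<rho>' (cis t *s \<zeta>) \<partial>angle_measure) \<partial>\<tau>)"
    by (intro integral_mono[OF torus_integral_circle_average(2)[OF cont[OF \<rho>(1) r(1)]]
          torus_integral_circle_average(2)[OF cont[OF r(2) \<rho>(3)]]]) (simp only: space_torus_lebesgue)
  then show ?thesis
    using torus_integral_circle_average(1)[OF cont] \<rho> r by simp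
qed

section \<open>Logarithmic integrals along the Schur algorithm\<close>

text \<open>
  The sign makes the quantity nonnegative for functions bounded by \<open>1\<close>.
\<close>

definition log_defect :: "real \<Rightarrow> (complex ^ 'd \<Rightarrow> complex) \<Rightarrow> real" where
  "log_defect \<rho> h = (\<integral>\<zeta>. - ln (1 - (norm (h (of_real \<rho> *s \<zeta>)))\<^sup>2) \<partial>\<tau>)"

text \<open>
  The identity for \<open>1 - |g|\<^sup>2\<close> is the invariance of the hyperbolic metric. Bounding its denominator by
  \<open>(1 + |r| |b|)\<^sup>2\<close> gives \<open>|g| \<le> (|r| + |b|) / (1 + |r| |b|)\<close>, whence the last inequality.
\<close>

lemma mobius_bounds:
  fixes r b :: complex
  assumes "norm r < 1" "norm b < 1"
  shows "1 + cnj r * b \<noteq> 0"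
    and "1 - (norm ((b + r) / (1 + cnj r * b)))\<^sup>2 =
      (1 - (norm r)\<^sup>2) * (1 - (norm b)\<^sup>2) / (norm (1 + cnj r * b))\<^sup>2"
    and "norm ((b + r) / (1 + cnj r * b)) < 1"
    and "norm ((b + r) / (1 + cnj r * b)) \<le> norm r + norm b"
proof -
  have rb: "norm (cnj r * b) < 1"
    using mult_strict_mono[OF assms] by (simp add: norm_mult)
  then show ne: "1 + cnj r * b \<noteq> 0"
    by (metis add_eq_0_iff norm_minus_cancel norm_one less_irrefl)
  then have pos: "0 < norm (1 + cnj r * b)" by simp
  have id: "(norm (1 + cnj r * b))\<^sup>2 - (norm (b + r))\<^sup>2 = (1 - (norm r)\<^sup>2) * (1 - (norm b)\<^sup>2)"
    unfolding cmod_power2 by (simp add: algebra_simps power2_eq_square)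
  then show eq: "1 - (norm ((b + r) / (1 + cnj r * b)))\<^sup>2 =
      (1 - (norm r)\<^sup>2) * (1 - (norm b)\<^sup>2) / (norm (1 + cnj r * b))\<^sup>2"
    using pos by (simp add: norm_divide power_divide field_simps)
  have q: "0 < 1 - (norm r)\<^sup>2" "0 < 1 - (norm b)\<^sup>2"
    using assms by (simp_all add: abs_square_less_1)
  then have "0 < 1 - (norm ((b + r) / (1 + cnj r * b)))\<^sup>2"
    unfolding eq using pos by (intro divide_pos_pos mult_pos_pos) auto
  then show "norm ((b + r) / (1 + cnj r * b)) < 1"
    by (simp add: abs_square_less_1)
  have le: "norm (1 + cnj r * b) \<le> 1 + norm r * norm b"
    using norm_triangle_ineq[of 1 "cnj r * b"] by (simp add: norm_mult)
  have p1: "0 < 1 + norm r * norm b" by (simp add: add_pos_nonneg)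
  have "(1 - (norm r)\<^sup>2) * (1 - (norm b)\<^sup>2) / (1 + norm r * norm b)\<^sup>2 \<le>
      1 - (norm ((b + r) / (1 + cnj r * b)))\<^sup>2"
    unfolding eq using q pos le p1 by (intro divide_left_mono power_mono mult_nonneg_nonneg mult_pos_pos zero_less_power) auto
  moreover have "(1 - (norm r)\<^sup>2) * (1 - (norm b)\<^sup>2) / (1 + norm r * norm b)\<^sup>2 =
      1 - ((norm r + norm b) / (1 + norm r * norm b))\<^sup>2"
    using p1 by (simp add: power_divide field_simps) (simp add: power2_eq_square algebra_simps)
  ultimately have "(norm ((b + r) / (1 + cnj r * b)))\<^sup>2 \<le> ((norm r + norm b) / (1 + norm r * norm b))\<^sup>2"
    by linarith
  then have "norm ((b + r) / (1 + cnj r * b)) \<le> (norm r + norm b) / (1 + norm r * norm b)"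
    by (rule power2_le_imp_le) (simp add: add_nonneg_nonneg)
  also have "\<dots> \<le> (norm r + norm b) / 1"
    by (intro divide_left_mono) (auto simp: add_pos_nonneg)
  finally show "norm ((b + r) / (1 + cnj r * b)) \<le> norm r + norm b" by simp
qed

lemma continuous_log_defect:
  assumes "holomorphic_on_polydisk g" "\<And>z. z \<in> polydisk \<Longrightarrow> norm (g z) < 1" "0 \<le> \<rho>" "\<rho> < 1" "0 \<le> s" "s \<le> 1"
  shows "continuous_on torus (\<lambda>\<zeta>. - ln (1 - (s * norm (g (of_real \<rho> *s \<zeta>)))\<^sup>2))"
proof (intro continuous_intros continuous_on_torus_dilation[OF assms(1,3,4)] ballI)
  fix \<zeta> :: "complex ^ 'a" assume "\<zeta> \<in> torus"
  then have "norm (g (of_real \<rho> *s \<zeta>)) < 1"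
    using assms(3,4) by (intro assms(2) smult_in_polydisk) auto
  moreover have "s * norm (g (of_real \<rho> *s \<zeta>)) \<le> norm (g (of_real \<rho> *s \<zeta>))"
    using assms(5,6) by (simp add: mult_left_le_one_le)
  ultimately have "s * norm (g (of_real \<rho> *s \<zeta>)) < 1" by linarith
  then have "(s * norm (g (of_real \<rho> *s \<zeta>)))\<^sup>2 < 1"
    using assms(5) by (simp add: abs_square_less_1)
  then show "1 - (s * norm (g (of_real \<rho> *s \<zeta>)))\<^sup>2 \<noteq> 0" by simp
qed

lemma holomorphic_on_polydisk_cmult:
  assumes "holomorphic_on_polydisk g"
  shows "holomorphic_on_polydisk (\<lambda>z. c * g z)"
  unfolding holomorphic_on_polydisk_def
proof
  fix z :: "complex ^ 'a" assume "z \<in> polydisk"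
  then obtain D where D: "(g has_derivative D) (at z)" "\<And>c v. D (c *s v) = c * D v"
    using assms unfolding holomorphic_on_polydisk_def by blast
  then have "((\<lambda>z. c * g z) has_derivative (\<lambda>v. c * D v)) (at z)"
    by (intro has_derivative_mult_right)
  then show "\<exists>D. ((\<lambda>z. c * g z) has_derivative D) (at z) \<and> (\<forall>c v. D (c *s v) = c * D v)"
    using D(2) by (intro exI[of _ "\<lambda>v. c * D v"]) simp
qed

text \<open>
  The iterates of the Schur algorithm. Since \<open>h n\<close> is a disc automorphism applied to a coordinate times
  \<open>h (Suc n)\<close>, the bound \<open>1\<close> for \<open>h (Suc n)\<close> makes \<open>h n\<close> strictly smaller than \<open>1\<close> on the polydisk.
\<close>

locale schur_chain =
  fixes h :: "nat \<Rightarrow> complex ^ 'd \<Rightarrow> complex" and r :: "nat \<Rightarrow> complex" and \<nu> :: "nat \<Rightarrow> 'd"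
  assumes hol_maps: "h n \<in> hol_maps"
    and param_less_1: "norm (r n) < 1"
    and step: "z \<in> polydisk \<Longrightarrow> h n z = mobius_op (r n) (mult_op (\<nu> (Suc n)) (h (Suc n))) z"
begin

abbreviation b :: "nat \<Rightarrow> complex ^ 'd \<Rightarrow> complex" where
  "b n \<equiv> mult_op (\<nu> n) (h n)"

lemma holomorphic: "holomorphic_on_polydisk (h n)"
  and norm_le_1: "z \<in> polydisk \<Longrightarrow> norm (h n z) \<le> 1"
  using hol_maps[of n] by (auto simp: hol_maps_def)

lemma step': "z \<in> polydisk \<Longrightarrow> h n z = (b (Suc n) z + r n) / (1 + cnj (r n) * b (Suc n) z)"
  using step[of z n] param_less_1[of n] by (simp add: mobius_op_def)

lemma norm_b_le: "z \<in> polydisk \<Longrightarrow> norm (b n z) \<le> norm (h n z)"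
  and norm_b_less_1: "z \<in> polydisk \<Longrightarrow> norm (b n z) < 1"
proof -
  assume z: "z \<in> polydisk"
  then have 1: "norm (z $ \<nu> n) < 1" by (simp add: polydisk_def)
  show "norm (b n z) \<le> norm (h n z)"
    using mult_right_mono[of "norm (z $ \<nu> n)" 1 "norm (h n z)"] 1 by (simp add: mult_op_def norm_mult)
  have "norm (b n z) \<le> norm (z $ \<nu> n)"
    using mult_left_mono[OF norm_le_1[OF z, of n], of "norm (z $ \<nu> n)"] by (simp add: mult_op_def norm_mult)
  then show "norm (b n z) < 1" using 1 by simp
qed

lemma norm_less_1: "z \<in> polydisk \<Longrightarrow> norm (h n z) < 1"
  using mobius_bounds(3)[OF param_less_1 norm_b_less_1] by (simp add: step')

text \<open>
  Iterated, this bounds \<open>h n\<close> on the torus of radius \<open>\<rho>\<close> by a geometric average of the parameters from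
  \<open>n\<close> on.
\<close>

lemma norm_le_parameter_plus_tail:
  assumes "\<zeta> \<in> torus" "0 \<le> \<rho>" "\<rho> < 1"
  shows "norm (h n (of_real \<rho> *s \<zeta>)) \<le> norm (r n) + \<rho> * norm (h (Suc n) (of_real \<rho> *s \<zeta>))"
proof -
  have z: "of_real \<rho> *s \<zeta> \<in> polydisk" using assms by (intro smult_in_polydisk) auto
  have "norm (b (Suc n) (of_real \<rho> *s \<zeta>)) = \<rho> * norm (h (Suc n) (of_real \<rho> *s \<zeta>))"
    using assms by (simp add: mult_op_def norm_mult torus_def)
  then show ?thesis
    using mobius_bounds(4)[OF param_less_1[of n] norm_b_less_1[OF z, of "Suc n"]]
    by (simp add: step'[OF z, of n])
qed

lemma holomorphic_b: "holomorphic_on_polydisk (b n)"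
  unfolding holomorphic_on_polydisk_def
proof
  fix z :: "complex ^ 'd" assume "z \<in> polydisk"
  then obtain D where D: "(h n has_derivative D) (at z)" "\<And>c v. D (c *s v) = c * D v"
    using holomorphic[of n] unfolding holomorphic_on_polydisk_def by blast
  have "((\<lambda>z. z $ \<nu> n * h n z) has_derivative (\<lambda>v. z $ \<nu> n * D v + v $ \<nu> n * h n z)) (at z)"
    by (intro has_derivative_mult D(1) bounded_linear_imp_has_derivative bounded_linear_vec_nth)
  moreover have "z $ \<nu> n * D (c *s v) + (c *s v) $ \<nu> n * h n z = c * (z $ \<nu> n * D v + v $ \<nu> n * h n z)" for c v
    by (simp add: D(2) algebra_simps)
  ultimately show "\<exists>D. (b n has_derivative D) (at z) \<and> (\<forall>c v. D (c *s v) = c * D v)"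
    unfolding mult_op_def by blast
qed

lemma continuous_log_h:
  assumes "0 \<le> \<rho>" "\<rho> < 1"
  shows "continuous_on torus (\<lambda>\<zeta>. - ln (1 - (norm (h n (of_real \<rho> *s \<zeta>)))\<^sup>2))"
    and "continuous_on torus (\<lambda>\<zeta>. - ln (1 - (norm (b n (of_real \<rho> *s \<zeta>)))\<^sup>2))"
  using continuous_log_defect[OF holomorphic norm_less_1 assms, of 1]
    continuous_log_defect[OF holomorphic_b norm_b_less_1 assms, of 1] by simp_all

text \<open>
  The identity \<open>1 - |h n|\<^sup>2 = (1 - |r n|\<^sup>2) (1 - |b|\<^sup>2) / |1 + cnj (r n) b|\<^sup>2\<close>, in which the logarithm of
  the denominator has mean zero because \<open>b\<close> vanishes at the origin.
\<close>

lemma log_defect_step: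
  assumes \<rho>: "0 \<le> \<rho>" "\<rho> < 1"
  shows "log_defect \<rho> (h n) = - ln (1 - (norm (r n))\<^sup>2) + log_defect \<rho> (b (Suc n))"
proof -
  interpret prob_space "\<tau> :: (complex ^ 'd) measure" by (rule prob_space_torus_lebesgue)
  let ?g = "\<lambda>z. cnj (r n) * b (Suc n) z"
  let ?L = "\<lambda>\<zeta>. ln (norm (1 + ?g (of_real \<rho> *s \<zeta>)))"
  let ?B = "\<lambda>\<zeta>. - ln (1 - (norm (b (Suc n) (of_real \<rho> *s \<zeta>)))\<^sup>2)"
  have small: "norm (?g z) < 1" if "z \<in> polydisk" for z
    using mult_strict_mono[OF param_less_1 norm_b_less_1[OF that]] by (simp add: norm_mult)
  have g0: "?g 0 = 0" by (simp add: mult_op_def)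
  note L = torus_log_mean_zero[where g = ?g, OF holomorphic_on_polydisk_cmult[OF holomorphic_b] small g0 \<rho>]
  have "- ln (1 - (norm (h n (of_real \<rho> *s \<zeta>)))\<^sup>2) = - ln (1 - (norm (r n))\<^sup>2) + ?B \<zeta> + 2 * ?L \<zeta>"
    if "\<zeta> \<in> torus" for \<zeta>
  proof -
    have z: "of_real \<rho> *s \<zeta> \<in> polydisk" using \<rho> that by (intro smult_in_polydisk) auto
    note m = mobius_bounds(1,2)[OF param_less_1[of n] norm_b_less_1[OF z, of "Suc n"]]
    have "0 < 1 - (norm (r n))\<^sup>2" "0 < 1 - (norm (b (Suc n) (of_real \<rho> *s \<zeta>)))\<^sup>2"
      using param_less_1[of n] norm_b_less_1[OF z, of "Suc n"] by (simp_all add: abs_square_less_1)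
    moreover have "0 < norm (1 + ?g (of_real \<rho> *s \<zeta>))" using m(1) by simp
    ultimately show ?thesis
      unfolding step'[OF z] m(2) by (simp add: ln_div ln_mult ln_realpow)
  qed
  then have "log_defect \<rho> (h n) = (\<integral>\<zeta>. - ln (1 - (norm (r n))\<^sup>2) + ?B \<zeta> + 2 * ?L \<zeta> \<partial>\<tau>)"
    unfolding log_defect_def by (intro Bochner_Integration.integral_cong) auto
  also have "\<dots> = - ln (1 - (norm (r n))\<^sup>2) + (\<integral>\<zeta>. ?B \<zeta> \<partial>\<tau>) + 2 * (\<integral>\<zeta>. ?L \<zeta> \<partial>\<tau>)"
  proof -
    have i: "integrable \<tau> ?B" "integrable \<tau> ?L"
      by (intro integrable_torus_lebesgue_continuous L(2) continuous_log_h(2)[OF \<rho>])+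
    show ?thesis
      by (subst Bochner_Integration.integral_add
          , intro Bochner_Integration.integrable_add integrable_const i(1)
          , intro integrable_mult_right i(2)
          , subst Bochner_Integration.integral_add
          , rule integrable_const, rule i(1), simp add: prob_space[simplified])
  qed
  finally show ?thesis by (simp add: L(1) log_defect_def)
qed

lemma log_defect_mult_le:
  assumes \<rho>: "0 \<le> \<rho>" "\<rho> < 1"
  shows "log_defect \<rho> (b n) \<le> log_defect \<rho> (h n)"
  unfolding log_defect_def
proof (intro integral_mono integrable_torus_lebesgue_continuous continuous_log_h \<rho>)
  fix \<zeta> :: "complex ^ 'd" assume "\<zeta> \<in> space \<tau>"
  then have z: "of_real \<rho> *s \<zeta> \<in> polydisk" using \<rho> by (intro smult_in_polydisk) auto
  have "(norm (b n (of_real \<rho> *s \<zeta>)))\<^sup>2 \<le> (norm (h n (of_real \<rho> *s \<zeta>)))\<^sup>2"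
    by (intro power_mono norm_b_le z) simp
  moreover have "(norm (h n (of_real \<rho> *s \<zeta>)))\<^sup>2 < 1"
    using norm_less_1[OF z] by (simp add: abs_square_less_1)
  ultimately have "ln (1 - (norm (h n (of_real \<rho> *s \<zeta>)))\<^sup>2) \<le> ln (1 - (norm (b n (of_real \<rho> *s \<zeta>)))\<^sup>2)"
    by (subst ln_le_cancel_iff) linarith+
  then show "- ln (1 - (norm (b n (of_real \<rho> *s \<zeta>)))\<^sup>2) \<le> - ln (1 - (norm (h n (of_real \<rho> *s \<zeta>)))\<^sup>2)"
    by simp
qed

lemma log_defect_le_partial_sum:
  assumes \<rho>: "0 \<le> \<rho>" "\<rho> < 1"
  shows "log_defect \<rho> (h 0) \<le> (\<Sum>j<n. - ln (1 - (norm (r j))\<^sup>2)) + log_defect \<rho> (h n)"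
proof (induction n)
  case (Suc n)
  then show ?case
    using log_defect_step[OF \<rho>, of n] log_defect_mult_le[OF \<rho>, of "Suc n"] by simp
qed simp

lemma uniform_bound_below_1:
  assumes \<rho>: "0 \<le> \<rho>" "\<rho> < 1"
  obtains c where "c < 1" "0 \<le> c" "\<And>\<zeta>. \<zeta> \<in> torus \<Longrightarrow> (norm (h n (of_real \<rho> *s \<zeta>)))\<^sup>2 \<le> c"
proof -
  have ne: "(torus :: (complex ^ 'd) set) \<noteq> {}"
    using cis_vec_in_torus by blast
  have "continuous_on torus (\<lambda>\<zeta>. (norm (h n (of_real \<rho> *s \<zeta>)))\<^sup>2)"
    by (intro continuous_intros continuous_on_torus_dilation holomorphic \<rho>)
  from continuous_attains_sup[OF compact_torus ne this]
  obtain \<eta> where \<eta>: "\<eta> \<in> torus"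
    "\<And>\<zeta>. \<zeta> \<in> torus \<Longrightarrow> (norm (h n (of_real \<rho> *s \<zeta>)))\<^sup>2 \<le> (norm (h n (of_real \<rho> *s \<eta>)))\<^sup>2" by blast
  have "norm (h n (of_real \<rho> *s \<eta>)) < 1"
    using \<rho> \<eta>(1) by (intro norm_less_1 smult_in_polydisk) auto
  then have "(norm (h n (of_real \<rho> *s \<eta>)))\<^sup>2 < 1" by (simp add: abs_square_less_1)
  then show thesis using \<eta>(2) by (intro that) auto
qed

text \<open>
  On the unit torus a coordinate factor would not change the modulus; inside the polydisk its effect
  is absorbed by enlarging the radius. Replacing \<open>h\<close> by \<open>s h\<close> with \<open>s\<close> close to \<open>1\<close> costs at most \<open>\<epsilon>\<close>. Then
  monotonicity in the radius allows passing from radius \<open>\<rho>\<close> to radius \<open>s\<close>, where the coordinate has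
  modulus exactly \<open>s\<close>.
\<close>

lemma log_defect_le_mult_larger_radius:
  assumes \<rho>: "0 \<le> \<rho>" "\<rho> < 1" and "0 < \<epsilon>"
  obtains \<rho>' where "\<rho> \<le> \<rho>'" "\<rho>' < 1" "log_defect \<rho> (h n) \<le> log_defect \<rho>' (b n) + \<epsilon>"
proof -
  interpret prob_space "\<tau> :: (complex ^ 'd) measure" by (rule prob_space_torus_lebesgue)
  obtain c where c: "c < 1" "0 \<le> c" "\<And>\<zeta>. \<zeta> \<in> torus \<Longrightarrow> (norm (h n (of_real \<rho> *s \<zeta>)))\<^sup>2 \<le> c"
    by (rule uniform_bound_below_1[OF \<rho>]) blast
  \<comment> \<open>The pointwise cost of the factor \<open>s\<close> is at most \<open>(1 - s\<^sup>2) / (1 - c) \<le> 2 * (1 - s) / (1 - c)\<close>.\<close>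
  define s where "s = max \<rho> (1 - \<epsilon> * (1 - c) / 2)"
  have s: "\<rho> \<le> s" "s < 1" "0 \<le> s" using \<rho> assms(3) c by (auto simp: s_def)
  have "1 - s \<le> \<epsilon> * (1 - c) / 2"
    using max.cobounded2[of "1 - \<epsilon> * (1 - c) / 2" \<rho>] unfolding s_def by linarith
  moreover have "1 - s\<^sup>2 \<le> 2 * (1 - s)"
    using zero_le_power2[of "1 - s"] by (simp add: power2_eq_square algebra_simps)
  ultimately have s2: "(1 - s\<^sup>2) / (1 - c) \<le> \<epsilon>"
    using c by (simp add: pos_divide_le_eq)
  let ?x = "\<lambda>\<rho> \<zeta>. norm (h n (of_real \<rho> *s \<zeta>))"
  have pt: "- ln (1 - (?x \<rho> \<zeta>)\<^sup>2) \<le> - ln (1 - (s * ?x \<rho> \<zeta>)\<^sup>2) + \<epsilon>" if "\<zeta> \<in> torus" for \<zeta>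
  proof -
    define y where "y = (?x \<rho> \<zeta>)\<^sup>2"
    have y: "0 \<le> y" "y \<le> c" "y < 1" using c(3)[OF that] c(1) by (auto simp: y_def)
    have s21: "s\<^sup>2 \<le> 1" using s by (simp add: abs_square_le_1)
    have sy: "s\<^sup>2 * y \<le> y" using s21 y by (simp add: mult_left_le_one_le)
    have "ln (1 - s\<^sup>2 * y) - ln (1 - y) = ln ((1 - s\<^sup>2 * y) / (1 - y))"
      using y sy by (subst ln_div) auto
    also have "\<dots> \<le> (1 - s\<^sup>2 * y) / (1 - y) - 1"
      using y sy by (intro ln_le_minus_one divide_pos_pos) auto
    also have "\<dots> = (1 - s\<^sup>2) * y / (1 - y)" using y by (simp add: field_simps)
    also have "\<dots> \<le> (1 - s\<^sup>2) * 1 / (1 - c)"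
      using y c s21 by (intro frac_le mult_left_mono mult_nonneg_nonneg) auto
    also have "\<dots> \<le> \<epsilon>" using s2 by simp
    finally show ?thesis by (simp add: y_def power_mult_distrib)
  qed
  have "log_defect \<rho> (h n) \<le> (\<integral>\<zeta>. - ln (1 - (s * ?x \<rho> \<zeta>)\<^sup>2) + \<epsilon> \<partial>\<tau>)"
    unfolding log_defect_def
    by (intro integral_mono Bochner_Integration.integrable_add integrable_const
        integrable_torus_lebesgue_continuous continuous_log_h(1)[OF \<rho>]
        continuous_log_defect[OF holomorphic norm_less_1 \<rho>]) (use s pt in auto)
  also have "\<dots> = (\<integral>\<zeta>. - ln (1 - (s * ?x \<rho> \<zeta>)\<^sup>2) \<partial>\<tau>) + \<epsilon>"
  proof -
    have "integrable \<tau> (\<lambda>\<zeta>. - ln (1 - (s * ?x \<rho> \<zeta>)\<^sup>2))"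
      by (intro integrable_torus_lebesgue_continuous continuous_log_defect[OF holomorphic norm_less_1 \<rho>])
        (use s in auto)
    then show ?thesis
      by (subst Bochner_Integration.integral_add) (use prob_space in simp_all)
  qed
  also have "(\<integral>\<zeta>. - ln (1 - (s * ?x \<rho> \<zeta>)\<^sup>2) \<partial>\<tau>) \<le>
      (\<integral>\<zeta>. - ln (1 - (s * ?x s \<zeta>)\<^sup>2) \<partial>\<tau>)"
    by (rule torus_log_mean_mono[OF hol_maps]) (use s \<rho> in auto)
  also have "\<dots> = log_defect s (b n)"
    unfolding log_defect_def
    by (intro Bochner_Integration.integral_cong refl) (use s in \<open>auto simp: mult_op_def norm_mult torus_def\<close>)
  finally show thesis
    by (intro that[of s] s) simp
qed

text \<open>
  Each step of the algorithm requires a larger radius, so the induction runs over all radii and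
  tolerances simultaneously.
\<close>

lemma partial_sum_le_log_defect:
  assumes "0 \<le> \<rho>" "\<rho> < 1" and "0 < \<epsilon>"
  shows "\<exists>\<rho>'. \<rho> \<le> \<rho>' \<and> \<rho>' < 1 \<and> (\<Sum>j<n. - ln (1 - (norm (r j))\<^sup>2)) + log_defect \<rho> (h n) \<le> log_defect \<rho>' (h 0) + \<epsilon>"
  using assms
proof (induction n arbitrary: \<rho> \<epsilon>)
  case 0
  then show ?case by (intro exI[of _ \<rho>]) auto
next
  case (Suc n)
  have e: "0 < \<epsilon> / 2" using Suc.prems by simp
  obtain \<rho>1 where 1: "\<rho> \<le> \<rho>1" "\<rho>1 < 1" "log_defect \<rho> (h (Suc n)) \<le> log_defect \<rho>1 (b (Suc n)) + \<epsilon> / 2"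
    by (rule log_defect_le_mult_larger_radius[OF Suc.prems(1,2) e])
  have p: "0 \<le> \<rho>1" using 1 Suc.prems by simp
  obtain \<rho>2 where 2: "\<rho>1 \<le> \<rho>2" "\<rho>2 < 1"
    "(\<Sum>j<n. - ln (1 - (norm (r j))\<^sup>2)) + log_defect \<rho>1 (h n) \<le> log_defect \<rho>2 (h 0) + \<epsilon> / 2"
    using Suc.IH[OF p 1(2) e] by blast
  show ?case
    using 1 2 log_defect_step[OF p 1(2), of n] by (intro exI[of _ \<rho>2]) auto
qed

lemma log_defect_nonneg:
  assumes "0 \<le> \<rho>" "\<rho> < 1"
  shows "0 \<le> log_defect \<rho> (h n)"
  unfolding log_defect_def
proof (rule integral_nonneg_AE, rule AE_I2)
  fix \<zeta> :: "complex ^ 'd" assume "\<zeta> \<in> space \<tau>"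
  then have "norm (h n (of_real \<rho> *s \<zeta>)) < 1"
    using assms by (intro norm_less_1 smult_in_polydisk) auto
  then have "(norm (h n (of_real \<rho> *s \<zeta>)))\<^sup>2 < 1" by (simp add: abs_square_less_1)
  then show "0 \<le> - ln (1 - (norm (h n (of_real \<rho> *s \<zeta>)))\<^sup>2)" by simp
qed

lemma exists_radius_partial_sum_le:
  assumes "0 < \<epsilon>"
  obtains \<rho> where "1 / 2 \<le> \<rho>" "\<rho> < 1" "(\<Sum>j<n. - ln (1 - (norm (r j))\<^sup>2)) \<le> log_defect \<rho> (h 0) + \<epsilon>"
proof -
  have h: "(0::real) \<le> 1 / 2" "(1 / 2 :: real) < 1" by simp_all
  show thesis
    using partial_sum_le_log_defect[OF h assms, of n] log_defect_nonneg[OF h, of n] that by fastforce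
qed

lemma iterate_tail_bound:
  assumes "\<And>m. n \<le> m \<Longrightarrow> norm (r m) \<le> \<delta>" "\<zeta> \<in> torus" "0 \<le> \<rho>" "\<rho> < 1"
  shows "norm (h n (of_real \<rho> *s \<zeta>)) \<le> \<delta> / (1 - \<rho>)"
proof -
  let ?x = "\<lambda>m. norm (h m (of_real \<rho> *s \<zeta>))"
  have x1: "?x m \<le> 1" for m
    using assms by (intro norm_le_1 smult_in_polydisk) auto
  have "?x m \<le> \<delta> / (1 - \<rho>) + \<rho> ^ k" if "n \<le> m" for m k
    using that
  proof (induction k arbitrary: m)
    case 0
    have "0 \<le> \<delta>" using assms(1)[OF order_refl] norm_ge_zero[of "r n"] by linarith
    then show ?case using x1[of m] assms(4) by (simp add: add_increasing)
  next
    case (Suc k)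
    have "?x m \<le> \<delta> + \<rho> * ?x (Suc m)"
      using norm_le_parameter_plus_tail[OF assms(2-4), of m] assms(1)[OF Suc.prems] by linarith
    also have "\<dots> \<le> \<delta> + \<rho> * (\<delta> / (1 - \<rho>) + \<rho> ^ k)"
      using Suc.IH[of "Suc m"] Suc.prems assms(3) by (intro add_left_mono mult_left_mono) auto
    also have "\<dots> = \<delta> / (1 - \<rho>) + \<rho> ^ Suc k"
      using assms(4) by (simp add: field_simps)
    finally show ?case .
  qed
  moreover have "(\<lambda>k. \<delta> / (1 - \<rho>) + \<rho> ^ k) \<longlonglongrightarrow> \<delta> / (1 - \<rho>) + 0"
    by (intro tendsto_intros LIMSEQ_realpow_zero assms)
  ultimately show ?thesis
    using LIMSEQ_le_const[of "\<lambda>k. \<delta> / (1 - \<rho>) + \<rho> ^ k"] by force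
qed

text \<open>
  If the sum converges, the parameters tend to \<open>0\<close>, hence \<open>h n\<close> tends to \<open>0\<close> uniformly on the torus of
  radius \<open>\<rho>\<close>, and the remainder \<open>log_defect \<rho> (h n)\<close> disappears.
\<close>

lemma log_defect_le_bounded_sum:
  assumes C: "\<And>n. (\<Sum>j<n. - ln (1 - (norm (r j))\<^sup>2)) \<le> C" and \<rho>: "0 \<le> \<rho>" "\<rho> < 1"
  shows "log_defect \<rho> (h 0) \<le> C"
proof (rule field_le_epsilon)
  interpret prob_space "\<tau> :: (complex ^ 'd) measure" by (rule prob_space_torus_lebesgue)
  let ?c = "\<lambda>j. - ln (1 - (norm (r j))\<^sup>2)"
  have sq: "(norm (r j))\<^sup>2 < 1" for j using param_less_1[of j] by (simp add: abs_square_less_1)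
  have c: "(norm (r j))\<^sup>2 \<le> ?c j" for j
    using ln_le_minus_one[of "1 - (norm (r j))\<^sup>2"] sq[of j] by simp
  have c0: "0 \<le> ?c j" for j using c[of j] zero_le_power2 order_trans by blast
  have "summable ?c"
    by (rule summableI_nonneg_bounded[where x = C]) (use c0 C in auto)
  then have lim: "?c \<longlonglongrightarrow> 0" by (rule summable_LIMSEQ_zero)
  fix \<epsilon> :: real assume "0 < \<epsilon>"
  \<comment> \<open>With these choices \<open>|h n| \<le> \<delta> / (1 - \<rho>) = sqrt \<eta>\<close> and \<open>- ln (1 - \<eta>) = \<epsilon>\<close>.\<close>
  define \<eta> where "\<eta> = 1 - exp (- \<epsilon>)"
  have \<eta>: "0 < \<eta>" "\<eta> < 1" "- ln (1 - \<eta>) = \<epsilon>" using \<open>0 < \<epsilon>\<close> by (auto simp: \<eta>_def)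
  define \<delta> where "\<delta> = sqrt \<eta> * (1 - \<rho>)"
  have \<delta>: "0 < \<delta>" using \<eta> \<rho> by (simp add: \<delta>_def)
  have "\<forall>\<^sub>F j in sequentially. ?c j < \<delta>\<^sup>2"
    using order_tendstoD(2)[OF lim] \<delta> by simp
  then obtain n where n: "\<And>m. n \<le> m \<Longrightarrow> ?c m < \<delta>\<^sup>2"
    by (auto simp: eventually_sequentially)
  have r\<delta>: "norm (r m) \<le> \<delta>" if "n \<le> m" for m
  proof (rule power2_le_imp_le)
    show "(norm (r m))\<^sup>2 \<le> \<delta>\<^sup>2" using c[of m] n[OF that] by linarith
  qed (use \<delta> in simp)
  have "log_defect \<rho> (h n) \<le> (\<integral>\<zeta>. \<epsilon> \<partial>(\<tau> :: (complex ^ 'd) measure))"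
    unfolding log_defect_def
  proof (intro integral_mono integrable_torus_lebesgue_continuous continuous_log_h \<rho> continuous_on_const)
    fix \<zeta> :: "complex ^ 'd" assume "\<zeta> \<in> space \<tau>"
    then have "norm (h n (of_real \<rho> *s \<zeta>)) \<le> sqrt \<eta>"
      using iterate_tail_bound[OF r\<delta>, of n \<zeta> \<rho>] \<rho> by (simp add: \<delta>_def)
    then have "(norm (h n (of_real \<rho> *s \<zeta>)))\<^sup>2 \<le> (sqrt \<eta>)\<^sup>2" by (intro power_mono) auto
    then have "(norm (h n (of_real \<rho> *s \<zeta>)))\<^sup>2 \<le> \<eta>" using \<eta> by simp
    then have "ln (1 - \<eta>) \<le> ln (1 - (norm (h n (of_real \<rho> *s \<zeta>)))\<^sup>2)"
      using \<eta>(2) by (subst ln_le_cancel_iff) linarith+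
    then show "- ln (1 - (norm (h n (of_real \<rho> *s \<zeta>)))\<^sup>2) \<le> \<epsilon>" using \<eta>(3) by simp
  qed
  also have "\<dots> = \<epsilon>" using prob_space by simp
  finally show "log_defect \<rho> (h 0) \<le> C + \<epsilon>"
    using log_defect_le_partial_sum[OF \<rho>, of n] C[of n] by linarith
qed

end

section \<open>The Poisson kernel of the torus\<close>

lemma poisson_denominator:
  fixes \<rho> x :: real
  assumes "0 \<le> \<rho>" "\<rho> < 1" "\<bar>x\<bar> \<le> 1"
  shows "(1 - \<rho>)\<^sup>2 \<le> 1 - 2 * \<rho> * x + \<rho>\<^sup>2" "1 - 2 * \<rho> * x + \<rho>\<^sup>2 \<le> (1 + \<rho>)\<^sup>2"
    "0 < 1 - 2 * \<rho> * x + \<rho>\<^sup>2"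
proof -
  have "\<rho> * x \<le> \<rho> * 1" "\<rho> * - 1 \<le> \<rho> * x"
    using assms by (intro mult_left_mono; simp)+
  then show 1: "(1 - \<rho>)\<^sup>2 \<le> 1 - 2 * \<rho> * x + \<rho>\<^sup>2" "1 - 2 * \<rho> * x + \<rho>\<^sup>2 \<le> (1 + \<rho>)\<^sup>2"
    by (simp_all add: power2_eq_square algebra_simps)
  have "0 < (1 - \<rho>)\<^sup>2" using assms by simp
  then show "0 < 1 - 2 * \<rho> * x + \<rho>\<^sup>2" using 1 by linarith
qed

text \<open>
  The argument \<open>x\<close> is the cosine of the angle between the two points of the circle.
\<close>

definition circle_poisson :: "real \<Rightarrow> real \<Rightarrow> real" where
  "circle_poisson \<rho> x = (1 - \<rho>\<^sup>2) / (1 - 2 * \<rho> * x + \<rho>\<^sup>2)"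

lemma circle_poisson_bounds:
  assumes "0 \<le> \<rho>" "\<rho> < 1" "\<bar>x\<bar> \<le> 1"
  shows "(1 - \<rho>\<^sup>2) / (1 + \<rho>)\<^sup>2 \<le> circle_poisson \<rho> x" "circle_poisson \<rho> x \<le> (1 - \<rho>\<^sup>2) / (1 - \<rho>)\<^sup>2"
    "0 < (1 - \<rho>\<^sup>2) / (1 + \<rho>)\<^sup>2"
proof -
  have r: "0 < 1 - \<rho>\<^sup>2" "0 < (1 - \<rho>)\<^sup>2" "0 < (1 + \<rho>)\<^sup>2" using assms by (auto simp: abs_square_less_1)
  note d = poisson_denominator[OF assms]
  show "(1 - \<rho>\<^sup>2) / (1 + \<rho>)\<^sup>2 \<le> circle_poisson \<rho> x" "circle_poisson \<rho> x \<le> (1 - \<rho>\<^sup>2) / (1 - \<rho>)\<^sup>2"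
    unfolding circle_poisson_def
    by (rule divide_left_mono[OF d(2) less_imp_le[OF r(1)] mult_pos_pos[OF r(3) d(3)]],
        rule divide_left_mono[OF d(1) less_imp_le[OF r(1)] mult_pos_pos[OF d(3) r(2)]])
  show "0 < (1 - \<rho>\<^sup>2) / (1 + \<rho>)\<^sup>2" using r by (intro divide_pos_pos)
qed

lemma circle_poisson_pos:
  "0 \<le> \<rho> \<Longrightarrow> \<rho> < 1 \<Longrightarrow> \<bar>x\<bar> \<le> 1 \<Longrightarrow> 0 < circle_poisson \<rho> x"
  using circle_poisson_bounds[of \<rho> x] by linarith

lemma continuous_circle_poisson:
  assumes "0 \<le> \<rho>" "\<rho> < 1" "continuous_on S g" "\<And>x. x \<in> S \<Longrightarrow> \<bar>g x\<bar> \<le> 1"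
  shows "continuous_on S (\<lambda>x. circle_poisson \<rho> (g x))"
  unfolding circle_poisson_def
  by (intro continuous_intros assms(3)) (use poisson_denominator(3)[OF assms(1,2) assms(4)] in force)

text \<open>
  The kernel is the real part of \<open>(1 + z) / (1 - z)\<close> at \<open>z = \<rho> e\<^sup>i\<^sup>t\<close>. The second integral measures its
  concentration at \<open>t = 0\<close>; it follows from the first since the kernel times its denominator is constant.
\<close>

lemma angle_integrals_circle_poisson:
  assumes \<rho>: "0 < \<rho>" "\<rho> < 1"
  shows "(\<integral>\<^sup>+t. ennreal (circle_poisson \<rho> (cos t)) \<partial>angle_measure) = 1"
    and "(\<integral>\<^sup>+t. ennreal (circle_poisson \<rho> (cos t) * (1 - cos t)) \<partial>angle_measure) = ennreal (1 - \<rho>)"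
proof -
  interpret prob_space angle_measure by (rule prob_space_angle_measure)
  let ?p = "\<lambda>t. circle_poisson \<rho> (cos t)"
  have r: "0 \<le> \<rho>" using \<rho> by simp
  define \<phi> :: "complex \<Rightarrow> complex" where "\<phi> z = (1 + z) / (1 - z)" for z
  have hol: "\<phi> holomorphic_on ball 0 1"
    unfolding \<phi>_def by (intro holomorphic_intros) auto
  have re: "Re (\<phi> (of_real \<rho> * cis t)) = ?p t" for t
  proof -
    have "(1 - \<rho> * cos t)\<^sup>2 + (\<rho> * sin t)\<^sup>2 = 1 - 2 * \<rho> * cos t + \<rho>\<^sup>2"
      using sin_cos_squared_add3[of t] by (simp add: power2_eq_square algebra_simps flip: distrib_left)
    moreover have "(1 + \<rho> * cos t) * (1 - \<rho> * cos t) - \<rho> * sin t * (\<rho> * sin t) = 1 - \<rho>\<^sup>2"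
      using sin_cos_squared_add3[of t] by (simp add: power2_eq_square algebra_simps flip: distrib_left)
    ultimately show ?thesis
      by (simp add: \<phi>_def circle_poisson_def Re_divide power2_eq_square)
  qed
  note mv = circle_mean_value[OF hol r \<rho>(2)]
  have int: "integrable angle_measure ?p"
    using integrable_Re[OF mv(2)] by (simp only: re)
  have one: "(\<integral>t. ?p t \<partial>angle_measure) = 1"
    using integral_Re[OF mv(2)] unfolding re mv(1) by (simp add: \<phi>_def)
  have pos: "0 < ?p t" for t by (rule circle_poisson_pos[OF r \<rho>(2)]) simp
  then show "(\<integral>\<^sup>+t. ennreal (?p t) \<partial>angle_measure) = 1"
    using nn_integral_eq_integral[OF int] one by (simp add: less_imp_le)
  have eq: "?p t * (1 - cos t) = ((1 - \<rho>\<^sup>2) - (1 - \<rho>)\<^sup>2 * ?p t) / (2 * \<rho>)" for t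
  proof -
    have "?p t * (1 - 2 * \<rho> * cos t + \<rho>\<^sup>2) = 1 - \<rho>\<^sup>2"
      unfolding circle_poisson_def using poisson_denominator(3)[OF r \<rho>(2), of "cos t"] by simp
    then have "2 * \<rho> * (?p t * (1 - cos t)) = (1 - \<rho>\<^sup>2) - (1 - \<rho>)\<^sup>2 * ?p t"
      by (simp add: power2_eq_square algebra_simps)
    then show ?thesis using \<rho> by (simp add: field_simps)
  qed
  have int2: "integrable angle_measure (\<lambda>t. ?p t * (1 - cos t))"
    unfolding eq using int by (intro integrable_divide_zero Bochner_Integration.integrable_diff integrable_mult_right integrable_const)
  have "(\<integral>t. ?p t * (1 - cos t) \<partial>angle_measure) = ((1 - \<rho>\<^sup>2) - (1 - \<rho>)\<^sup>2) / (2 * \<rho>)"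
    unfolding eq using int one prob_space by (simp add: Bochner_Integration.integral_diff)
  also have "\<dots> = 1 - \<rho>" using \<rho> by (simp add: field_simps power2_eq_square)
  finally show "(\<integral>\<^sup>+t. ennreal (?p t * (1 - cos t)) \<partial>angle_measure) = ennreal (1 - \<rho>)"
    using nn_integral_eq_integral[OF int2] pos by (simp add: less_imp_le)
qed

lemma nn_integral_angle_measure:
  assumes [measurable]: "g \<in> borel_measurable borel"
  shows "ennreal (2 * pi) * (\<integral>\<^sup>+t. g t \<partial>angle_measure) = (\<integral>\<^sup>+t. g t * indicator {0..<2 * pi} t \<partial>lborel)"
proof -
  have "(\<integral>\<^sup>+t. g t \<partial>angle_measure) = (\<integral>\<^sup>+t. ennreal (indicator {0..2 * pi} t / (2 * pi)) * g t \<partial>lborel)"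
    unfolding angle_measure_def
  proof (rule nn_integral_density)
    have "(\<lambda>t. indicator {0..2 * pi} t / (2 * pi)) \<in> borel_measurable lborel"
      by (intro borel_measurable_divide borel_measurable_indicator borel_measurable_const) simp
    then show "(\<lambda>t. ennreal (indicator {0..2 * pi} t / (2 * pi))) \<in> borel_measurable lborel" by simp
  qed simp
  also have "\<dots> = (\<integral>\<^sup>+t. ennreal (1 / (2 * pi)) * (g t * indicator {0..2 * pi} t) \<partial>lborel)"
    by (intro nn_integral_cong) (simp add: indicator_def)
  also have "\<dots> = ennreal (1 / (2 * pi)) * (\<integral>\<^sup>+t. g t * indicator {0..2 * pi} t \<partial>lborel)"
    by (rule nn_integral_cmult) simp
  also have "(\<integral>\<^sup>+t. g t * indicator {0..2 * pi} t \<partial>lborel) = (\<integral>\<^sup>+t. g t * indicator {0..<2 * pi} t \<partial>lborel)"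
    by (rule nn_integral_cong_AE) (use AE_lborel_singleton[of "2 * pi"] in eventually_elim, auto simp: indicator_def)
  finally have "ennreal (2 * pi) * (\<integral>\<^sup>+t. g t \<partial>angle_measure) =
      (ennreal (2 * pi) * ennreal (1 / (2 * pi))) * (\<integral>\<^sup>+t. g t * indicator {0..<2 * pi} t \<partial>lborel)"
    by (simp only: mult.assoc)
  also have "ennreal (2 * pi) * ennreal (1 / (2 * pi)) = 1"
    by (simp flip: ennreal_mult)
  finally show ?thesis by simp
qed

lemma torus_borel_measurable_from_borel:
  "g \<in> borel_measurable borel \<Longrightarrow> g \<in> borel_measurable torus_borel"
  by (rule measurable_restrict_space1)

lemma nn_integral_torus_prod:
  fixes F :: "'d::finite \<Rightarrow> complex \<Rightarrow> real"
  assumes m[measurable]: "\<And>j. F j \<in> borel_measurable borel" and nn: "\<And>j t. 0 \<le> F j (cis t)"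
  shows "(\<integral>\<^sup>+\<zeta>. ennreal (\<Prod>j\<in>UNIV. F j (\<zeta> $ j)) \<partial>(\<tau> :: (complex ^ 'd) measure)) =
    (\<Prod>j\<in>UNIV. \<integral>\<^sup>+t. ennreal (F j (cis t)) \<partial>angle_measure)"
proof -
  have [measurable]: "cis \<in> borel_measurable borel"
    by (intro borel_measurable_continuous_onI continuous_intros)
  have [measurable]: "(\<lambda>\<zeta> :: complex ^ 'd. \<zeta> $ j) \<in> borel_measurable borel" for j
    by (intro borel_measurable_continuous_onI continuous_intros)
  let ?G = "\<lambda>j t. F j (cis t) * indicator {0..<2 * pi} t"
  have eq: "ennreal (\<Prod>j\<in>UNIV. F j (cis_vec \<theta> $ j)) * indicator fundamental_box \<theta> =
      ennreal (\<Prod>j\<in>UNIV. ?G j (\<theta> $ j))" for \<theta>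
  proof (cases "\<theta> \<in> fundamental_box")
    case True
    then show ?thesis by (simp add: fundamental_box_def cis_vec_def)
  next
    case False
    then obtain j where "\<theta> $ j \<notin> {0..<2 * pi}" by (auto simp: fundamental_box_def)
    then have "\<exists>j\<in>UNIV. ?G j (\<theta> $ j) = 0" by (intro bexI[of _ j]) (simp_all add: indicator_def)
    then have "(\<Prod>j\<in>UNIV. ?G j (\<theta> $ j)) = 0" by (intro prod_zero) simp_all
    then show ?thesis by (simp only: indicator_simps(2)[OF False] ennreal_0 mult_zero_right)
  qed
  have "(\<integral>\<^sup>+\<zeta>. ennreal (\<Prod>j\<in>UNIV. F j (\<zeta> $ j)) \<partial>(\<tau> :: (complex ^ 'd) measure)) =
      (\<integral>\<^sup>+\<theta>. ennreal (\<Prod>j\<in>UNIV. ?G j (\<theta> $ j)) \<partial>(lborel :: (real ^ 'd) measure)) / ennreal ((2 * pi) ^ CARD('d))"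
    by (subst nn_integral_torus_lebesgue) (intro torus_borel_measurable_from_borel, measurable, simp only: eq)
  also have "(\<integral>\<^sup>+\<theta>. ennreal (\<Prod>j\<in>UNIV. ?G j (\<theta> $ j)) \<partial>(lborel :: (real ^ 'd) measure)) =
      (\<Prod>j\<in>UNIV. \<integral>\<^sup>+t. ennreal (?G j t) \<partial>lborel)"
    by (rule nn_integral_lborel_coordinate_prod) (measurable, simp add: nn)
  also have "\<dots> = (\<Prod>j\<in>UNIV. ennreal (2 * pi) * (\<integral>\<^sup>+t. ennreal (F j (cis t)) \<partial>angle_measure))"
    by (intro prod.cong refl, subst nn_integral_angle_measure)
      (measurable, intro nn_integral_cong, simp add: indicator_def)
  also have "(\<Prod>j\<in>UNIV. ennreal (2 * pi) * (\<integral>\<^sup>+t. ennreal (F j (cis t)) \<partial>angle_measure)) =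
      ennreal ((2 * pi) ^ CARD('d)) * (\<Prod>j\<in>UNIV. \<integral>\<^sup>+t. ennreal (F j (cis t)) \<partial>angle_measure)"
    by (simp add: prod.distrib ennreal_power)
  also have "\<dots> / ennreal ((2 * pi) ^ CARD('d)) = (\<Prod>j\<in>UNIV. \<integral>\<^sup>+t. ennreal (F j (cis t)) \<partial>angle_measure)"
    by (subst mult.commute, rule mult_divide_eq_ennreal) simp_all
  finally show ?thesis .
qed

definition torus_poisson :: "real \<Rightarrow> complex ^ 'd \<Rightarrow> complex ^ 'd \<Rightarrow> real" where
  "torus_poisson \<rho> \<zeta> \<eta> = (\<Prod>j\<in>UNIV. circle_poisson \<rho> (Re (\<zeta> $ j * cnj (\<eta> $ j))))"

lemma abs_Re_torus_le_1:
  assumes "\<zeta> \<in> torus" "\<eta> \<in> torus"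
  shows "\<bar>Re (\<zeta> $ j * cnj (\<eta> $ j))\<bar> \<le> 1"
  using abs_Re_le_cmod[of "\<zeta> $ j * cnj (\<eta> $ j)"] assms by (simp add: torus_def norm_mult)

lemma poisson_kernel_eq_torus_poisson:
  assumes \<zeta>: "\<zeta> \<in> torus" and \<eta>: "\<eta> \<in> torus" and \<rho>: "0 < \<rho>"
  shows "poisson_kernel (of_real \<rho> *s \<zeta>) \<eta> = torus_poisson \<rho> \<zeta> \<eta>"
  unfolding poisson_kernel_def torus_poisson_def circle_poisson_def
proof (rule prod.cong[OF refl])
  fix j
  have 1: "norm (\<zeta> $ j) = 1" "norm (\<eta> $ j) = 1" using \<zeta> \<eta> by (auto simp: torus_def)
  then have c: "\<zeta> $ j = cis (Arg (\<zeta> $ j))" "\<eta> $ j = cis (Arg (\<eta> $ j))"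
    using rcis_cmod_Arg[of "\<zeta> $ j"] rcis_cmod_Arg[of "\<eta> $ j"] by (simp_all add: rcis_def)
  have "Re (\<zeta> $ j * cnj (\<eta> $ j)) = cos (Arg (\<zeta> $ j) - Arg (\<eta> $ j))"
    by (subst c(1), subst c(2)) (simp add: cos_diff)
  then show "(1 - (norm ((of_real \<rho> *s \<zeta>) $ j))\<^sup>2) /
      (1 - 2 * norm ((of_real \<rho> *s \<zeta>) $ j) * cos (Arg ((of_real \<rho> *s \<zeta>) $ j) - Arg (\<eta> $ j)) + (norm ((of_real \<rho> *s \<zeta>) $ j))\<^sup>2) =
      (1 - \<rho>\<^sup>2) / (1 - 2 * \<rho> * Re (\<zeta> $ j * cnj (\<eta> $ j)) + \<rho>\<^sup>2)"
    using \<rho> 1 by (simp add: norm_mult)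
qed

lemma torus_poisson_bounds:
  fixes \<rho> :: real
  assumes "0 \<le> \<rho>" "\<rho> < 1"
  obtains c C where "0 < c" "c \<le> C"
    "\<And>\<zeta> \<eta> :: complex ^ 'd. \<zeta> \<in> torus \<Longrightarrow> \<eta> \<in> torus \<Longrightarrow> c \<le> torus_poisson \<rho> \<zeta> \<eta>"
    "\<And>\<zeta> \<eta> :: complex ^ 'd. \<zeta> \<in> torus \<Longrightarrow> \<eta> \<in> torus \<Longrightarrow> torus_poisson \<rho> \<zeta> \<eta> \<le> C"
proof
  let ?c = "\<Prod>j\<in>(UNIV :: 'd set). (1 - \<rho>\<^sup>2) / (1 + \<rho>)\<^sup>2" and ?C = "\<Prod>j\<in>(UNIV :: 'd set). (1 - \<rho>\<^sup>2) / (1 - \<rho>)\<^sup>2"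
  note b = circle_poisson_bounds[OF assms]
  have b3: "0 < (1 - \<rho>\<^sup>2) / (1 + \<rho>)\<^sup>2" using b(3)[of 0] by simp
  show "0 < ?c" by (intro prod_pos b3)
  have "(1 - \<rho>\<^sup>2) / (1 + \<rho>)\<^sup>2 \<le> (1 - \<rho>\<^sup>2) / (1 - \<rho>)\<^sup>2" using b(1,2)[of 0] by simp
  then show "?c \<le> ?C" using b3 by (intro prod_mono) simp
  fix \<zeta> \<eta> :: "complex ^ 'd" assume t: "\<zeta> \<in> torus" "\<eta> \<in> torus"
  note b' = b[OF abs_Re_torus_le_1[OF t]]
  show "?c \<le> torus_poisson \<rho> \<zeta> \<eta>"
    unfolding torus_poisson_def by (intro prod_mono conjI b'(1) less_imp_le[OF b3])
  show "torus_poisson \<rho> \<zeta> \<eta> \<le> ?C"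
    unfolding torus_poisson_def
    by (intro prod_mono conjI b'(2) order_trans[OF less_imp_le[OF b3] b'(1)])
qed

lemma torus_poisson_pos:
  assumes "0 \<le> \<rho>" "\<rho> < 1" "\<zeta> \<in> torus" "\<eta> \<in> torus"
  shows "0 < torus_poisson \<rho> \<zeta> \<eta>"
  unfolding torus_poisson_def
  by (intro prod_pos circle_poisson_pos assms abs_Re_torus_le_1)

lemma torus_poisson_commute: "torus_poisson \<rho> \<zeta> \<eta> = torus_poisson \<rho> \<eta> \<zeta>"
  by (simp add: torus_poisson_def mult.commute)

lemma borel_measurable_torus_poisson:
  fixes M N :: "(complex ^ 'd) measure"
  assumes "sets M = sets torus_borel" "sets N = sets torus_borel"
  shows "(\<lambda>(\<zeta>, \<eta>). torus_poisson \<rho> \<zeta> \<eta>) \<in> borel_measurable (M \<Otimes>\<^sub>M N)"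
proof -
  have "(\<lambda>p. (fst p, snd p)) \<in> M \<Otimes>\<^sub>M N \<rightarrow>\<^sub>M borel \<Otimes>\<^sub>M borel"
  proof (rule measurable_Pair)
    have "fst \<in> M \<Otimes>\<^sub>M N \<rightarrow>\<^sub>M torus_borel" "snd \<in> M \<Otimes>\<^sub>M N \<rightarrow>\<^sub>M torus_borel"
      using measurable_fst[of M N] measurable_snd[of M N] assms by (simp_all cong: measurable_cong_sets)
    then show "fst \<in> borel_measurable (M \<Otimes>\<^sub>M N)" "snd \<in> borel_measurable (M \<Otimes>\<^sub>M N)"
      by (simp_all add: measurable_restrict_space2_iff)
  qed
  moreover have "(\<lambda>p. torus_poisson \<rho> (fst p) (snd p)) \<in> borel_measurable (borel :: ((complex ^ 'd) \<times> (complex ^ 'd)) measure)"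
    unfolding torus_poisson_def circle_poisson_def
    by (intro borel_measurable_prod borel_measurable_divide borel_measurable_continuous_onI continuous_intros)
  ultimately show ?thesis
    using measurable_compose[of "\<lambda>p. (fst p, snd p)" _ "borel :: ((complex ^ 'd) \<times> (complex ^ 'd)) measure" "\<lambda>p. torus_poisson \<rho> (fst p) (snd p)"]
    by (simp add: borel_prod case_prod_unfold)
qed

lemma continuous_torus_poisson:
  assumes "0 \<le> \<rho>" "\<rho> < 1" "\<zeta> \<in> torus"
  shows "continuous_on torus (torus_poisson \<rho> \<zeta>)"
  unfolding torus_poisson_def[abs_def]
  by (intro continuous_on_prod continuous_circle_poisson assms continuous_intros abs_Re_torus_le_1)

text \<open>
  A rotation moves \<open>\<zeta>\<close> to \<open>1\<close>, after which the integrand is a product of functions of single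
  coordinates.
\<close>

lemma torus_poisson_integrals:
  fixes \<zeta> :: "complex ^ 'd"
  assumes \<rho>: "0 < \<rho>" "\<rho> < 1" and \<zeta>: "\<zeta> \<in> torus"
  shows "(\<integral>\<eta>. torus_poisson \<rho> \<zeta> \<eta> \<partial>\<tau>) = 1"
    and "(\<integral>\<eta>. torus_poisson \<rho> \<zeta> \<eta> * (1 - Re (\<zeta> $ i * cnj (\<eta> $ i))) \<partial>\<tau>) = 1 - \<rho>"
proof -
  have r: "0 \<le> \<rho>" using \<rho> by simp
  let ?p = "\<lambda>\<eta> :: complex ^ 'd. \<Prod>j\<in>UNIV. circle_poisson \<rho> (Re (\<eta> $ j))"
  have re: "Re (\<zeta> $ j * cnj (torus_rotation \<zeta> \<eta> $ j)) = Re (\<eta> $ j)" for \<eta> j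
  proof -
    have "\<zeta> $ j * cnj (\<zeta> $ j) = 1" using \<zeta> by (simp add: torus_def complex_norm_square[symmetric])
    then have "\<zeta> $ j * cnj (torus_rotation \<zeta> \<eta> $ j) = cnj (\<eta> $ j)"
      by (simp add: torus_rotation_def mult.assoc[symmetric])
    then show ?thesis by simp
  qed
  have rot: "torus_poisson \<rho> \<zeta> (torus_rotation \<zeta> \<eta>) = ?p \<eta>" for \<eta>
    unfolding torus_poisson_def re ..
  have Re1: "\<bar>Re (\<eta> $ j)\<bar> \<le> 1" if "\<eta> \<in> torus" for \<eta> :: "complex ^ 'd" and j
    using abs_Re_le_cmod[of "\<eta> $ j"] that by (simp add: torus_def)
  have ppos: "0 < ?p \<eta>" if "\<eta> \<in> torus" for \<eta>
    by (intro prod_pos circle_poisson_pos r \<rho> Re1 that)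
  have pc: "continuous_on torus ?p"
    by (intro continuous_on_prod continuous_circle_poisson r \<rho> continuous_intros Re1)
  have m: "(\<lambda>z. circle_poisson \<rho> (Re z)) \<in> borel_measurable borel"
    unfolding circle_poisson_def
    by (intro borel_measurable_divide borel_measurable_continuous_onI continuous_intros)
  note ang = angle_integrals_circle_poisson[OF \<rho>]
  have cp: "0 \<le> circle_poisson \<rho> (cos t)" for t
    by (rule less_imp_le[OF circle_poisson_pos[OF r \<rho>(2)]]) simp
  have "(\<integral>\<eta>. torus_poisson \<rho> \<zeta> \<eta> \<partial>\<tau>) = (\<integral>\<eta>. ?p \<eta> \<partial>\<tau>)"
    using torus_integral_rotation[OF torus_borel_measurable_continuous[OF continuous_torus_poisson[OF r \<rho>(2) \<zeta>]] \<zeta>]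
    by (simp only: rot)
  also have "\<dots> = enn2real (\<integral>\<^sup>+\<eta>. ennreal (?p \<eta>) \<partial>\<tau>)"
    by (rule integral_eq_nn_integral)
      (use integrable_torus_lebesgue_continuous[OF pc] ppos in \<open>auto intro!: AE_I2 intro: less_imp_le\<close>)
  also have "(\<integral>\<^sup>+\<eta>. ennreal (?p \<eta>) \<partial>\<tau>) = 1"
    using nn_integral_torus_prod[of "\<lambda>j z. circle_poisson \<rho> (Re z)", OF m] cp by (simp add: ang(1))
  finally show "(\<integral>\<eta>. torus_poisson \<rho> \<zeta> \<eta> \<partial>\<tau>) = 1" by simp
  let ?F = "\<lambda>j z. if j = i then circle_poisson \<rho> (Re z) * (1 - Re z) else circle_poisson \<rho> (Re z)"
  have eq: "?p \<eta> * (1 - Re (\<eta> $ i)) = (\<Prod>j\<in>UNIV. ?F j (\<eta> $ j))" for \<eta>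
  proof -
    have "(\<Prod>j\<in>UNIV. ?F j (\<eta> $ j)) = (\<Prod>j\<in>UNIV. circle_poisson \<rho> (Re (\<eta> $ j)) * (if j = i then 1 - Re (\<eta> $ j) else 1))"
      by (intro prod.cong) auto
    then show ?thesis by (simp add: prod.distrib)
  qed
  have c2: "continuous_on torus (\<lambda>\<eta>. torus_poisson \<rho> \<zeta> \<eta> * (1 - Re (\<zeta> $ i * cnj (\<eta> $ i))))"
    by (intro continuous_intros continuous_torus_poisson[OF r \<rho>(2) \<zeta>])
  have c3: "continuous_on torus (\<lambda>\<eta>. ?p \<eta> * (1 - Re (\<eta> $ i)))"
    by (intro continuous_intros pc)
  have "(\<integral>\<eta>. torus_poisson \<rho> \<zeta> \<eta> * (1 - Re (\<zeta> $ i * cnj (\<eta> $ i))) \<partial>\<tau>) =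
      (\<integral>\<eta>. ?p \<eta> * (1 - Re (\<eta> $ i)) \<partial>\<tau>)"
    using torus_integral_rotation[OF torus_borel_measurable_continuous[OF c2] \<zeta>]
    by (simp only: rot re)
  also have "\<dots> = enn2real (\<integral>\<^sup>+\<eta>. ennreal (?p \<eta> * (1 - Re (\<eta> $ i))) \<partial>\<tau>)"
  proof (rule integral_eq_nn_integral)
    show "(\<lambda>\<eta>. ?p \<eta> * (1 - Re (\<eta> $ i))) \<in> borel_measurable \<tau>"
      using integrable_torus_lebesgue_continuous[OF c3] by auto
    show "AE \<eta> in \<tau>. 0 \<le> ?p \<eta> * (1 - Re (\<eta> $ i))"
    proof (rule AE_I2)
      fix \<eta> :: "complex ^ 'd" assume "\<eta> \<in> space \<tau>"
      then show "0 \<le> ?p \<eta> * (1 - Re (\<eta> $ i))"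
        using ppos[of \<eta>] Re1[of \<eta> i] by (intro mult_nonneg_nonneg) auto
    qed
  qed
  also have "(\<integral>\<^sup>+\<eta>. ennreal (?p \<eta> * (1 - Re (\<eta> $ i))) \<partial>\<tau>) =
      (\<Prod>j\<in>(UNIV :: 'd set). \<integral>\<^sup>+t. ennreal (?F j (cis t)) \<partial>angle_measure)"
    unfolding eq
  proof (rule nn_integral_torus_prod)
    show "?F j \<in> borel_measurable borel" for j
      using m by (cases "j = i") (auto intro!: borel_measurable_times borel_measurable_diff borel_measurable_Re)
    show "0 \<le> ?F j (cis t)" for j t using cp[of t] by simp
  qed
  also have "\<dots> = (\<Prod>j\<in>(UNIV :: 'd set). if j = i then ennreal (1 - \<rho>) else 1)"
    by (intro prod.cong refl) (simp add: ang)
  also have "\<dots> = ennreal (1 - \<rho>)" by simp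
  finally show "(\<integral>\<eta>. torus_poisson \<rho> \<zeta> \<eta> * (1 - Re (\<zeta> $ i * cnj (\<eta> $ i))) \<partial>\<tau>) = 1 - \<rho>"
    using \<rho> by simp
qed

text \<open>
  A Korovkin argument: uniform continuity gives \<open>|v \<eta> - v \<zeta>| \<le> \<epsilon> / 2 + (2 * M / \<delta>\<^sup>2) |\<eta> - \<zeta>|\<^sup>2\<close>, and
  \<open>|\<eta> - \<zeta>|\<^sup>2\<close> is a combination of the test functions \<open>1 - Re (\<zeta> $ j * cnj (\<eta> $ j))\<close>, whose Poisson
  integrals are all \<open>1 - \<rho>\<close>.
\<close>

lemma poisson_approximate_identity:
  fixes v :: "complex ^ 'd \<Rightarrow> real"
  assumes v: "continuous_on torus v" and "0 < \<epsilon>"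
  obtains \<rho> where "0 < \<rho>" "\<rho> < 1"
    "\<And>\<zeta>. \<zeta> \<in> torus \<Longrightarrow> \<bar>(\<integral>\<eta>. torus_poisson \<rho> \<zeta> \<eta> * v \<eta> \<partial>\<tau>) - v \<zeta>\<bar> \<le> \<epsilon>"
proof -
  have "bounded (v ` torus)"
    by (rule compact_imp_bounded[OF compact_continuous_image[OF v compact_torus]])
  then obtain M where M: "\<And>\<zeta>. \<zeta> \<in> torus \<Longrightarrow> \<bar>v \<zeta>\<bar> \<le> M" by (auto simp: bounded_iff)
  have M0: "0 \<le> M" using M[OF cis_vec_in_torus] abs_ge_zero order_trans by blast
  have "uniformly_continuous_on torus v" by (rule compact_uniformly_continuous[OF v compact_torus])
  then obtain \<delta> where \<delta>: "0 < \<delta>"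
    "\<And>\<zeta> \<eta>. \<zeta> \<in> torus \<Longrightarrow> \<eta> \<in> torus \<Longrightarrow> dist \<eta> \<zeta> < \<delta> \<Longrightarrow> dist (v \<eta>) (v \<zeta>) < \<epsilon> / 2"
    using \<open>0 < \<epsilon>\<close> unfolding uniformly_continuous_on_def by (metis half_gt_zero)
  \<comment> \<open>The identity \<open>|\<eta> - \<zeta>|\<^sup>2 = \<Sum>j. 2 * (1 - Re (\<zeta> $ j * cnj (\<eta> $ j)))\<close> turns \<open>2 * M / \<delta>\<^sup>2\<close> into \<open>K\<close>.\<close>
  define K where "K = 4 * M / \<delta>\<^sup>2"
  have K0: "0 \<le> K" using M0 by (simp add: K_def)
  define A where "A = K * CARD('d) + 1"
  have A: "0 < A" using K0 by (simp add: A_def add_nonneg_pos)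
  define \<rho> where "\<rho> = max (1 / 2) (1 - \<epsilon> / 2 / A)"
  have \<rho>: "0 < \<rho>" "\<rho> < 1" using A \<open>0 < \<epsilon>\<close> by (auto simp: \<rho>_def)
  have "1 - \<rho> \<le> \<epsilon> / 2 / A" by (simp add: \<rho>_def max_def)
  then have "(1 - \<rho>) * A \<le> \<epsilon> / 2" using A by (simp add: pos_le_divide_eq)
  moreover have "(1 - \<rho>) * (K * CARD('d)) \<le> (1 - \<rho>) * A" using \<rho> by (intro mult_left_mono) (auto simp: A_def)
  ultimately have small: "K * CARD('d) * (1 - \<rho>) \<le> \<epsilon> / 2" by (simp add: mult.commute)
  have r: "0 \<le> \<rho>" using \<rho> by simp
  show thesis
  proof (rule that[OF \<rho>])
    fix \<zeta> :: "complex ^ 'd" assume \<zeta>: "\<zeta> \<in> torus"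
    let ?P = "torus_poisson \<rho> \<zeta>" and ?R = "\<lambda>\<eta>. \<Sum>j\<in>UNIV. 1 - Re (\<zeta> $ j * cnj (\<eta> $ j))"
    note Pc = continuous_torus_poisson[OF r \<rho>(2) \<zeta>]
    have Rnn: "0 \<le> ?R \<eta>" if "\<eta> \<in> torus" for \<eta>
      using abs_Re_torus_le_1[OF \<zeta> that] by (intro sum_nonneg) (simp add: abs_le_iff)
    have pt: "\<bar>v \<eta> - v \<zeta>\<bar> \<le> \<epsilon> / 2 + K * ?R \<eta>" if \<eta>: "\<eta> \<in> torus" for \<eta>
    proof (cases "dist \<eta> \<zeta> < \<delta>")
      case True
      then have "\<bar>v \<eta> - v \<zeta>\<bar> \<le> \<epsilon> / 2" using \<delta>(2)[OF \<zeta> \<eta>] by (simp add: dist_real_def)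
      moreover have "0 \<le> K * ?R \<eta>" using K0 Rnn[OF \<eta>] by (rule mult_nonneg_nonneg)
      ultimately show ?thesis by linarith
    next
      case False
      have "(dist \<eta> \<zeta>)\<^sup>2 = (\<Sum>j\<in>UNIV. (norm (\<eta> $ j - \<zeta> $ j))\<^sup>2)"
        by (simp add: dist_vec_def L2_set_def dist_norm sum_nonneg)
      also have "\<dots> = (\<Sum>j\<in>UNIV. 2 * (1 - Re (\<zeta> $ j * cnj (\<eta> $ j))))"
      proof (rule sum.cong[OF refl])
        fix j
        have "(norm (\<zeta> $ j))\<^sup>2 = 1" "(norm (\<eta> $ j))\<^sup>2 = 1" using \<zeta> \<eta> by (auto simp: torus_def)
        then show "(norm (\<eta> $ j - \<zeta> $ j))\<^sup>2 = 2 * (1 - Re (\<zeta> $ j * cnj (\<eta> $ j)))"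
          unfolding cmod_power2 by (simp add: power2_eq_square algebra_simps)
      qed
      also have "\<dots> = 2 * ?R \<eta>" by (simp add: sum_distrib_left)
      finally have "\<delta>\<^sup>2 \<le> 2 * ?R \<eta>"
        using False \<delta>(1) power_mono[of \<delta> "dist \<eta> \<zeta>" 2] by simp
      then have "2 * M * 1 \<le> 2 * M * (2 * ?R \<eta> / \<delta>\<^sup>2)"
        using M0 \<delta>(1) by (intro mult_left_mono) (simp_all add: pos_le_divide_eq)
      then have "2 * M \<le> K * ?R \<eta>" by (simp add: K_def)
      moreover have "\<bar>v \<eta> - v \<zeta>\<bar> \<le> 2 * M" using M[OF \<zeta>] M[OF \<eta>] by linarith
      ultimately show ?thesis using \<open>0 < \<epsilon>\<close> by linarith
    qed
    have ints: "integrable \<tau> (\<lambda>\<eta>. ?P \<eta> * v \<eta>)" "integrable \<tau> ?P"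
      "integrable \<tau> (\<lambda>\<eta>. ?P \<eta> * (v \<eta> - v \<zeta>))"
      "integrable \<tau> (\<lambda>\<eta>. ?P \<eta> * (\<epsilon> / 2 + K * ?R \<eta>))"
      "\<And>i. integrable \<tau> (\<lambda>\<eta>. ?P \<eta> * (1 - Re (\<zeta> $ i * cnj (\<eta> $ i))))"
      by (intro integrable_torus_lebesgue_continuous continuous_intros Pc v)+
    have "(\<integral>\<eta>. ?P \<eta> * v \<eta> \<partial>\<tau>) - v \<zeta> = (\<integral>\<eta>. ?P \<eta> * v \<eta> \<partial>\<tau>) - (\<integral>\<eta>. ?P \<eta> * v \<zeta> \<partial>\<tau>)"
      using torus_poisson_integrals(1)[OF \<rho> \<zeta>] by simp
    also have "\<dots> = (\<integral>\<eta>. ?P \<eta> * (v \<eta> - v \<zeta>) \<partial>\<tau>)"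
      by (subst Bochner_Integration.integral_diff[symmetric])
        (use ints in \<open>auto simp: right_diff_distrib\<close>)
    finally have "\<bar>(\<integral>\<eta>. ?P \<eta> * v \<eta> \<partial>\<tau>) - v \<zeta>\<bar> \<le> (\<integral>\<eta>. \<bar>?P \<eta> * (v \<eta> - v \<zeta>)\<bar> \<partial>\<tau>)"
      by (simp only: integral_abs_bound)
    also have "\<dots> \<le> (\<integral>\<eta>. ?P \<eta> * (\<epsilon> / 2 + K * ?R \<eta>) \<partial>\<tau>)"
    proof (rule integral_mono)
      show "integrable \<tau> (\<lambda>\<eta>. \<bar>?P \<eta> * (v \<eta> - v \<zeta>)\<bar>)"
        using ints(3) by (rule integrable_abs)
      fix \<eta> :: "complex ^ 'd" assume "\<eta> \<in> space \<tau>"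
      then have \<eta>: "\<eta> \<in> torus" by simp
      show "\<bar>?P \<eta> * (v \<eta> - v \<zeta>)\<bar> \<le> ?P \<eta> * (\<epsilon> / 2 + K * ?R \<eta>)"
        using torus_poisson_pos[OF r \<rho>(2) \<zeta> \<eta>] pt[OF \<eta>] by (simp add: abs_mult)
    qed (rule ints)
    also have "\<dots> = (\<integral>\<eta>. \<epsilon> / 2 * ?P \<eta> + K * (\<Sum>j\<in>UNIV. ?P \<eta> * (1 - Re (\<zeta> $ j * cnj (\<eta> $ j)))) \<partial>\<tau>)"
      by (intro Bochner_Integration.integral_cong refl) (simp only: sum_distrib_left[symmetric], simp add: algebra_simps)
    also have "\<dots> = \<epsilon> / 2 * (\<integral>\<eta>. ?P \<eta> \<partial>\<tau>) + K * (\<Sum>j\<in>UNIV. \<integral>\<eta>. ?P \<eta> * (1 - Re (\<zeta> $ j * cnj (\<eta> $ j))) \<partial>\<tau>)"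
      by (subst Bochner_Integration.integral_add, intro integrable_mult_right ints, intro integrable_mult_right Bochner_Integration.integrable_sum ints(5))
        (simp only: integral_mult_right_zero Bochner_Integration.integral_sum[OF ints(5)])
    also have "\<dots> = \<epsilon> / 2 + K * CARD('d) * (1 - \<rho>)"
      by (simp only: torus_poisson_integrals[OF \<rho> \<zeta>]) simp
    also have "\<dots> \<le> \<epsilon>" using small by simp
    finally show "\<bar>(\<integral>\<eta>. ?P \<eta> * v \<eta> \<partial>\<tau>) - v \<zeta>\<bar> \<le> \<epsilon>" .
  qed
qed

section \<open>Entropy of Poisson integrals\<close>

definition poisson_integral :: "real \<Rightarrow> (complex ^ 'd) measure \<Rightarrow> complex ^ 'd \<Rightarrow> real" where
  "poisson_integral \<rho> \<mu> \<zeta> = (\<integral>\<eta>. torus_poisson \<rho> \<zeta> \<eta> \<partial>\<mu>)"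

locale torus_probability = prob_space \<mu> for \<mu> :: "(complex ^ 'd) measure" +
  assumes sets_eq: "sets \<mu> = sets torus_borel"
begin

lemma space_eq: "space \<mu> = torus"
  using sets_eq_imp_space_eq[OF sets_eq] by simp

lemma integrable_continuous: "continuous_on torus F \<Longrightarrow> integrable \<mu> F"
  for F :: "complex ^ 'd \<Rightarrow> 'b::{banach, second_countable_topology}"
  by (rule integrable_torus_continuous[OF _ finite_measure sets_eq])

sublocale T: prob_space "\<tau> :: (complex ^ 'd) measure"
  by (rule prob_space_torus_lebesgue)

sublocale P: pair_prob_space "\<tau> :: (complex ^ 'd) measure" \<mu> ..

lemma poisson_integral_bounds:
  assumes "0 \<le> \<rho>" "\<rho> < 1"
  obtains c C where "0 < c" "\<And>\<zeta>. \<zeta> \<in> torus \<Longrightarrow> c \<le> poisson_integral \<rho> \<mu> \<zeta>"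
    "\<And>\<zeta>. \<zeta> \<in> torus \<Longrightarrow> poisson_integral \<rho> \<mu> \<zeta> \<le> C"
proof -
  obtain c C where b: "0 < c" "c \<le> C"
    "\<And>\<zeta> \<eta> :: complex ^ 'd. \<zeta> \<in> torus \<Longrightarrow> \<eta> \<in> torus \<Longrightarrow> c \<le> torus_poisson \<rho> \<zeta> \<eta>"
    "\<And>\<zeta> \<eta> :: complex ^ 'd. \<zeta> \<in> torus \<Longrightarrow> \<eta> \<in> torus \<Longrightarrow> torus_poisson \<rho> \<zeta> \<eta> \<le> C"
    by (rule torus_poisson_bounds[OF assms, where 'd = 'd]) blast
  note int = integrable_continuous[OF continuous_torus_poisson[OF assms]]
  show thesis
  proof (rule that[OF b(1)])
    fix \<zeta> :: "complex ^ 'd" assume \<zeta>: "\<zeta> \<in> torus"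
    have "(\<integral>\<eta>. c \<partial>\<mu>) \<le> poisson_integral \<rho> \<mu> \<zeta>"
      unfolding poisson_integral_def by (rule integral_mono[OF integrable_const int[OF \<zeta>]]) (use b(3) \<zeta> space_eq in auto)
    then show "c \<le> poisson_integral \<rho> \<mu> \<zeta>" using prob_space by simp
    have "poisson_integral \<rho> \<mu> \<zeta> \<le> (\<integral>\<eta>. C \<partial>\<mu>)"
      unfolding poisson_integral_def by (rule integral_mono[OF int[OF \<zeta>] integrable_const]) (use b(4) \<zeta> space_eq in auto)
    then show "poisson_integral \<rho> \<mu> \<zeta> \<le> C" using prob_space by simp
  qed
qed

lemma measurable_poisson_integral [measurable]:
  "poisson_integral \<rho> \<mu> \<in> borel_measurable \<tau>"
  unfolding poisson_integral_def[abs_def]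
  by (rule borel_measurable_lebesgue_integral) (simp add: borel_measurable_torus_poisson sets_eq)

lemma integrable_ln_poisson_integral:
  assumes "0 \<le> \<rho>" "\<rho> < 1"
  shows "integrable \<tau> (\<lambda>\<zeta>. ln (poisson_integral \<rho> \<mu> \<zeta>))"
proof -
  obtain c C where b: "0 < c" "\<And>\<zeta>. \<zeta> \<in> torus \<Longrightarrow> c \<le> poisson_integral \<rho> \<mu> \<zeta>"
    "\<And>\<zeta>. \<zeta> \<in> torus \<Longrightarrow> poisson_integral \<rho> \<mu> \<zeta> \<le> C"
    by (rule poisson_integral_bounds[OF assms]) blast
  show "integrable \<tau> (\<lambda>\<zeta>. ln (poisson_integral \<rho> \<mu> \<zeta>))"
  proof (rule T.integrable_const_bound[of _ "\<bar>ln c\<bar> + \<bar>ln C\<bar>"])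
    show "AE \<zeta> in \<tau>. norm (ln (poisson_integral \<rho> \<mu> \<zeta>)) \<le> \<bar>ln c\<bar> + \<bar>ln C\<bar>"
    proof (rule AE_I2)
      fix \<zeta> :: "complex ^ 'd" assume "\<zeta> \<in> space \<tau>"
      then have "c \<le> poisson_integral \<rho> \<mu> \<zeta>" "poisson_integral \<rho> \<mu> \<zeta> \<le> C" using b by auto
      then have "ln c \<le> ln (poisson_integral \<rho> \<mu> \<zeta>)" "ln (poisson_integral \<rho> \<mu> \<zeta>) \<le> ln C"
        using b(1) by (subst ln_le_cancel_iff; linarith)+
      then show "norm (ln (poisson_integral \<rho> \<mu> \<zeta>)) \<le> \<bar>ln c\<bar> + \<bar>ln C\<bar>" by simp
    qed
  qed measurable
qed

text \<open>
  Smoothing by a doubly stochastic kernel raises the integral of a concave function. Instead of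
  Jensen's inequality the tangent bound \<open>ln (w \<eta>) \<le> ln (W \<zeta>) + w \<eta> / W \<zeta> - 1\<close> is integrated against the
  kernel in both variables, where \<open>W\<close> is the Poisson integral; the hypothesis \<open>\<integral> P w \<le> W\<close> leaves
  room for a singular part of \<open>\<mu>\<close>.
\<close>

lemma log_integral_le_log_poisson_integral:
  assumes \<rho>: "0 < \<rho>" "\<rho> < 1"
    and w: "integrable \<tau> w" "AE \<eta> in \<tau>. 0 < w \<eta>"
    and lnw: "integrable \<tau> (\<lambda>\<eta>. ln (w \<eta>))"
    and dom: "\<And>\<zeta>. \<zeta> \<in> torus \<Longrightarrow>
      (\<integral>\<eta>. torus_poisson \<rho> \<zeta> \<eta> * w \<eta> \<partial>\<tau>) \<le> poisson_integral \<rho> \<mu> \<zeta>"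
  shows "(\<integral>\<zeta>. ln (w \<zeta>) \<partial>\<tau>) \<le> (\<integral>\<zeta>. ln (poisson_integral \<rho> \<mu> \<zeta>) \<partial>\<tau>)"
proof -
  have r: "0 \<le> \<rho>" using \<rho> by simp
  interpret TT: pair_prob_space "\<tau> :: (complex ^ 'd) measure" "\<tau> :: (complex ^ 'd) measure" ..
  let ?P = "torus_poisson \<rho> :: complex ^ 'd \<Rightarrow> _" and ?W = "poisson_integral \<rho> \<mu>"
  obtain c C where b: "0 < c" "c \<le> C"
    "\<And>\<zeta> \<eta> :: complex ^ 'd. \<zeta> \<in> torus \<Longrightarrow> \<eta> \<in> torus \<Longrightarrow> c \<le> torus_poisson \<rho> \<zeta> \<eta>"
    "\<And>\<zeta> \<eta> :: complex ^ 'd. \<zeta> \<in> torus \<Longrightarrow> \<eta> \<in> torus \<Longrightarrow> torus_poisson \<rho> \<zeta> \<eta> \<le> C"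
    by (rule torus_poisson_bounds[OF r \<rho>(2), where 'd = 'd]) blast
  obtain c' C' where b': "0 < c'" "\<And>\<zeta>. \<zeta> \<in> torus \<Longrightarrow> c' \<le> ?W \<zeta>" "\<And>\<zeta>. \<zeta> \<in> torus \<Longrightarrow> ?W \<zeta> \<le> C'"
    by (rule poisson_integral_bounds[OF r \<rho>(2)]) blast
  have Pabs: "\<bar>?P \<zeta> \<eta>\<bar> \<le> C" if "\<zeta> \<in> torus" "\<eta> \<in> torus" for \<zeta> \<eta>
    using b(3,4)[OF that] b(1) by simp
  have Pm: "?P \<zeta> \<in> borel_measurable \<tau>" if "\<zeta> \<in> torus" for \<zeta>
    using integrable_torus_lebesgue_continuous[OF continuous_torus_poisson[OF r \<rho>(2) that]] by simp
  have intP: "integrable \<tau> (\<lambda>\<eta>. ?P \<zeta> \<eta> * u \<eta>)"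
    if "integrable \<tau> u" "\<zeta> \<in> torus" for \<zeta> and u :: "complex ^ 'd \<Rightarrow> real"
  proof (rule Bochner_Integration.integrable_bound[of _ "\<lambda>\<eta>. C * u \<eta>"])
    show "AE \<eta> in \<tau>. norm (?P \<zeta> \<eta> * u \<eta>) \<le> norm (C * u \<eta>)"
      using b(1,2) by (intro AE_I2) (auto simp: abs_mult intro!: mult_right_mono Pabs that)
  qed (use that Pm in auto)
  let ?l = "\<lambda>\<zeta> \<eta>. ?P \<zeta> \<eta> * ln (w \<eta>)"
  have int2: "integrable (\<tau> \<Otimes>\<^sub>M \<tau>) (\<lambda>(\<zeta>, \<eta>). ?l \<zeta> \<eta>)"
  proof (rule Bochner_Integration.integrable_bound)
    show "integrable (\<tau> \<Otimes>\<^sub>M \<tau>) (\<lambda>(\<zeta>::complex ^ 'd, \<eta>). C * ln (w \<eta>))"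
    proof (rule TT.Fubini_integrable)
      show "(\<lambda>(\<zeta>::complex ^ 'd, \<eta>). C * ln (w \<eta>)) \<in> borel_measurable (\<tau> \<Otimes>\<^sub>M \<tau>)"
        using borel_measurable_integrable[OF lnw] by (auto intro!: borel_measurable_times measurable_compose[OF measurable_snd] simp: case_prod_unfold)
    qed (use lnw in auto)
    show "(\<lambda>(\<zeta>, \<eta>). ?l \<zeta> \<eta>) \<in> borel_measurable (\<tau> \<Otimes>\<^sub>M \<tau>)"
      using borel_measurable_integrable[OF lnw]
        borel_measurable_torus_poisson[of "\<tau> :: (complex ^ 'd) measure" "\<tau> :: (complex ^ 'd) measure" \<rho>]
      by (auto intro!: borel_measurable_times measurable_compose[OF measurable_snd] simp: case_prod_unfold)
    show "AE x in \<tau> \<Otimes>\<^sub>M \<tau>.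
        norm (case x of (\<zeta>, \<eta>) \<Rightarrow> ?l \<zeta> \<eta>) \<le> norm (case x of (\<zeta>::complex ^ 'd, \<eta>) \<Rightarrow> C * ln (w \<eta>))"
      using b(1,2) by (intro AE_I2) (auto simp: space_pair_measure abs_mult intro!: mult_right_mono Pabs)
  qed
  have "(\<integral>\<zeta>. ln (w \<zeta>) \<partial>\<tau>) = (\<integral>\<eta>. (\<integral>\<zeta>. ?l \<zeta> \<eta> \<partial>\<tau>) \<partial>\<tau>)"
  proof (rule Bochner_Integration.integral_cong[OF refl])
    fix \<eta> :: "complex ^ 'd" assume "\<eta> \<in> space \<tau>"
    then have "(\<integral>\<zeta>. ?P \<eta> \<zeta> \<partial>\<tau>) = 1" by (intro torus_poisson_integrals \<rho>) simp
    then show "ln (w \<eta>) = (\<integral>\<zeta>. ?l \<zeta> \<eta> \<partial>\<tau>)"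
      by (simp add: torus_poisson_commute[of \<rho> _ \<eta>])
  qed
  also have "\<dots> = (\<integral>\<zeta>. (\<integral>\<eta>. ?l \<zeta> \<eta> \<partial>\<tau>) \<partial>\<tau>)"
    by (rule TT.Fubini_integral[OF int2])
  also have "\<dots> \<le> (\<integral>\<zeta>. ln (?W \<zeta>) \<partial>\<tau>)"
  proof (rule integral_mono[OF _ integrable_ln_poisson_integral[OF r \<rho>(2)]])
    show "integrable \<tau> (\<lambda>\<zeta>. \<integral>\<eta>. ?l \<zeta> \<eta> \<partial>\<tau>)"
      by (rule TT.integrable_fst[OF int2])
    fix \<zeta> :: "complex ^ 'd" assume "\<zeta> \<in> space \<tau>"
    then have \<zeta>: "\<zeta> \<in> torus" by simp
    have Wpos: "0 < ?W \<zeta>" using b'(1) b'(2)[OF \<zeta>] by linarith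
    have one: "(\<integral>\<eta>. ?P \<zeta> \<eta> \<partial>\<tau>) = 1" by (rule torus_poisson_integrals(1)[OF \<rho> \<zeta>])
    have i1: "integrable \<tau> (\<lambda>\<eta>. ?P \<zeta> \<eta> * (ln (?W \<zeta>) - 1))"
      using intP[OF T.integrable_const \<zeta>] .
    have i2: "integrable \<tau> (\<lambda>\<eta>. ?P \<zeta> \<eta> * w \<eta> / ?W \<zeta>)"
      using intP[OF w(1) \<zeta>] by simp
    have "(\<integral>\<eta>. ?l \<zeta> \<eta> \<partial>\<tau>) \<le>
        (\<integral>\<eta>. ?P \<zeta> \<eta> * (ln (?W \<zeta>) - 1) + ?P \<zeta> \<eta> * w \<eta> / ?W \<zeta> \<partial>\<tau>)"
    proof (rule integral_mono_AE[OF intP[OF lnw \<zeta>] Bochner_Integration.integrable_add[OF i1 i2]])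
      show "AE \<eta> in \<tau>. ?l \<zeta> \<eta> \<le> ?P \<zeta> \<eta> * (ln (?W \<zeta>) - 1) + ?P \<zeta> \<eta> * w \<eta> / ?W \<zeta>"
        using w(2) AE_space
      proof eventually_elim
        fix \<eta> :: "complex ^ 'd" assume \<eta>: "0 < w \<eta>" "\<eta> \<in> space \<tau>"
        have "ln (w \<eta> / ?W \<zeta>) \<le> w \<eta> / ?W \<zeta> - 1"
          using \<eta>(1) Wpos by (intro ln_le_minus_one divide_pos_pos)
        then have "ln (w \<eta>) \<le> ln (?W \<zeta>) - 1 + w \<eta> / ?W \<zeta>"
          using \<eta>(1) Wpos by (simp add: ln_div)
        then have "?P \<zeta> \<eta> * ln (w \<eta>) \<le> ?P \<zeta> \<eta> * (ln (?W \<zeta>) - 1 + w \<eta> / ?W \<zeta>)"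
          using torus_poisson_pos[OF r \<rho>(2) \<zeta>, of \<eta>] \<eta>(2) by (intro mult_left_mono) auto
        then show "?l \<zeta> \<eta> \<le> ?P \<zeta> \<eta> * (ln (?W \<zeta>) - 1) + ?P \<zeta> \<eta> * w \<eta> / ?W \<zeta>"
          by (simp add: distrib_left)
      qed
    qed
    also have "\<dots> = (ln (?W \<zeta>) - 1) + (\<integral>\<eta>. ?P \<zeta> \<eta> * w \<eta> \<partial>\<tau>) / ?W \<zeta>"
      by (subst Bochner_Integration.integral_add[OF i1 i2]) (simp add: one)
    also have "\<dots> \<le> ln (?W \<zeta>)" using dom[OF \<zeta>] Wpos by (simp add: divide_le_eq)
    finally show "(\<integral>\<eta>. ?l \<zeta> \<eta> \<partial>\<tau>) \<le> ln (?W \<zeta>)" .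
  qed
  finally show ?thesis .
qed

text \<open>
  By the symmetry of the kernel, integrating \<open>v\<close> against the Poisson integral of \<open>\<mu>\<close> is integrating the
  Poisson integral of \<open>v\<close> against \<open>\<mu>\<close>.
\<close>

lemma poisson_integral_weak_convergence:
  fixes v :: "complex ^ 'd \<Rightarrow> real"
  assumes v: "continuous_on torus v" and \<epsilon>: "0 < \<epsilon>"
  obtains \<rho> where "0 < \<rho>" "\<rho> < 1"
    "(\<integral>\<zeta>. v \<zeta> * poisson_integral \<rho> \<mu> \<zeta> \<partial>\<tau>) \<le> (\<integral>\<zeta>. v \<zeta> \<partial>\<mu>) + \<epsilon>"
    "integrable \<tau> (\<lambda>\<zeta>. v \<zeta> * poisson_integral \<rho> \<mu> \<zeta>)"
proof -
  obtain \<rho> where \<rho>: "0 < \<rho>" "\<rho> < 1"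
    "\<And>\<zeta>. \<zeta> \<in> torus \<Longrightarrow> \<bar>(\<integral>\<eta>. torus_poisson \<rho> \<zeta> \<eta> * v \<eta> \<partial>\<tau>) - v \<zeta>\<bar> \<le> \<epsilon>"
    by (rule poisson_approximate_identity[OF v \<epsilon>]) blast
  have r: "0 \<le> \<rho>" using \<rho> by simp
  obtain c C where b: "0 < c" "c \<le> C"
    "\<And>\<zeta> \<eta> :: complex ^ 'd. \<zeta> \<in> torus \<Longrightarrow> \<eta> \<in> torus \<Longrightarrow> c \<le> torus_poisson \<rho> \<zeta> \<eta>"
    "\<And>\<zeta> \<eta> :: complex ^ 'd. \<zeta> \<in> torus \<Longrightarrow> \<eta> \<in> torus \<Longrightarrow> torus_poisson \<rho> \<zeta> \<eta> \<le> C"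
    by (rule torus_poisson_bounds[OF r \<rho>(2), where 'd = 'd]) blast
  have "bounded (v ` torus)"
    by (rule compact_imp_bounded[OF compact_continuous_image[OF v compact_torus]])
  then obtain M where M: "\<And>\<zeta>. \<zeta> \<in> torus \<Longrightarrow> \<bar>v \<zeta>\<bar> \<le> M" by (auto simp: bounded_iff)
  have M0: "0 \<le> M" using M[OF cis_vec_in_torus] abs_ge_zero order_trans by blast
  let ?k = "\<lambda>\<zeta> \<eta>. v \<zeta> * torus_poisson \<rho> \<zeta> \<eta>"
  have vm: "v \<in> borel_measurable \<tau>"
    using integrable_torus_lebesgue_continuous[OF v] by simp
  have int: "integrable (\<tau> \<Otimes>\<^sub>M \<mu>) (\<lambda>(\<zeta>, \<eta>). ?k \<zeta> \<eta>)"
  proof (rule P.P.integrable_const_bound[of _ "M * C"])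
    show "AE x in \<tau> \<Otimes>\<^sub>M \<mu>. norm (case x of (\<zeta>, \<eta>) \<Rightarrow> ?k \<zeta> \<eta>) \<le> M * C"
    proof (rule AE_I2)
      fix x assume "x \<in> space ((\<tau> :: (complex ^ 'd) measure) \<Otimes>\<^sub>M \<mu>)"
      then obtain \<zeta> \<eta> where x: "x = (\<zeta>, \<eta>)" "\<zeta> \<in> torus" "\<eta> \<in> torus"
        by (auto simp: space_pair_measure space_eq)
      have "\<bar>torus_poisson \<rho> \<zeta> \<eta>\<bar> \<le> C" using b(3,4)[OF x(2,3)] b(1) by simp
      then have "\<bar>v \<zeta>\<bar> * \<bar>torus_poisson \<rho> \<zeta> \<eta>\<bar> \<le> M * C" by (intro mult_mono M x M0) auto
      then show "norm (case x of (\<zeta>, \<eta>) \<Rightarrow> ?k \<zeta> \<eta>) \<le> M * C" by (simp add: x abs_mult)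
    qed
    show "(\<lambda>(\<zeta>, \<eta>). ?k \<zeta> \<eta>) \<in> borel_measurable (\<tau> \<Otimes>\<^sub>M \<mu>)"
      using borel_measurable_torus_poisson[of \<tau> \<mu> \<rho>] vm sets_eq
      by (auto intro!: borel_measurable_times measurable_compose[OF measurable_fst] simp: case_prod_unfold)
  qed
  have W: "(\<lambda>\<zeta>. v \<zeta> * poisson_integral \<rho> \<mu> \<zeta>) = (\<lambda>\<zeta>. \<integral>\<eta>. ?k \<zeta> \<eta> \<partial>\<mu>)"
    by (simp add: poisson_integral_def)
  have "(\<integral>\<zeta>. v \<zeta> * poisson_integral \<rho> \<mu> \<zeta> \<partial>\<tau>) = (\<integral>\<eta>. (\<integral>\<zeta>. ?k \<zeta> \<eta> \<partial>\<tau>) \<partial>\<mu>)"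
    unfolding W by (rule P.Fubini_integral[OF int, symmetric])
  also have "\<dots> \<le> (\<integral>\<eta>. v \<eta> + \<epsilon> \<partial>\<mu>)"
  proof (rule integral_mono[OF P.integrable_snd[OF int]])
    show "integrable \<mu> (\<lambda>\<eta>. v \<eta> + \<epsilon>)"
      by (intro integrable_continuous continuous_intros v)
    fix \<eta> :: "complex ^ 'd" assume "\<eta> \<in> space \<mu>"
    then show "(\<integral>\<zeta>. ?k \<zeta> \<eta> \<partial>\<tau>) \<le> v \<eta> + \<epsilon>"
      using \<rho>(3)[of \<eta>] space_eq by (simp add: torus_poisson_commute[of \<rho> _ \<eta>] mult.commute abs_le_iff)
  qed
  also have "\<dots> = (\<integral>\<eta>. v \<eta> \<partial>\<mu>) + \<epsilon>"
    using integrable_continuous[OF v] prob_space by simp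
  finally have le: "(\<integral>\<zeta>. v \<zeta> * poisson_integral \<rho> \<mu> \<zeta> \<partial>\<tau>) \<le> (\<integral>\<zeta>. v \<zeta> \<partial>\<mu>) + \<epsilon>" .
  show thesis
    by (rule that[OF \<rho>(1,2) le]) (unfold W, rule P.integrable_fst[OF int])
qed

text \<open>
  The right-hand side is the variational form of the entropy: its infimum over \<open>v\<close> is \<open>\<integral> ln w\<close>. For a
  fixed continuous \<open>v\<close> it is continuous in \<open>\<mu>\<close> for weak convergence, and this is why the entropy is upper
  semicontinuous.
\<close>

lemma entropy_bound_continuous:
  fixes v :: "complex ^ 'd \<Rightarrow> real"
  assumes L: "\<And>\<rho>. 0 < \<rho> \<Longrightarrow> \<rho> < 1 \<Longrightarrow> L \<le> (\<integral>\<zeta>. ln (poisson_integral \<rho> \<mu> \<zeta>) \<partial>\<tau>)"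
    and v: "continuous_on torus v" "\<And>\<zeta>. \<zeta> \<in> torus \<Longrightarrow> 0 < v \<zeta>"
  shows "L \<le> (\<integral>\<zeta>. - ln (v \<zeta>) \<partial>\<tau>) + (\<integral>\<zeta>. v \<zeta> \<partial>\<mu>) - 1"
proof (rule field_le_epsilon)
  fix \<epsilon> :: real assume "0 < \<epsilon>"
  from poisson_integral_weak_convergence[OF v(1) this] obtain \<rho> where \<rho>: "0 < \<rho>" "\<rho> < 1"
    "(\<integral>\<zeta>. v \<zeta> * poisson_integral \<rho> \<mu> \<zeta> \<partial>\<tau>) \<le> (\<integral>\<zeta>. v \<zeta> \<partial>\<mu>) + \<epsilon>"
    "integrable \<tau> (\<lambda>\<zeta>. v \<zeta> * poisson_integral \<rho> \<mu> \<zeta>)" by blast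
  have r: "0 \<le> \<rho>" using \<rho> by simp
  let ?W = "poisson_integral \<rho> \<mu>"
  obtain c' C' where b': "0 < c'" "\<And>\<zeta>. \<zeta> \<in> torus \<Longrightarrow> c' \<le> ?W \<zeta>" "\<And>\<zeta>. \<zeta> \<in> torus \<Longrightarrow> ?W \<zeta> \<le> C'"
    by (rule poisson_integral_bounds[OF r \<rho>(2)]) blast
  have i: "integrable \<tau> (\<lambda>\<zeta>. - ln (v \<zeta>))"
    by (intro integrable_torus_lebesgue_continuous continuous_intros v(1)) (use v(2) in force)
  have "L \<le> (\<integral>\<zeta>. ln (?W \<zeta>) \<partial>\<tau>)" by (rule L[OF \<rho>(1,2)])
  also have "\<dots> \<le> (\<integral>\<zeta>. - ln (v \<zeta>) + (v \<zeta> * ?W \<zeta> - 1) \<partial>\<tau>)"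
  proof (rule integral_mono[OF integrable_ln_poisson_integral[OF r \<rho>(2)]])
    show "integrable \<tau> (\<lambda>\<zeta>. - ln (v \<zeta>) + (v \<zeta> * ?W \<zeta> - 1))"
      by (intro Bochner_Integration.integrable_add Bochner_Integration.integrable_diff i \<rho>(4) T.integrable_const)
    fix \<zeta> :: "complex ^ 'd" assume "\<zeta> \<in> space \<tau>"
    then have "\<zeta> \<in> torus" by simp
    then have "0 < v \<zeta>" "0 < ?W \<zeta>" using v(2) b'(1) b'(2)[of \<zeta>] by auto
    then show "ln (?W \<zeta>) \<le> - ln (v \<zeta>) + (v \<zeta> * ?W \<zeta> - 1)"
      using ln_le_minus_one[of "v \<zeta> * ?W \<zeta>"] by (simp add: ln_mult)
  qed
  also have "\<dots> = (\<integral>\<zeta>. - ln (v \<zeta>) \<partial>\<tau>) + ((\<integral>\<zeta>. v \<zeta> * ?W \<zeta> \<partial>\<tau>) - 1)"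
    by (subst Bochner_Integration.integral_add[OF i])
      (use \<rho>(4) T.prob_space in \<open>simp_all add: Bochner_Integration.integral_diff\<close>)
  finally show "L \<le> (\<integral>\<zeta>. - ln (v \<zeta>) \<partial>\<tau>) + (\<integral>\<zeta>. v \<zeta> \<partial>\<mu>) - 1 + \<epsilon>"
    using \<rho>(3) by linarith
qed

end

section \<open>The entropy bound for Borel functions\<close>

lemma sets_torus_borel_subset: "B \<in> sets torus_borel \<Longrightarrow> B \<in> sets borel \<and> B \<subseteq> torus"
  using borel_closed[OF closed_torus] by (auto simp: sets_restrict_space)

text \<open>
  Inner and outer regularity, for the image of the measure on the whole space.
\<close>

lemma regular_enclosure:
  fixes M :: "(complex ^ 'd) measure"
  assumes M: "finite_measure M" "sets M = sets torus_borel" and B: "B \<in> sets torus_borel" and "0 < \<epsilon>"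
  obtains K U where "compact K" "open U" "K \<subseteq> B" "B \<subseteq> U" "measure M ((U - K) \<inter> torus) \<le> \<epsilon>"
proof -
  interpret finite_measure M by fact
  have sp: "space M = torus" using sets_eq_imp_space_eq[OF M(2)] by simp
  have id: "(\<lambda>x. x) \<in> borel_measurable M"
    using measurable_ident_sets[OF M(2)] by (simp add: measurable_restrict_space2_iff)
  define N where "N = distr M borel (\<lambda>x. x)"
  interpret N: finite_measure N unfolding N_def by (rule finite_measure_distr[OF id])
  have N: "sets N = sets borel" "emeasure N (space N) \<noteq> \<infinity>"
    using N.emeasure_finite by (simp_all add: N_def)
  have eN: "measure N A = measure M (A \<inter> torus)" if "A \<in> sets borel" for A
    using that id by (simp add: N_def measure_distr sp)
  have B': "B \<in> sets borel" using sets_torus_borel_subset[OF B] by simp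
  have "\<exists>K. K \<subseteq> B \<and> compact K \<and> measure N B \<le> measure N K + \<epsilon> / 2"
  proof (rule ccontr)
    assume neg: "\<not> ?thesis"
    then have "measure N K \<le> measure N B - \<epsilon> / 2" if "K \<subseteq> B" "compact K" for K
      using that by force
    then have "emeasure N K \<le> ennreal (measure N B - \<epsilon> / 2)" if "K \<subseteq> B" "compact K" for K
      using that by (simp add: N.emeasure_eq_measure ennreal_leI)
    then have "emeasure N B \<le> ennreal (measure N B - \<epsilon> / 2)"
      unfolding inner_regular[OF N B'] by (intro SUP_least) auto
    moreover have "\<epsilon> / 2 < measure N B"
      using neg[unfolded not_ex, THEN spec, of "{}"] by simp
    ultimately have "measure N B \<le> measure N B - \<epsilon> / 2"
      by (simp only: N.emeasure_eq_measure) (subst (asm) ennreal_le_iff, simp_all)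
    then show False using \<open>0 < \<epsilon>\<close> by simp
  qed
  then obtain K where K: "K \<subseteq> B" "compact K" "measure N B \<le> measure N K + \<epsilon> / 2" by blast
  have "\<exists>U. B \<subseteq> U \<and> open U \<and> measure N U \<le> measure N B + \<epsilon> / 2"
  proof (rule ccontr)
    assume "\<not> ?thesis"
    then have "measure N B + \<epsilon> / 2 \<le> measure N U" if "B \<subseteq> U" "open U" for U
      using that by force
    then have "ennreal (measure N B + \<epsilon> / 2) \<le> emeasure N U" if "B \<subseteq> U" "open U" for U
      using that by (simp add: N.emeasure_eq_measure ennreal_leI)
    then have "ennreal (measure N B + \<epsilon> / 2) \<le> emeasure N B"
      unfolding outer_regular[OF N B'] by (intro INF_greatest) auto
    then have "measure N B + \<epsilon> / 2 \<le> measure N B"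
      by (simp add: N.emeasure_eq_measure ennreal_le_iff)
    then show False using \<open>0 < \<epsilon>\<close> by simp
  qed
  then obtain U where U: "B \<subseteq> U" "open U" "measure N U \<le> measure N B + \<epsilon> / 2" by blast
  have bor: "K \<in> sets borel" "U \<in> sets borel" using borel_closed[OF compact_imp_closed[OF K(2)]] borel_open[OF U(2)] by auto
  have "measure N (U - K) = measure N U - measure N K"
    using K U bor N(1) by (intro N.finite_measure_Diff) auto
  then have "measure M ((U - K) \<inter> torus) \<le> \<epsilon>"
    using eN[of "U - K"] bor K(3) U(3) by simp
  then show thesis using K U by (intro that) auto
qed

text \<open>
  One function serves two measures at once: the union of the compact sets and the intersection of the
  open sets are separated by a Urysohn function.
\<close>

lemma continuous_approx_indicator:
  fixes M N :: "(complex ^ 'd) measure"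
  assumes M: "finite_measure M" "sets M = sets torus_borel" and N: "finite_measure N" "sets N = sets torus_borel"
    and B: "B \<in> sets torus_borel" and "0 < \<epsilon>"
  shows "\<exists>g. continuous_on torus g \<and>
    (\<integral>x. \<bar>indicator B x - g x\<bar> \<partial>M) \<le> \<epsilon> \<and> (\<integral>x. \<bar>indicator B x - g x\<bar> \<partial>N) \<le> (\<epsilon>::real)"
proof -
  obtain K1 U1 where 1: "compact K1" "open U1" "K1 \<subseteq> B" "B \<subseteq> U1" "measure M ((U1 - K1) \<inter> torus) \<le> \<epsilon>"
    by (rule regular_enclosure[OF M B \<open>0 < \<epsilon>\<close>])
  obtain K2 U2 where 2: "compact K2" "open U2" "K2 \<subseteq> B" "B \<subseteq> U2" "measure N ((U2 - K2) \<inter> torus) \<le> \<epsilon>"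
    by (rule regular_enclosure[OF N B \<open>0 < \<epsilon>\<close>])
  let ?K = "K1 \<union> K2" and ?U = "U1 \<inter> U2"
  obtain g :: "complex ^ 'd \<Rightarrow> real" where g: "continuous_on UNIV g" "\<And>x. g x \<in> closed_segment 1 0"
    "\<And>x. x \<in> ?K \<Longrightarrow> g x = 1" "\<And>x. x \<in> - ?U \<Longrightarrow> g x = 0"
    by (rule Urysohn[of ?K "- ?U" 1 0]) (use 1 2 in \<open>auto intro: compact_imp_closed\<close>)
  have g01: "0 \<le> g x" "g x \<le> 1" for x using g(2)[of x] by (auto simp: closed_segment_eq_real_ivl)
  have "(\<integral>x. \<bar>indicator B x - g x\<bar> \<partial>M) \<le> \<epsilon>"
    if M: "finite_measure M" "sets M = sets torus_borel" and K: "compact K" "open U" "K \<subseteq> ?K" "?U \<subseteq> U"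
      "measure M ((U - K) \<inter> torus) \<le> \<epsilon>" for M :: "(complex ^ 'd) measure" and K U
  proof -
    interpret finite_measure M by fact
    have sp: "space M = torus" using sets_eq_imp_space_eq[OF M(2)] by simp
    have s: "(U - K) \<inter> torus \<in> sets M"
      unfolding M(2) sets_restrict_space
      by (subst Int_commute, intro imageI sets.Diff borel_open borel_closed compact_imp_closed K)
    have gm: "g \<in> borel_measurable M"
      using borel_measurable_continuous_on_restrict[OF continuous_on_subset[OF g(1), of torus]] M(2)
      by (simp cong: measurable_cong_sets)
    have "(\<integral>x. \<bar>indicator B x - g x\<bar> \<partial>M) \<le> (\<integral>x. indicator ((U - K) \<inter> torus) x \<partial>M)"
    proof (rule integral_mono)
      show "integrable M (\<lambda>x. \<bar>indicator B x - g x\<bar>)"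
      proof (rule integrable_const_bound[of _ 1])
        have "norm \<bar>indicator B x - g x\<bar> \<le> 1" for x
          using g01[of x] by (cases "x \<in> B") (simp_all add: abs_le_iff)
        then show "AE x in M. norm \<bar>indicator B x - g x\<bar> \<le> 1" by (intro AE_I2)
        show "(\<lambda>x. \<bar>indicator B x - g x\<bar>) \<in> borel_measurable M"
          using gm B M(2) by (intro borel_measurable_abs borel_measurable_diff borel_measurable_indicator) simp_all
      qed
      show "integrable M (indicator ((U - K) \<inter> torus) :: _ \<Rightarrow> real)"
        using s by (intro integrable_real_indicator) (simp_all add: emeasure_eq_measure)
      fix x assume "x \<in> space M"
      then have x: "x \<in> torus" by (simp add: sp)
      show "\<bar>indicator B x - g x\<bar> \<le> indicator ((U - K) \<inter> torus) x"
      proof (cases "x \<in> ?K \<or> x \<notin> ?U")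
        case True
        then have "indicator B x = g x"
          using g(3)[of x] g(4)[of x] 1(3,4) 2(3,4) by (auto simp: indicator_def)
        then show ?thesis by simp
      next
        case False
        then have "x \<in> (U - K) \<inter> torus" using K x by auto
        then show ?thesis using g01[of x] by (simp add: indicator_def abs_le_iff)
      qed
    qed
    also have "\<dots> = measure M ((U - K) \<inter> torus)" using s by simp
    finally show ?thesis using K(5) by simp
  qed
  from this[OF M 1(1,2) _ _ 1(5)] this[OF N 2(1,2) _ _ 2(5)] show ?thesis
    using continuous_on_subset[OF g(1)] by blast
qed

text \<open>
  The sum counts the levels \<open>k * b / n\<close> below \<open>v\<close>, so it is \<open>v\<close> rounded down to a multiple of \<open>b / n\<close>.
\<close>

lemma layer_cake_step:
  fixes v b :: real
  assumes "0 \<le> v" "v \<le> b" "0 < b" "0 < n"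
  shows "\<bar>v - (\<Sum>k\<in>{1..n}. b / real n * (if real k * b / real n \<le> v then 1 else 0))\<bar> \<le> b / real n"
proof -
  define x where "x = v * real n / b"
  have x: "0 \<le> x" "x \<le> real n" using assms by (auto simp: x_def field_simps)
  have eq: "real k * b / real n \<le> v \<longleftrightarrow> real k \<le> x" for k
    using assms by (simp add: x_def field_simps)
  have set: "{k \<in> {1..n}. real k \<le> x} = {1..nat \<lfloor>x\<rfloor>}"
    using x by (auto simp: le_nat_floor le_nat_iff le_floor_iff)
  have "(\<Sum>k\<in>{1..n}. b / real n * (if real k * b / real n \<le> v then 1 else 0)) =
      b / real n * real (card {k \<in> {1..n}. real k \<le> x})"
    unfolding eq sum_distrib_left[symmetric] sum.inter_filter[OF finite_atLeastAtMost, symmetric] by simp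
  also have "\<dots> = b / real n * of_int \<lfloor>x\<rfloor>" unfolding set using x by simp
  finally have s: "(\<Sum>k\<in>{1..n}. b / real n * (if real k * b / real n \<le> v then 1 else 0)) = b / real n * of_int \<lfloor>x\<rfloor>" .
  have "v = b / real n * x" using assms by (simp add: x_def)
  then have "v - b / real n * of_int \<lfloor>x\<rfloor> = b / real n * (x - of_int \<lfloor>x\<rfloor>)"
    by (simp add: right_diff_distrib)
  moreover have "0 \<le> b / real n * (x - of_int \<lfloor>x\<rfloor>)"
    using assms by (intro mult_nonneg_nonneg divide_nonneg_nonneg) linarith+
  moreover have "b / real n * (x - of_int \<lfloor>x\<rfloor>) \<le> b / real n * 1"
    using assms by (intro mult_left_mono) (linarith, simp)
  ultimately show ?thesis
    unfolding s by linarith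
qed

text \<open>
  The function \<open>v\<close> is a uniform limit of finite combinations of indicators of its superlevel sets, and
  each indicator is approximated in mean. Clamping to \<open>[a, b]\<close> does not increase the distance to \<open>v\<close>.
\<close>

lemma continuous_approx_bounded:
  fixes M N :: "(complex ^ 'd) measure" and v :: "complex ^ 'd \<Rightarrow> real"
  assumes M: "prob_space M" "sets M = sets torus_borel" and N: "prob_space N" "sets N = sets torus_borel"
    and v: "v \<in> borel_measurable torus_borel" "\<And>x. x \<in> torus \<Longrightarrow> a \<le> v x \<and> v x \<le> b" and ab: "0 < a" "a \<le> b"
    and "0 < \<epsilon>"
  obtains g where "continuous_on torus g" "\<And>x. a \<le> g x \<and> g x \<le> b"
    "(\<integral>x. \<bar>v x - g x\<bar> \<partial>M) \<le> \<epsilon>" "(\<integral>x. \<bar>v x - g x\<bar> \<partial>N) \<le> \<epsilon>"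
proof -
  have b: "0 < b" using ab by simp
  obtain n where n: "0 < n" "b / real n \<le> \<epsilon> / 2"
  proof -
    obtain n where "2 * b / \<epsilon> < real n" using reals_Archimedean2 by blast
    moreover have "0 < 2 * b / \<epsilon>" using b \<open>0 < \<epsilon>\<close> by simp
    ultimately have "0 < real n" "2 * b < real n * \<epsilon>" using \<open>0 < \<epsilon>\<close> by (linarith, simp add: field_simps)
    then show thesis by (intro that[of n]) (auto simp: field_simps)
  qed
  define B where "B k = {x \<in> torus. real k * b / real n \<le> v x}" for k
  have B: "B k \<in> sets torus_borel" for k
  proof -
    have "{x \<in> space torus_borel. real k * b / real n \<le> v x} \<in> sets torus_borel"
      by (rule borel_measurable_le) (use v(1) in auto)
    then show ?thesis by (simp add: B_def)
  qed
  \<comment> \<open>The \<open>n\<close> indicators carry the weight \<open>b / n\<close>, which turns their errors into \<open>\<epsilon> / 2\<close> in total.\<close>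
  have e: "0 < \<epsilon> / (2 * b)" using b \<open>0 < \<epsilon>\<close> by simp
  have fin: "finite_measure M" "finite_measure N" using M N by (auto intro: prob_space.finite_measure)
  have "\<exists>G. \<forall>k. continuous_on torus (G k) \<and>
      (\<integral>x. \<bar>indicator (B k) x - G k x\<bar> \<partial>M) \<le> \<epsilon> / (2 * b) \<and> (\<integral>x. \<bar>indicator (B k) x - G k x\<bar> \<partial>N) \<le> \<epsilon> / (2 * b)"
    by (rule choice) (use continuous_approx_indicator[OF fin(1) M(2) fin(2) N(2) B e] in blast)
  then obtain G where G: "\<And>k. continuous_on torus (G k)"
      "\<And>k. (\<integral>x. \<bar>indicator (B k) x - G k x\<bar> \<partial>M) \<le> \<epsilon> / (2 * b)"
      "\<And>k. (\<integral>x. \<bar>indicator (B k) x - G k x\<bar> \<partial>N) \<le> \<epsilon> / (2 * b)" by blast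
  define g where "g x = max a (min b (\<Sum>k\<in>{1..n}. b / real n * G k x))" for x
  have gc: "continuous_on torus g"
    unfolding g_def by (intro continuous_intros G(1))
  have gab: "a \<le> g x \<and> g x \<le> b" for x using ab by (auto simp: g_def)
  have "(\<integral>x. \<bar>v x - g x\<bar> \<partial>M) \<le> \<epsilon>"
    if M: "prob_space M" "sets M = sets torus_borel" and GM: "\<And>k. (\<integral>x. \<bar>indicator (B k) x - G k x\<bar> \<partial>M) \<le> \<epsilon> / (2 * b)"
    for M :: "(complex ^ 'd) measure"
  proof -
    interpret prob_space M by fact
    have sp: "space M = torus" using sets_eq_imp_space_eq[OF M(2)] by simp
    have iB: "integrable M (\<lambda>x. \<bar>indicator (B k) x - G k x\<bar>)" for k
      using B[of k] M(2)
      by (intro integrable_abs Bochner_Integration.integrable_diff integrable_real_indicator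
          integrable_torus_continuous[OF G(1) finite_measure M(2)]) (auto simp: emeasure_eq_measure)
    have vi: "integrable M v"
    proof (rule integrable_const_bound[of _ b])
      show "AE x in M. norm (v x) \<le> b"
        using v(2) ab sp by (intro AE_I2) force
      show "v \<in> borel_measurable M" using v(1) M(2) by (simp cong: measurable_cong_sets)
    qed
    have "(\<integral>x. \<bar>v x - g x\<bar> \<partial>M) \<le> (\<integral>x. b / real n + (\<Sum>k\<in>{1..n}. b / real n * \<bar>indicator (B k) x - G k x\<bar>) \<partial>M)"
    proof (rule integral_mono)
      show "integrable M (\<lambda>x. \<bar>v x - g x\<bar>)"
        by (intro integrable_abs Bochner_Integration.integrable_diff vi integrable_torus_continuous[OF gc finite_measure M(2)])
      show "integrable M (\<lambda>x. b / real n + (\<Sum>k\<in>{1..n}. b / real n * \<bar>indicator (B k) x - G k x\<bar>))"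
        by (intro Bochner_Integration.integrable_add Bochner_Integration.integrable_sum integrable_mult_right iB integrable_const)
      fix x assume "x \<in> space M"
      then have x: "x \<in> torus" by (simp add: sp)
      then have vx: "a \<le> v x" "v x \<le> b" using v(2) by auto
      let ?s = "\<Sum>k\<in>{1..n}. b / real n * indicator (B k) x" and ?S = "\<Sum>k\<in>{1..n}. b / real n * G k x"
      have "?s = (\<Sum>k\<in>{1..n}. b / real n * (if real k * b / real n \<le> v x then 1 else 0))"
        using x by (intro sum.cong) (auto simp: B_def indicator_def)
      then have 1: "\<bar>v x - ?s\<bar> \<le> b / real n"
        using layer_cake_step[of "v x" b n] vx ab b n by simp
      have "\<bar>?s - ?S\<bar> = \<bar>\<Sum>k\<in>{1..n}. b / real n * (indicator (B k) x - G k x)\<bar>"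
        by (simp add: sum_subtractf right_diff_distrib)
      also have "\<dots> \<le> (\<Sum>k\<in>{1..n}. \<bar>b / real n * (indicator (B k) x - G k x)\<bar>)" by (rule sum_abs)
      also have "\<dots> = (\<Sum>k\<in>{1..n}. b / real n * \<bar>indicator (B k) x - G k x\<bar>)"
        using b by (simp add: abs_mult)
      finally have 2: "\<bar>?s - ?S\<bar> \<le> (\<Sum>k\<in>{1..n}. b / real n * \<bar>indicator (B k) x - G k x\<bar>)" .
      have "\<bar>v x - g x\<bar> \<le> \<bar>v x - ?S\<bar>" using vx unfolding g_def by (auto simp: max_def min_def)
      then show "\<bar>v x - g x\<bar> \<le> b / real n + (\<Sum>k\<in>{1..n}. b / real n * \<bar>indicator (B k) x - G k x\<bar>)"
        using 1 2 by linarith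
    qed
    also have "\<dots> = b / real n + (\<Sum>k\<in>{1..n}. b / real n * (\<integral>x. \<bar>indicator (B k) x - G k x\<bar> \<partial>M))"
    proof -
      have "(\<integral>x. (\<Sum>k\<in>{1..n}. b / real n * \<bar>indicator (B k) x - G k x\<bar>) \<partial>M) =
          (\<Sum>k\<in>{1..n}. b / real n * (\<integral>x. \<bar>indicator (B k) x - G k x\<bar> \<partial>M))"
        by (subst Bochner_Integration.integral_sum) (simp_all only: integrable_mult_right[OF iB] integral_mult_right_zero)
      then show ?thesis
        by (subst Bochner_Integration.integral_add)
          (auto intro!: Bochner_Integration.integrable_sum integrable_mult_right iB simp: prob_space simp del: integral_mult_right_zero)
    qed
    also have "\<dots> \<le> b / real n + (\<Sum>k\<in>{1..n}. b / real n * (\<epsilon> / (2 * b)))"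
      using b by (intro add_left_mono sum_mono mult_left_mono GM) auto
    also have "\<dots> = b / real n + \<epsilon> / 2" using b n by simp
    also have "\<dots> \<le> \<epsilon>" using n(2) by linarith
    finally show ?thesis .
  qed
  from this[OF M G(2)] this[OF N G(3)] show thesis by (rule that[OF gc gab])
qed

context torus_probability begin

text \<open>
  Density of continuous functions in \<open>L\<^sup>1\<close> of both measures carries the variational bound over to Borel
  functions, since \<open>ln\<close> is Lipschitz on \<open>[a, b]\<close>.
\<close>

lemma entropy_bound_borel:
  fixes v :: "complex ^ 'd \<Rightarrow> real"
  assumes L: "\<And>\<rho>. 0 < \<rho> \<Longrightarrow> \<rho> < 1 \<Longrightarrow> L \<le> (\<integral>\<zeta>. ln (poisson_integral \<rho> \<mu> \<zeta>) \<partial>\<tau>)"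
    and v: "v \<in> borel_measurable torus_borel" "\<And>x. x \<in> torus \<Longrightarrow> a \<le> v x \<and> v x \<le> b" and ab: "0 < a" "a \<le> b"
  shows "L \<le> (\<integral>\<zeta>. - ln (v \<zeta>) \<partial>\<tau>) + (\<integral>\<zeta>. v \<zeta> \<partial>\<mu>) - 1"
proof (rule field_le_epsilon)
  fix \<epsilon> :: real assume "0 < \<epsilon>"
  \<comment> \<open>An error \<open>\<delta>\<close> in mean costs \<open>\<delta> / a\<close> in the logarithmic integral and \<open>\<delta>\<close> in the other one.\<close>
  define \<delta> where "\<delta> = \<epsilon> / (1 / a + 1)"
  have a1: "0 < 1 / a + 1" using ab by (simp add: add_pos_pos)
  have "\<delta> * (1 / a + 1) = \<epsilon>" using a1 by (simp add: \<delta>_def)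
  then have \<delta>: "0 < \<delta>" "\<delta> / a + \<delta> = \<epsilon>"
    using \<open>0 < \<epsilon>\<close> a1 by (simp_all add: \<delta>_def distrib_left)
  obtain g where g: "continuous_on torus g" "\<And>x. a \<le> g x \<and> g x \<le> b"
    "(\<integral>x. \<bar>v x - g x\<bar> \<partial>\<tau>) \<le> \<delta>" "(\<integral>x. \<bar>v x - g x\<bar> \<partial>\<mu>) \<le> \<delta>"
    by (rule continuous_approx_bounded[OF prob_space_torus_lebesgue sets_torus_lebesgue prob_space_axioms sets_eq v ab \<delta>(1)]) blast+
  have gpos: "0 < g x" for x using g(2)[of x] ab by simp
  have vpos: "0 < v x" if "x \<in> torus" for x using v(2)[OF that] ab by simp
  have vm: "v \<in> borel_measurable \<tau>" "v \<in> borel_measurable \<mu>"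
    using v(1) sets_eq by (simp_all cong: measurable_cong_sets)
  have vb: "norm (v x) \<le> b" if "x \<in> torus" for x
    using v(2)[OF that] ab by simp
  have vi: "integrable \<tau> v" "integrable \<mu> v"
    using vb space_eq
    by (intro T.integrable_const_bound[of _ b] integrable_const_bound[of _ b] AE_I2 vm; simp)+
  have gi: "integrable \<tau> g" "integrable \<mu> g"
    by (intro integrable_torus_lebesgue_continuous integrable_continuous g)+
  have lg: "integrable \<tau> (\<lambda>x. - ln (g x))"
    by (intro integrable_torus_lebesgue_continuous continuous_intros g(1)) (simp add: less_imp_neq[OF gpos, symmetric])
  have lv: "integrable \<tau> (\<lambda>x. - ln (v x))"
  proof (rule T.integrable_const_bound[of _ "\<bar>ln a\<bar> + \<bar>ln b\<bar>"])
    show "AE x in \<tau>. norm (- ln (v x)) \<le> \<bar>ln a\<bar> + \<bar>ln b\<bar>"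
    proof (rule AE_I2)
      fix x :: "complex ^ 'd" assume "x \<in> space \<tau>"
      then have "a \<le> v x" "v x \<le> b" using v(2) by auto
      then have "ln a \<le> ln (v x)" "ln (v x) \<le> ln b"
        using ab by (subst ln_le_cancel_iff; linarith)+
      then show "norm (- ln (v x)) \<le> \<bar>ln a\<bar> + \<bar>ln b\<bar>" by simp
    qed
  qed (use vm in measurable)
  have "(\<integral>x. - ln (g x) \<partial>\<tau>) \<le> (\<integral>x. - ln (v x) + \<bar>v x - g x\<bar> / a \<partial>\<tau>)"
  proof (rule integral_mono[OF lg])
    show "integrable \<tau> (\<lambda>x. - ln (v x) + \<bar>v x - g x\<bar> / a)"
      by (intro Bochner_Integration.integrable_add lv integrable_divide_zero integrable_abs Bochner_Integration.integrable_diff vi gi)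
    fix x :: "complex ^ 'd" assume "x \<in> space \<tau>"
    then have x: "0 < v x" using vpos by simp
    have "ln (v x / g x) \<le> v x / g x - 1" using x gpos by (intro ln_le_minus_one divide_pos_pos)
    also have "\<dots> = (v x - g x) / g x" using gpos[of x] by (simp add: diff_divide_distrib)
    also have "\<dots> \<le> \<bar>v x - g x\<bar> / g x" using gpos[of x] by (intro divide_right_mono) auto
    also have "\<dots> \<le> \<bar>v x - g x\<bar> / a" using g(2)[of x] ab gpos[of x] by (intro divide_left_mono) auto
    finally show "- ln (g x) \<le> - ln (v x) + \<bar>v x - g x\<bar> / a" using x gpos[of x] by (simp add: ln_div)
  qed
  also have "\<dots> = (\<integral>x. - ln (v x) \<partial>\<tau>) + (\<integral>x. \<bar>v x - g x\<bar> \<partial>\<tau>) / a"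
    by (subst Bochner_Integration.integral_add[OF lv])
      (intro integrable_divide_zero integrable_abs Bochner_Integration.integrable_diff vi gi,
        simp only: integral_divide_zero)
  also have "\<dots> \<le> (\<integral>x. - ln (v x) \<partial>\<tau>) + \<delta> / a"
    using g(3) ab by (intro add_left_mono divide_right_mono) auto
  finally have 1: "(\<integral>x. - ln (g x) \<partial>\<tau>) \<le> (\<integral>x. - ln (v x) \<partial>\<tau>) + \<delta> / a" .
  have iabs: "integrable \<mu> (\<lambda>x. \<bar>v x - g x\<bar>)"
    by (intro integrable_abs Bochner_Integration.integrable_diff vi gi)
  have "(\<integral>x. g x \<partial>\<mu>) \<le> (\<integral>x. v x + \<bar>v x - g x\<bar> \<partial>\<mu>)"
    by (rule integral_mono[OF gi(2) Bochner_Integration.integrable_add[OF vi(2) iabs]]) linarith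
  also have "\<dots> = (\<integral>x. v x \<partial>\<mu>) + (\<integral>x. \<bar>v x - g x\<bar> \<partial>\<mu>)"
    by (rule Bochner_Integration.integral_add[OF vi(2) iabs])
  also have "\<dots> \<le> (\<integral>x. v x \<partial>\<mu>) + \<delta>" using g(4) by simp
  finally have 2: "(\<integral>x. g x \<partial>\<mu>) \<le> (\<integral>x. v x \<partial>\<mu>) + \<delta>" .
  have "L \<le> (\<integral>\<zeta>. - ln (g \<zeta>) \<partial>\<tau>) + (\<integral>\<zeta>. g \<zeta> \<partial>\<mu>) - 1"
    by (rule entropy_bound_continuous[OF L g(1) gpos])
  then show "L \<le> (\<integral>\<zeta>. - ln (v \<zeta>) \<partial>\<tau>) + (\<integral>\<zeta>. v \<zeta> \<partial>\<mu>) - 1 + \<epsilon>"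
    using 1 2 \<delta>(2) by linarith
qed

end

section \<open>The Lebesgue decomposition and the sum formula\<close>

text \<open>
  The positive part of \<open>log w\<close> is at most \<open>w\<close>, so the extended integral is \<open>- \<infinity>\<close> or an ordinary one.
\<close>

lemma ereal_integral_log_cases:
  fixes w :: "'a \<Rightarrow> real"
  assumes w: "w \<in> borel_measurable M" and wf: "(\<integral>\<^sup>+x. ennreal (w x) \<partial>M) < \<infinity>"
  shows "(\<integral>\<^sup>+x. e2ennreal (- log_ereal (w x)) \<partial>M) = \<infinity> \<and> ereal_integral M (\<lambda>x. log_ereal (w x)) = - \<infinity> \<or>
    (\<integral>\<^sup>+x. e2ennreal (- log_ereal (w x)) \<partial>M) \<noteq> \<infinity> \<and> (AE x in M. 0 < w x) \<and> integrable M (\<lambda>x. ln (w x)) \<and>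
      ereal_integral M (\<lambda>x. log_ereal (w x)) = ereal (\<integral>x. ln (w x) \<partial>M)"
proof -
  have pos: "e2ennreal (log_ereal t) = (if 0 < t then ennreal (ln t) else 0)" for t
    by (simp add: log_ereal_def e2ennreal_neg)
  have neg: "e2ennreal (- log_ereal t) = (if 0 < t then ennreal (- ln t) else \<infinity>)" for t
    by (simp add: log_ereal_def)
  let ?I = "\<integral>\<^sup>+x. e2ennreal (log_ereal (w x)) \<partial>M" and ?N = "\<integral>\<^sup>+x. e2ennreal (- log_ereal (w x)) \<partial>M"
  have "?I \<le> (\<integral>\<^sup>+x. ennreal (w x) \<partial>M)"
    by (intro nn_integral_mono) (auto simp: pos intro!: ennreal_leI order_trans[OF ln_le_minus_one])
  with wf have I: "?I < \<infinity>" by simp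
  have m: "(\<lambda>x. e2ennreal (- log_ereal (w x))) \<in> borel_measurable M"
    unfolding neg using w by measurable
  show ?thesis
  proof (cases "?N = \<infinity>")
    case True
    obtain i where "?I = ennreal i" "0 \<le> i" using I by (cases ?I) auto
    then have "ereal_integral M (\<lambda>x. log_ereal (w x)) = - \<infinity>"
      unfolding ereal_integral_def True by (simp add: enn2ereal_ennreal)
    with True show ?thesis by simp
  next
    case False
    have ae: "AE x in M. 0 < w x"
      using nn_integral_noteq_infinite[OF m False] by eventually_elim (simp add: neg split: if_splits)
    have Ieq: "?I = (\<integral>\<^sup>+x. ennreal (ln (w x)) \<partial>M)" and Neq: "?N = (\<integral>\<^sup>+x. ennreal (- ln (w x)) \<partial>M)"
      by (rule nn_integral_cong_AE, use ae in eventually_elim, simp add: pos neg)+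
    have lm: "(\<lambda>x. ln (w x)) \<in> borel_measurable M" using w by measurable
    have "(\<integral>\<^sup>+x. ennreal (norm (ln (w x))) \<partial>M) \<le> (\<integral>\<^sup>+x. ennreal (ln (w x)) + ennreal (- ln (w x)) \<partial>M)"
      by (intro nn_integral_mono) (simp add: abs_if ennreal_neg)
    also have "\<dots> = ?I + ?N"
      unfolding Ieq Neq by (rule nn_integral_add) (use lm in measurable)
    also have "\<dots> < \<infinity>" using I False by (simp add: less_top)
    finally have int: "integrable M (\<lambda>x. ln (w x))"
      using lm by (simp add: integrable_iff_bounded)
    have "ereal_integral M (\<lambda>x. log_ereal (w x)) = ereal (enn2real ?I) - ereal (enn2real ?N)"
    proof -
      obtain i n where "?I = ennreal i" "0 \<le> i" "?N = ennreal n" "0 \<le> n"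
        using I False by (cases ?I; cases ?N) auto
      then show ?thesis unfolding ereal_integral_def by (simp add: enn2ereal_ennreal)
    qed
    also have "\<dots> = ereal (\<integral>x. ln (w x) \<partial>M)"
      unfolding Ieq Neq real_lebesgue_integral_def[OF int] by simp
    finally show ?thesis using False ae int by simp
  qed
qed

text \<open>
  At the origin the Poisson kernel is \<open>1\<close>.
\<close>

lemma prob_space_poisson_measure:
  assumes "poisson_measure f \<mu>" "f 0 = 0"
  shows "prob_space \<mu>"
proof
  have "(0 :: complex ^ 'a) \<in> polydisk" by (simp add: polydisk_def)
  then have "Re ((1 + f 0) / (1 - f 0)) = (\<integral>\<zeta>. poisson_kernel 0 \<zeta> \<partial>\<mu>)"
    using assms(1) unfolding poisson_measure_def by blast
  then have "(\<integral>\<zeta>. 1 \<partial>\<mu>) = (1 :: real)" using assms(2) by (simp add: poisson_kernel_def)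
  then have 1: "measure \<mu> (space \<mu>) = 1" by simp
  then have "emeasure \<mu> (space \<mu>) \<noteq> \<infinity>" by (auto simp: measure_def)
  then show "emeasure \<mu> (space \<mu>) = 1"
    using 1 by (simp add: emeasure_eq_ennreal_measure)
qed

text \<open>
  The last term is written with the factor \<open>- 1\<close> so that it has the form \<open>1 + g\<close> to which the mean value
  zero applies.
\<close>

lemma ln_Re_cayley:
  assumes "norm a < 1"
  shows "ln (Re ((1 + a) / (1 - a))) = ln (1 - (norm a)\<^sup>2) - 2 * ln (norm (1 + - 1 * a))"
proof -
  have ne: "1 - a \<noteq> 0" using assms by auto
  have sq: "0 < 1 - (norm a)\<^sup>2" using assms by (simp add: abs_square_less_1)
  have "Re ((1 + a) / (1 - a)) = (1 - (norm a)\<^sup>2) / (norm (1 - a))\<^sup>2"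
    unfolding cmod_power2 by (simp add: Re_divide power2_eq_square algebra_simps)
  then show ?thesis using sq ne by (simp add: ln_div ln_realpow)
qed

context torus_probability begin

lemma lebesgue_part_facts:
  assumes dec: "lebesgue_decomposition \<mu> \<tau> w \<sigma>"
  shows "w \<in> borel_measurable \<tau>" "AE x in \<tau>. 0 \<le> w x"
    "(\<integral>\<^sup>+x. ennreal (w x) \<partial>\<tau>) \<le> 1" "integrable \<tau> w"
    and "\<And>A. A \<in> sets torus_borel \<Longrightarrow> emeasure (density \<tau> (\<lambda>x. ennreal (w x))) A \<le> emeasure \<mu> A"
proof -
  show w: "w \<in> borel_measurable \<tau>" and w0: "AE x in \<tau>. 0 \<le> w x"
    using dec by (auto simp: lebesgue_decomposition_def)
  show le: "emeasure (density \<tau> (\<lambda>x. ennreal (w x))) A \<le> emeasure \<mu> A"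
    if "A \<in> sets torus_borel" for A
    using dec that sets_eq by (simp add: lebesgue_decomposition_def)
  have top: "(torus :: (complex ^ 'd) set) \<in> sets torus_borel"
    using sets.top[of torus_borel] by simp
  have "(\<integral>\<^sup>+x. ennreal (w x) \<partial>\<tau>) = emeasure (density \<tau> (\<lambda>x. ennreal (w x))) torus"
    using w top by (subst emeasure_density) (auto intro!: nn_integral_cong)
  also have "\<dots> \<le> emeasure \<mu> torus"
    by (rule le[OF top])
  also have "\<dots> \<le> 1" using emeasure_space_1 by (simp add: space_eq)
  finally show w1: "(\<integral>\<^sup>+x. ennreal (w x) \<partial>\<tau>) \<le> 1" .
  then have "(\<integral>\<^sup>+x. ennreal (w x) \<partial>\<tau>) < \<infinity>" by (rule order_le_less_trans) simp
  then show "integrable \<tau> w"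
    by (intro integrableI_nonneg w w0)
qed

lemma lebesgue_part_le:
  assumes dec: "lebesgue_decomposition \<mu> \<tau> w \<sigma>"
    and P: "continuous_on torus P" "\<And>x. x \<in> torus \<Longrightarrow> 0 \<le> P x"
  shows "(\<integral>x. P x * w x \<partial>\<tau>) \<le> (\<integral>x. P x \<partial>\<mu>)"
proof -
  note w = lebesgue_part_facts[OF dec]
  let ?D = "density \<tau> (\<lambda>x. ennreal (w x))"
  have Pi: "integrable \<tau> P" "integrable \<mu> P"
    using P(1) by (auto intro: integrable_torus_lebesgue_continuous integrable_continuous)
  obtain B where B: "\<And>x. x \<in> torus \<Longrightarrow> \<bar>P x\<bar> \<le> B"
    using compact_imp_bounded[OF compact_continuous_image[OF P(1) compact_torus]] by (auto simp: bounded_iff)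
  have ae: "AE x in \<tau>. 0 \<le> P x * w x"
    using w(2) AE_space by eventually_elim (use P(2) in auto)
  have int: "integrable \<tau> (\<lambda>x. P x * w x)"
  proof (rule Bochner_Integration.integrable_bound[of _ "\<lambda>x. B * w x"])
    show "integrable \<tau> (\<lambda>x. B * w x)" using w(4) by simp
    show "(\<lambda>x. P x * w x) \<in> borel_measurable \<tau>"
      using w(1) Pi(1) by (intro borel_measurable_times) auto
    show "AE x in \<tau>. norm (P x * w x) \<le> norm (B * w x)"
    proof (rule AE_I2)
      fix x :: "complex ^ 'd" assume "x \<in> space \<tau>"
      then have "\<bar>P x\<bar> \<le> \<bar>B\<bar>" using B[of x] by simp
      then show "norm (P x * w x) \<le> norm (B * w x)" by (simp add: abs_mult mult_right_mono)
    qed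
  qed
  have "ennreal (\<integral>x. P x * w x \<partial>\<tau>) = (\<integral>\<^sup>+x. ennreal (P x * w x) \<partial>\<tau>)"
    by (rule nn_integral_eq_integral[OF int ae, symmetric])
  also have "\<dots> = (\<integral>\<^sup>+x. ennreal (w x) * ennreal (P x) \<partial>\<tau>)"
    by (rule nn_integral_cong_AE) (use w(2) AE_space in eventually_elim, use P(2) in \<open>simp add: ennreal_mult mult.commute\<close>)
  also have "\<dots> = (\<integral>\<^sup>+x. ennreal (P x) \<partial>?D)"
    by (rule nn_integral_density[symmetric]) (use w(1) Pi(1) in auto)
  also have "\<dots> \<le> (\<integral>\<^sup>+x. ennreal (P x) \<partial>\<mu>)"
  proof (rule nn_integral_mono_measure)
    show "sets ?D = sets \<mu>" by (simp add: sets_eq)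
    then show "?D \<le> \<mu>" using w(5) by (subst le_measure) (auto simp: sets_eq)
  qed
  also have "\<dots> = ennreal (\<integral>x. P x \<partial>\<mu>)"
    by (rule nn_integral_eq_integral[OF Pi(2)]) (use P(2) space_eq in \<open>auto intro!: AE_I2\<close>)
  finally show ?thesis
    by (subst (asm) ennreal_le_iff) (use P(2) space_eq in \<open>auto intro!: integral_nonneg_AE AE_I2\<close>)
qed

lemma log_integral_upper:
  assumes dec: "lebesgue_decomposition \<mu> \<tau> w \<sigma>" and \<rho>: "0 < \<rho>" "\<rho> < 1"
  shows "ereal_integral \<tau> (\<lambda>\<zeta>. log_ereal (w \<zeta>)) \<le>
    ereal (\<integral>\<zeta>. ln (poisson_integral \<rho> \<mu> \<zeta>) \<partial>\<tau>)"
proof -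
  note w = lebesgue_part_facts[OF dec]
  have wf: "(\<integral>\<^sup>+x. ennreal (w x) \<partial>\<tau>) < \<infinity>"
    using w(3) by (rule order_le_less_trans) simp
  have r: "0 \<le> \<rho>" using \<rho> by simp
  have dom: "(\<integral>\<eta>. torus_poisson \<rho> \<zeta> \<eta> * w \<eta> \<partial>\<tau>) \<le> poisson_integral \<rho> \<mu> \<zeta>"
    if "\<zeta> \<in> torus" for \<zeta>
    unfolding poisson_integral_def
    by (rule lebesgue_part_le[OF dec continuous_torus_poisson[OF r \<rho>(2) that]])
      (rule less_imp_le[OF torus_poisson_pos[OF r \<rho>(2) that]])
  show ?thesis
    using ereal_integral_log_cases[OF w(1) wf] log_integral_le_log_poisson_integral[OF \<rho> w(4) _ _ dom]
    by auto
qed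

text \<open>
  The optimal \<open>v\<close> in the variational bound is \<open>1 / w\<close> on a set \<open>A\<close> carrying the absolutely continuous part,
  and \<open>0\<close> on its complement, which carries \<open>\<sigma>\<close>. Truncating \<open>w\<close> to \<open>[1 / m, m]\<close> and taking \<open>1 / m\<close> on
  the complement makes \<open>v\<close> admissible and costs at most \<open>2 / m\<close>, because \<open>w\<close> divided by its truncation
  is at most \<open>1 + w / m\<close>.
\<close>

lemma truncated_log_lower_bound:
  assumes dec: "lebesgue_decomposition \<mu> \<tau> w \<sigma>" and m: "1 \<le> m"
    and L: "\<And>\<rho>. 0 < \<rho> \<Longrightarrow> \<rho> < 1 \<Longrightarrow> L \<le> (\<integral>\<zeta>. ln (poisson_integral \<rho> \<mu> \<zeta>) \<partial>\<tau>)"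
  shows "L \<le> (\<integral>\<zeta>. ln (max (1 / m) (min m (w \<zeta>))) \<partial>\<tau>) + 2 / m"
proof -
  note w = lebesgue_part_facts[OF dec]
  let ?D = "density \<tau> (\<lambda>x. ennreal (w x))"
  let ?c = "\<lambda>x. max (1 / m) (min m (w x))"
  have m0: "0 < m" "1 / m \<le> m" using m mult_mono[of 1 m 1 m] by (simp_all add: divide_le_eq)
  obtain A where A: "A \<in> sets torus_borel" "emeasure \<sigma> A = 0" "emeasure \<tau> (torus - A) = 0"
    using dec unfolding lebesgue_decomposition_def mutually_singular_def by auto
  define v where "v x = (if x \<in> A then 1 / ?c x else 1 / m)" for x
  have c: "1 / m \<le> ?c x" "?c x \<le> m" "0 < ?c x" for x
    using m0 by (auto simp: less_max_iff_disj)
  have wm: "w \<in> borel_measurable torus_borel" using w(1) by (simp cong: measurable_cong_sets)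
  have vm: "v \<in> borel_measurable torus_borel"
    unfolding v_def using A(1) wm by measurable
  have vb: "1 / m \<le> v x \<and> v x \<le> m" for x
  proof -
    have "1 / m \<le> 1 / ?c x" using c[of x] m0 by (intro divide_left_mono) auto
    moreover have "1 / ?c x \<le> 1 / (1 / m)" using c[of x] m0 by (intro divide_left_mono) auto
    ultimately show ?thesis using m0 by (simp add: v_def)
  qed
  have v0: "0 \<le> v x" for x using vb[of x] m0 by (meson divide_nonneg_nonneg less_imp_le order_trans zero_le_one)
  have "L \<le> (\<integral>x. - ln (v x) \<partial>\<tau>) + (\<integral>x. v x \<partial>\<mu>) - 1"
    by (rule entropy_bound_borel[OF L vm vb]) (use m0 in auto)
  moreover have "(\<integral>x. - ln (v x) \<partial>\<tau>) = (\<integral>x. ln (?c x) \<partial>\<tau>)"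
  proof (rule integral_cong_AE)
    have "torus - A \<in> null_sets \<tau>"
      using A by (auto simp: null_sets_def intro: sets.compl_sets[of A torus_borel, simplified])
    then have "AE x in \<tau>. x \<notin> torus - A" by (rule AE_not_in)
    then show "AE x in \<tau>. - ln (v x) = ln (?c x)"
      using AE_space by eventually_elim (use c in \<open>simp add: v_def ln_div less_imp_neq[symmetric]\<close>)
  qed (use vm wm in \<open>simp_all cong: measurable_cong_sets\<close>)
  moreover have "(\<integral>x. v x \<partial>\<mu>) \<le> 1 + 2 / m"
  proof -
    have Am: "A \<in> sets \<mu>" "A \<in> sets ?D" using A(1) sets_eq by auto
    \<comment> \<open>On \<open>A\<close> the measure \<open>\<mu>\<close> is absolutely continuous with density \<open>w\<close>.\<close>
    have eqA: "density \<mu> (indicator A) = density ?D (indicator A)"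
    proof (rule measure_eqI)
      show "sets (density \<mu> (indicator A)) = sets (density ?D (indicator A))" by (simp add: sets_eq)
      fix X assume "X \<in> sets (density \<mu> (indicator A))"
      then have X: "X \<in> sets \<mu>" "X \<in> sets ?D" using sets_eq by auto
      have "emeasure \<sigma> (A \<inter> X) = 0"
      proof -
        have "sets \<sigma> = sets torus_borel"
          using dec unfolding lebesgue_decomposition_def mutually_singular_def by simp
        then have "emeasure \<sigma> (A \<inter> X) \<le> emeasure \<sigma> A" using A(1) by (intro emeasure_mono) auto
        then show ?thesis using A(2) by simp
      qed
      then have "emeasure \<mu> (A \<inter> X) = emeasure ?D (A \<inter> X)"
        using dec Am X unfolding lebesgue_decomposition_def by (simp add: sets.Int)
      then show "emeasure (density \<mu> (indicator A)) X = emeasure (density ?D (indicator A)) X"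
        using emeasure_restricted[OF Am(1) X(1)] emeasure_restricted[OF Am(2) X(2)] by simp
    qed
    have vm': "(\<lambda>x. ennreal (v x)) \<in> borel_measurable N" if "sets N = sets torus_borel" for N
      using vm that by (simp cong: measurable_cong_sets)
    have "(\<integral>\<^sup>+x. ennreal (v x) \<partial>\<mu>) \<le> (\<integral>\<^sup>+x. indicator A x * ennreal (v x) + ennreal (1 / m) \<partial>\<mu>)"
      by (intro nn_integral_mono) (simp add: v_def indicator_def)
    also have "\<dots> = (\<integral>\<^sup>+x. indicator A x * ennreal (v x) \<partial>\<mu>) + ennreal (1 / m)"
      using Am vm'[OF sets_eq] emeasure_space_1 by (subst nn_integral_add) auto
    also have "(\<integral>\<^sup>+x. indicator A x * ennreal (v x) \<partial>\<mu>) = (\<integral>\<^sup>+x. ennreal (v x) \<partial>density \<mu> (indicator A))"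
      by (rule nn_integral_density[symmetric]) (use Am vm'[OF sets_eq] in auto)
    also have "\<dots> = (\<integral>\<^sup>+x. indicator A x * ennreal (v x) \<partial>?D)"
      unfolding eqA by (rule nn_integral_density) (use Am vm' in auto)
    also have "\<dots> = (\<integral>\<^sup>+x. ennreal (w x) * (indicator A x * ennreal (v x)) \<partial>\<tau>)"
      by (rule nn_integral_density) (use A(1) vm' w(1) in auto)
    also have "\<dots> \<le> (\<integral>\<^sup>+x. 1 + ennreal (1 / m) * ennreal (w x) \<partial>\<tau>)"
    proof (rule nn_integral_mono_AE, use w(2) in eventually_elim)
      fix x :: "complex ^ 'd" assume wx: "0 \<le> w x"
      have "w x * (1 / ?c x) \<le> 1 + 1 / m * w x"
      proof (cases "w x \<le> m")
        case True
        then have "w x \<le> ?c x" by simp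
        then have "w x * (1 / ?c x) \<le> 1" using c(3)[of x] by (simp add: divide_le_eq)
        moreover have "0 \<le> 1 / m * w x" using wx m0 by simp
        ultimately show ?thesis by linarith
      next
        case False
        then have "?c x = m" using m0 by (simp add: max_def)
        then show ?thesis using m0 by simp
      qed
      then have "ennreal (w x * (1 / ?c x)) \<le> ennreal (1 + 1 / m * w x)" by (rule ennreal_leI)
      moreover have "ennreal (w x * (1 / ?c x)) = ennreal (w x) * ennreal (1 / ?c x)"
        using wx c(3)[of x] by (intro ennreal_mult) auto
      moreover have "ennreal (1 + 1 / m * w x) = 1 + ennreal (1 / m) * ennreal (w x)"
        using wx m0 by (subst ennreal_plus) (simp_all flip: ennreal_mult)
      ultimately have "ennreal (w x) * ennreal (1 / ?c x) \<le> 1 + ennreal (1 / m) * ennreal (w x)"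
        by simp
      then show "ennreal (w x) * (indicator A x * ennreal (v x)) \<le> 1 + ennreal (1 / m) * ennreal (w x)"
        by (simp add: v_def indicator_def)
    qed
    also have "\<dots> = 1 + ennreal (1 / m) * (\<integral>\<^sup>+x. ennreal (w x) \<partial>\<tau>)"
      using w(1) T.emeasure_space_1 by (subst nn_integral_add) (auto simp: nn_integral_cmult)
    also have "\<dots> \<le> 1 + ennreal (1 / m) * 1"
      by (intro add_left_mono mult_left_mono w(3)) simp
    also have "1 + ennreal (1 / m) * 1 + ennreal (1 / m) = ennreal (1 + 2 / m)"
    proof -
      have "ennreal (1 + 1 / m) = 1 + ennreal (1 / m)" using m0 by (subst ennreal_plus) simp_all
      moreover have "ennreal (1 + 2 / m) = ennreal (1 + 1 / m) + ennreal (1 / m)"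
        using m0 by (subst ennreal_plus[symmetric]) simp_all
      ultimately show ?thesis by simp
    qed
    finally have "(\<integral>\<^sup>+x. ennreal (v x) \<partial>\<mu>) \<le> ennreal (1 + 2 / m)" by (simp add: add_right_mono)
    then show ?thesis
      using vm'[OF sets_eq] v0 m0 vm sets_eq
      by (subst integral_eq_nn_integral) (auto simp: enn2real_leI cong: measurable_cong_sets)
  qed
  ultimately show ?thesis by linarith
qed

text \<open>
  Fatou's lemma for the truncated negative parts shows first that \<open>log w\<close> is integrable; then dominated
  convergence removes the truncation.
\<close>

lemma log_integral_lower:
  assumes dec: "lebesgue_decomposition \<mu> \<tau> w \<sigma>"
    and L: "\<And>\<rho>. 0 < \<rho> \<Longrightarrow> \<rho> < 1 \<Longrightarrow> L \<le> (\<integral>\<zeta>. ln (poisson_integral \<rho> \<mu> \<zeta>) \<partial>\<tau>)"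
  shows "ereal L \<le> ereal_integral \<tau> (\<lambda>\<zeta>. log_ereal (w \<zeta>))"
proof -
  note w = lebesgue_part_facts[OF dec]
  have wf: "(\<integral>\<^sup>+x. ennreal (w x) \<partial>\<tau>) < \<infinity>"
    using w(3) by (rule order_le_less_trans) simp
  have wint: "(\<integral>x. w x \<partial>\<tau>) \<le> 1"
    using w(3) nn_integral_eq_integral[OF w(4,2)] by (simp add: ennreal_le_1)
  define m where "m k = real (Suc k)" for k
  have m: "1 \<le> m k" for k by (simp add: m_def)
  have m0: "0 < m k" "1 / m k \<le> 1" "0 < 1 / m k" for k by (simp_all add: m_def)
  let ?c = "\<lambda>k x. max (1 / m k) (min (m k) (w x))"
  have L': "L \<le> (\<integral>x. ln (?c k x) \<partial>\<tau>) + 2 / m k" for k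
    by (rule truncated_log_lower_bound[OF dec m L])
  have mm: "1 / m k \<le> m k" for k using m0(2)[of k] m[of k] by linarith
  have cb: "1 / m k \<le> ?c k x" "?c k x \<le> m k" for k x using mm[of k] by simp_all
  have cint: "integrable \<tau> (\<lambda>x. ln (?c k x))" for k
  proof (rule T.integrable_const_bound[of _ "ln (m k)"])
    show "AE x in \<tau>. norm (ln (?c k x)) \<le> ln (m k)"
    proof (rule AE_I2)
      fix x
      have "ln (1 / m k) \<le> ln (?c k x)" "ln (?c k x) \<le> ln (m k)"
        using cb[of k x] m0[of k] by (subst ln_le_cancel_iff; linarith)+
      then show "norm (ln (?c k x)) \<le> ln (m k)" using m0(1)[of k] by (simp add: ln_div)
    qed
  qed (use w(1) in measurable)
  define p where "p k x = max 0 (- ln (max (1 / m k) (w x)))" for k x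
  have pm: "p k \<in> borel_measurable \<tau>" for k
    unfolding p_def using w(1) by measurable
  have N: "(\<integral>\<^sup>+x. e2ennreal (- log_ereal (w x)) \<partial>\<tau>) \<noteq> \<infinity>"
  proof -
    have pt: "AE x in \<tau>. p k x \<le> w x - ln (?c k x)" for k
      using w(2)
    proof eventually_elim
      fix x assume x: "0 \<le> w x"
      show "p k x \<le> w x - ln (?c k x)"
      proof (cases "w x \<le> m k")
        case True
        then have eq: "?c k x = max (1 / m k) (w x)" by simp
        have "ln (?c k x) \<le> w x"
        proof (cases "w x \<le> 1 / m k")
          case True
          then have "?c k x = 1 / m k" unfolding eq by simp
          then have "ln (?c k x) = - ln (m k)" using m0(1)[of k] by (simp add: ln_div)
          moreover have "0 \<le> ln (m k)" using m[of k] by simp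
          ultimately show ?thesis using x by linarith
        next
          case False
          then have "?c k x = w x" "0 < w x" unfolding eq using m0(3)[of k] by linarith+
          then show ?thesis using ln_le_minus_one[of "w x"] by simp
        qed
        then show ?thesis unfolding p_def eq[symmetric] using x by simp
      next
        case False
        then have eq: "?c k x = m k" "max (1 / m k) (w x) = w x" using m0[of k] m[of k] by linarith+
        have "ln (m k) \<le> ln (w x)"
          using False m0(1)[of k] by (subst ln_le_cancel_iff) linarith+
        moreover have "ln (w x) \<le> w x - 1"
          using False m0(1)[of k] by (intro ln_le_minus_one) linarith
        moreover have "0 \<le> ln (w x)" using False m[of k] by simp
        ultimately show ?thesis unfolding p_def eq by simp
      qed
    qed
    \<comment> \<open>The constant is \<open>1\<close> for the integral of \<open>w\<close> plus \<open>2\<close> for the largest value of \<open>2 / m k\<close>.\<close>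
    have bound: "(\<integral>\<^sup>+x. ennreal (p k x) \<partial>\<tau>) \<le> ennreal (3 - L)" for k
    proof -
      have d: "integrable \<tau> (\<lambda>x. w x - ln (?c k x))"
        by (intro Bochner_Integration.integrable_diff w(4) cint)
      have "(\<integral>\<^sup>+x. ennreal (p k x) \<partial>\<tau>) \<le> (\<integral>\<^sup>+x. ennreal (w x - ln (?c k x)) \<partial>\<tau>)"
        by (rule nn_integral_mono_AE) (use pt[of k] in eventually_elim, rule ennreal_leI)
      also have "\<dots> = ennreal (\<integral>x. w x - ln (?c k x) \<partial>\<tau>)"
      proof (rule nn_integral_eq_integral[OF d])
        show "AE x in \<tau>. 0 \<le> w x - ln (?c k x)"
          using pt[of k]
        proof eventually_elim
          fix x assume "p k x \<le> w x - ln (?c k x)"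
          moreover have "0 \<le> p k x" by (simp add: p_def)
          ultimately show "0 \<le> w x - ln (?c k x)" by linarith
        qed
      qed
      also have "(\<integral>x. w x - ln (?c k x) \<partial>\<tau>) = (\<integral>x. w x \<partial>\<tau>) - (\<integral>x. ln (?c k x) \<partial>\<tau>)"
        by (rule Bochner_Integration.integral_diff[OF w(4) cint])
      also have "\<dots> \<le> 3 - L"
      proof -
        have "2 / m k \<le> 2" using m[of k] by (simp add: divide_le_eq)
        then show ?thesis using L'[of k] wint by linarith
      qed
      finally show ?thesis by (simp add: ennreal_leI)
    qed
    have lim: "(\<lambda>k. ennreal (p k x)) \<longlonglongrightarrow> e2ennreal (- log_ereal (w x))" for x
    proof (cases "0 < w x")
      case True
      have "(\<lambda>k. 1 / m k) \<longlonglongrightarrow> 0" unfolding m_def by (rule LIMSEQ_Suc[OF lim_1_over_n])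
      then have "\<forall>\<^sub>F k in sequentially. 1 / m k < w x" by (rule order_tendstoD(2)) (rule True)
      then have "\<forall>\<^sub>F k in sequentially. ennreal (p k x) = ennreal (- ln (w x))"
        by eventually_elim (simp add: p_def max_def ennreal_neg)
      then show ?thesis using True by (simp add: log_ereal_def tendsto_eventually)
    next
      case False
      have "p k x = ln (m k)" for k
      proof -
        have "max (1 / m k) (w x) = 1 / m k" using False m0(3)[of k] by (intro max_absorb1) linarith
        moreover have "ln (1 / m k) = - ln (m k)" using m0(1)[of k] by (simp add: ln_div)
        moreover have "0 \<le> ln (m k)" using m[of k] by simp
        ultimately show ?thesis by (simp only: p_def minus_minus max_absorb2)
      qed
      moreover have "(\<lambda>k. ennreal (ln (m k))) \<longlonglongrightarrow> \<infinity>"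
      proof -
        have "filterlim (\<lambda>k. ln (m k)) at_top sequentially"
          unfolding m_def by (rule filterlim_compose[OF ln_at_top filterlim_compose[OF filterlim_real_sequentially filterlim_Suc]])
        then show ?thesis
          by (simp add: ennreal_tendsto_top_eq_at_top)
      qed
      ultimately show ?thesis using False by (simp add: log_ereal_def)
    qed
    have "(\<integral>\<^sup>+x. e2ennreal (- log_ereal (w x)) \<partial>\<tau>) = (\<integral>\<^sup>+x. liminf (\<lambda>k. ennreal (p k x)) \<partial>\<tau>)"
      by (intro nn_integral_cong lim_imp_Liminf[symmetric] lim) simp
    also have "\<dots> \<le> liminf (\<lambda>k. \<integral>\<^sup>+x. ennreal (p k x) \<partial>\<tau>)"
      by (rule nn_integral_liminf) (use pm in measurable)
    also have "\<dots> \<le> liminf (\<lambda>k. ennreal (3 - L))"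
      by (intro Liminf_mono always_eventually allI bound)
    also have "\<dots> < \<infinity>" by (simp add: Liminf_const)
    finally show ?thesis by simp
  qed
  from ereal_integral_log_cases[OF w(1) wf] N
  have pos: "AE x in \<tau>. 0 < w x" and int: "integrable \<tau> (\<lambda>x. ln (w x))"
    and eq: "ereal_integral \<tau> (\<lambda>x. log_ereal (w x)) = ereal (\<integral>x. ln (w x) \<partial>\<tau>)"
    by auto
  have "(\<lambda>k. (\<integral>x. ln (?c k x) \<partial>\<tau>)) \<longlonglongrightarrow> (\<integral>x. ln (w x) \<partial>\<tau>)"
  proof (rule integral_dominated_convergence[where w = "\<lambda>x. \<bar>ln (w x)\<bar>"])
    show "integrable \<tau> (\<lambda>x. \<bar>ln (w x)\<bar>)" using int by simp
    show "AE x in \<tau>. (\<lambda>k. ln (?c k x)) \<longlonglongrightarrow> ln (w x)"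
      using pos
    proof eventually_elim
      fix x assume x: "0 < w x"
      have "(\<lambda>k. 1 / m k) \<longlonglongrightarrow> 0" unfolding m_def by (rule LIMSEQ_Suc[OF lim_1_over_n])
      then have "\<forall>\<^sub>F k in sequentially. 1 / m k < w x" by (rule order_tendstoD(2)) (rule x)
      moreover have "\<forall>\<^sub>F k in sequentially. w x \<le> m k"
      proof -
        obtain n where "w x < real n" using reals_Archimedean2 by blast
        then show ?thesis by (auto simp: eventually_sequentially m_def intro!: exI[of _ n])
      qed
      ultimately have "\<forall>\<^sub>F k in sequentially. ln (?c k x) = ln (w x)"
        by eventually_elim simp
      then show "(\<lambda>k. ln (?c k x)) \<longlonglongrightarrow> ln (w x)" by (rule tendsto_eventually)
    qed
    show "AE x in \<tau>. norm (ln (?c k x)) \<le> \<bar>ln (w x)\<bar>" for k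
      using pos
    proof eventually_elim
      fix x assume x: "0 < w x"
      show "norm (ln (?c k x)) \<le> \<bar>ln (w x)\<bar>"
      proof (cases "1 \<le> w x")
        case True
        moreover from this have "1 / m k \<le> w x" using m0(2)[of k] by linarith
        ultimately have "1 \<le> ?c k x" "?c k x \<le> w x" using m[of k] by auto
        then have "0 \<le> ln (?c k x)" "ln (?c k x) \<le> ln (w x)" using x by (simp_all)
        then show ?thesis by simp
      next
        case False
        then have "w x \<le> 1" "w x \<le> m k" using m[of k] by linarith+
        then have "?c k x \<le> 1" "w x \<le> ?c k x" using m0(2)[of k] by simp_all
        then have "ln (?c k x) \<le> 0" "ln (w x) \<le> ln (?c k x)" using x by (simp_all add: less_le_trans[OF x])
        then show ?thesis by simp
      qed
    qed
  qed (use w(1) in measurable)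
  moreover have "(\<lambda>k. 2 / m k) \<longlonglongrightarrow> 0"
  proof -
    have "(\<lambda>k. 1 / m k) \<longlonglongrightarrow> 0" unfolding m_def by (rule LIMSEQ_Suc[OF lim_1_over_n])
    from tendsto_mult_left[OF this, of 2] show ?thesis by simp
  qed
  ultimately have "(\<lambda>k. (\<integral>x. ln (?c k x) \<partial>\<tau>) + 2 / m k) \<longlonglongrightarrow> (\<integral>x. ln (w x) \<partial>\<tau>) + 0"
    by (rule tendsto_add)
  then have "L \<le> (\<integral>x. ln (w x) \<partial>\<tau>)"
    using LIMSEQ_le_const[of _ "(\<integral>x. ln (w x) \<partial>\<tau>) + 0" L] L' by auto
  then show ?thesis by (simp add: eq)
qed

end

text \<open>
  The partial sums decrease.
\<close>

lemma suminf_ereal_nonpos: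
  fixes t :: "nat \<Rightarrow> real"
  assumes "\<And>j. t j \<le> 0"
  shows "(\<Sum>j. ereal (t j)) = (INF n. ereal (\<Sum>j<n. t j))"
proof -
  have "decseq (\<lambda>n. ereal (\<Sum>j<n. t j))"
    by (rule decseq_SucI) (use assms in simp)
  from LIMSEQ_INF[OF this] have "(\<lambda>j. ereal (t j)) sums (INF n. ereal (\<Sum>j<n. t j))"
    by (simp add: sums_def)
  then show ?thesis by (rule sums_unique[symmetric])
qed

theorem theorem4:
  fixes f :: "complex ^ 'd \<Rightarrow> complex" and r :: "nat \<Rightarrow> complex"
    and \<mu> \<sigma> :: "(complex ^ 'd) measure" and w :: "complex ^ 'd \<Rightarrow> real"
  assumes "standard_schur f r"
    and "poisson_measure f \<mu>"
    and "lebesgue_decomposition \<mu> torus_lebesgue w \<sigma>"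
  shows "ereal_integral torus_lebesgue (\<lambda>\<zeta>. log_ereal (w \<zeta>)) =
    (\<Sum>j. ereal (ln (1 - (norm (r (Suc j)))\<^sup>2)))"
proof -
  have f0: "f 0 = 0" and r1: "\<And>n. norm (r n) < 1" and "schur_parameters f r"
    using assms(1) by (auto simp: standard_schur_def)
  then obtain h \<nu> where h: "h 0 = f" "\<And>n. h n \<in> schur_class" "\<And>n. r n = h n 0"
    "\<And>n z. z \<in> polydisk \<Longrightarrow> h n z = mobius_op (r n) (mult_op (\<nu> (Suc n)) (h (Suc n))) z"
    unfolding schur_parameters_def by blast
  have "h n \<in> hol_maps" for n
    using h(2)[of n] closure_of_subset_topspace[of hol_maps_topology schur_generators]
    by (auto simp: schur_class_def topspace_hol_maps_topology)
  then interpret schur_chain h r \<nu>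
    using r1 h(4) by unfold_locales
  interpret torus_probability \<mu>
    using prob_space_poisson_measure[OF assms(2) f0] assms(2)
    by (simp add: torus_probability_def torus_probability_axioms_def poisson_measure_def)
  have log_poisson: "(\<integral>\<zeta>. ln (poisson_integral \<rho> \<mu> \<zeta>) \<partial>\<tau>) = - log_defect \<rho> f"
    if \<rho>: "0 < \<rho>" "\<rho> < 1" for \<rho>
  proof -
    have p: "0 \<le> \<rho>" using \<rho> by simp
    have fz: "norm (f z) < 1" if "z \<in> polydisk" for z using norm_less_1[OF that, of 0] h(1) by simp
    let ?D = "\<lambda>\<zeta>. - ln (1 - (norm (f (of_real \<rho> *s \<zeta>)))\<^sup>2)"
    let ?L = "\<lambda>\<zeta>. ln (norm (1 + - 1 * f (of_real \<rho> *s \<zeta>)))"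
    have small: "norm (- 1 * f z) < 1" if "z \<in> polydisk" for z using fz[OF that] by simp
    have g0: "- 1 * f 0 = 0" using f0 by simp
    note L = torus_log_mean_zero[where g = "\<lambda>z. - 1 * f z",
        OF holomorphic_on_polydisk_cmult[OF holomorphic[of 0, unfolded h(1)]] small g0 p \<rho>(2)]
    have "ln (poisson_integral \<rho> \<mu> \<zeta>) = - ?D \<zeta> - 2 * ?L \<zeta>" if \<zeta>: "\<zeta> \<in> torus" for \<zeta>
    proof -
      have z: "of_real \<rho> *s \<zeta> \<in> polydisk" using \<rho> \<zeta> by (intro smult_in_polydisk) auto
      have "poisson_integral \<rho> \<mu> \<zeta> = (\<integral>\<eta>. poisson_kernel (of_real \<rho> *s \<zeta>) \<eta> \<partial>\<mu>)"
        unfolding poisson_integral_def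
        by (intro Bochner_Integration.integral_cong refl)
          (use \<zeta> \<rho> space_eq in \<open>simp add: poisson_kernel_eq_torus_poisson\<close>)
      also have "\<dots> = Re ((1 + f (of_real \<rho> *s \<zeta>)) / (1 - f (of_real \<rho> *s \<zeta>)))"
        using assms(2) z by (simp add: poisson_measure_def)
      finally show ?thesis using ln_Re_cayley[OF fz[OF z]] by simp
    qed
    then have "(\<integral>\<zeta>. ln (poisson_integral \<rho> \<mu> \<zeta>) \<partial>\<tau>) = (\<integral>\<zeta>. - ?D \<zeta> - 2 * ?L \<zeta> \<partial>\<tau>)"
      by (intro Bochner_Integration.integral_cong) auto
    also have "\<dots> = - (\<integral>\<zeta>. ?D \<zeta> \<partial>\<tau>) - 2 * (\<integral>\<zeta>. ?L \<zeta> \<partial>\<tau>)"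
    proof -
      have i: "integrable \<tau> ?D" "integrable \<tau> (\<lambda>\<zeta>. 2 * ?L \<zeta>)"
        using continuous_log_h(1)[OF p \<rho>(2), of 0]
        by (intro integrable_torus_lebesgue_continuous, simp only: h(1),
            intro integrable_mult_right integrable_torus_lebesgue_continuous L(2))
      show ?thesis
        using Bochner_Integration.integral_diff[OF Bochner_Integration.integrable_minus[OF i(1)] i(2)]
        by (simp only: Bochner_Integration.integral_minus integral_mult_right_zero)
    qed
    finally show ?thesis using L(1) by (simp only: log_defect_def mult_zero_right diff_zero)
  qed
  let ?X = "ereal_integral \<tau> (\<lambda>\<zeta>. log_ereal (w \<zeta>))"
  let ?t = "\<lambda>j. ln (1 - (norm (r (Suc j)))\<^sup>2)"
  \<comment> \<open>The parameter with index \<open>0\<close> contributes nothing, so the sum may start at \<open>0\<close> or at \<open>1\<close>.\<close>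
  have r0: "r 0 = 0" using h(1,3) f0 by metis
  have sq: "(norm (r n))\<^sup>2 < 1" for n using r1[of n] by (simp add: abs_square_less_1)
  have shift: "(\<Sum>j<Suc n. - ln (1 - (norm (r j))\<^sup>2)) = - (\<Sum>j<n. ?t j)" for n
    by (simp only: sum.lessThan_Suc_shift) (simp add: r0 sum_negf)
  have upper: "?X \<le> ereal (\<Sum>j<n. ?t j)" for n
  proof (rule ereal_le_epsilon2)
    fix \<epsilon> :: real assume "0 < \<epsilon>"
    from exists_radius_partial_sum_le[OF this, of "Suc n"] obtain \<rho> where
      \<rho>: "1 / 2 \<le> \<rho>" "\<rho> < 1" "(\<Sum>j<Suc n. - ln (1 - (norm (r j))\<^sup>2)) \<le> log_defect \<rho> (h 0) + \<epsilon>" by blast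
    have "?X \<le> ereal (- log_defect \<rho> f)"
      using log_integral_upper[OF assms(3), of \<rho>] \<rho>(1,2) log_poisson[of \<rho>] by simp
    also have "\<dots> \<le> ereal (\<Sum>j<n. ?t j) + ereal \<epsilon>"
      using \<rho>(3) unfolding shift h(1) by simp
    finally show "?X \<le> ereal (\<Sum>j<n. ?t j) + ereal \<epsilon>" .
  qed
  have lower: "ereal L \<le> ?X" if L: "\<And>n. L \<le> (\<Sum>j<n. ?t j)" for L
  proof (rule log_integral_lower[OF assms(3)])
    fix \<rho> :: real assume \<rho>: "0 < \<rho>" "\<rho> < 1"
    have "(\<Sum>j<n. - ln (1 - (norm (r j))\<^sup>2)) \<le> - L" for n
    proof (cases n)
      case 0
      then show ?thesis using L[of 0] by simp
    next
      case (Suc k)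
      then show ?thesis using L[of k] shift[of k] by simp
    qed
    from log_defect_le_bounded_sum[OF this, of \<rho>] \<rho>
    show "L \<le> (\<integral>\<zeta>. ln (poisson_integral \<rho> \<mu> \<zeta>) \<partial>\<tau>)"
      using h(1) by (simp add: log_poisson)
  qed
  have "(\<Sum>j. ereal (?t j)) = (INF n. ereal (\<Sum>j<n. ?t j))"
    by (rule suminf_ereal_nonpos) (use sq in \<open>simp add: less_imp_le\<close>)
  also have "\<dots> = ?X"
  proof (rule antisym)
    let ?I = "INF n. ereal (\<Sum>j<n. ?t j)"
    show "?X \<le> ?I" by (rule INF_greatest) (rule upper)
    have I: "?I \<le> ereal (\<Sum>j<n. ?t j)" for n by (rule INF_lower) simp
    show "?I \<le> ?X"
    proof (cases ?I)
      case (real L)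
      then have "L \<le> (\<Sum>j<n. ?t j)" for n using I[of n] by simp
      then show ?thesis unfolding real by (rule lower)
    next
      case PInf
      then show ?thesis using I[of 0] by simp
    next
      case MInf
      then show ?thesis by simp
    qed
  qed
  finally show ?thesis ..
qed

end
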